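(* Let $p\ge 5$ be a prime and $\mathcal{K}$ a complete non-Archimedean field of characteristic $p$. Let $\lambda\in\mathcal{K}$ be not a root of unity and satisfy $|1-\lambda|<1$. Then for all $a_1,a_{p-1}\in\mathcal{K}$, the polynomial $\lambda z+a_1z^2+a_{p-1}z^p\in\mathcal{K}[z]$ is linearizable if and only if $a_1=0$.
   Context: A power series $f(z)=z(\lambda+\sum_{i\ge1}a_iz^i)\in\mathcal{K}[[z]]$ that is locally analytic at $z=0$ (positive radius of convergence) is called (locally) linearizable at $z=0$ if there is a locally analytic (at $z=0$) power series $h(z)=b_0z+b_1z^2+\cdots\in\mathcal{K}[[z]]$ with $b_0\neq0$ such that $h\circ f\circ h^{-1}(z)=\lambda z$. *)

theory Defs
  imports "HOL-Analysis.Analysis" "HOL-Computational_Algebra.Polynomial_FPS"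
begin

text \<open>
  The normed classes of the library are all built over the reals and hence force
  characteristic 0, and the constant \<^const>\<open>norm\<close> is constrained to them. Here \<open>absval\<close> is a
  non-Archimedean absolute value on a field, and the metric and topology are those induced by it;
  its definiteness and nonnegativity are inherited from \<^class>\<open>metric_space\<close>. The trivial
  absolute value is not excluded by the class.
\<close>

class nonarch_field = field + metric_space +
  fixes absval :: "'a \<Rightarrow> real"
  assumes dist_absval: "dist x y = absval (x - y)"
    and absval_mult: "absval (x * y) = absval x * absval y"
    and absval_add_le: "absval (x + y) \<le> max (absval x) (absval y)"

class complete_nonarch_field = nonarch_field + complete_space

text \<open>
  The Cauchy--Hadamard radius of convergence. The library constant \<^const>\<open>conv_radius\<close> depends
  only on the norms of the coefficients, but is restricted to Banach spaces; it is therefore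
  applied to the real sequence of absolute values.
\<close>

definition nonarch_conv_radius :: "'a::complete_nonarch_field fps \<Rightarrow> ereal" where
  "nonarch_conv_radius f = conv_radius (\<lambda>n. absval (fps_nth f n))"

definition locally_analytic :: "'a::complete_nonarch_field fps \<Rightarrow> bool" where
  "locally_analytic f \<longleftrightarrow> nonarch_conv_radius f > 0"

text \<open>
  The multiplier \<open>\<lambda>\<close> is the linear coefficient of \<open>f\<close>. As \<open>h\<close> has zero constant and nonzero linear
  coefficient, \<^term>\<open>fps_inv h\<close> is its two-sided compositional inverse.
\<close>

definition linearizable :: "'a::complete_nonarch_field fps \<Rightarrow> bool" where
  "linearizable f \<longleftrightarrow>
     locally_analytic f \<and> fps_nth f 0 = 0 \<and>
     (\<exists>h. locally_analytic h \<and> fps_nth h 0 = 0 \<and> fps_nth h 1 \<noteq> 0 \<and>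
          h oo f oo fps_inv h = fps_const (fps_nth f 1) * fps_X)"

text \<open>
  The radius defined above is the radius of convergence of the series in the field itself:
\<close>

lemma absval_one: "absval (1::'a::nonarch_field) = 1"
proof -
  have "absval (1::'a) \<noteq> 0"
    using dist_absval[of "1::'a" 0] by (metis diff_zero dist_eq_0_iff zero_neq_one)
  then show ?thesis using absval_mult[of "1::'a" 1] by simp
qed

lemma absval_power: "absval ((x::'a::nonarch_field) ^ n) = absval x ^ n"
  by (induction n) (simp_all add: absval_mult absval_one)

lemma absval_nonneg [simp]: "absval (x::'a::nonarch_field) \<ge> 0"
  using zero_le_dist[of x 0] unfolding dist_absval by simp

lemma absval_sum_le:
  fixes g :: "nat \<Rightarrow> 'a::nonarch_field"
  shows "absval (sum g {m..<n}) \<le> (\<Sum>i=m..<n. absval (g i))"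
proof (induction n)
  case 0
  then show ?case using dist_absval[of "0::'a" 0] by simp
next
  case (Suc n)
  have "absval (x + y) \<le> absval x + absval y" for x y :: 'a
    using absval_add_le[of x y] absval_nonneg[of x] absval_nonneg[of y]
    by linarith
  from this[of "sum g {m..<n}" "g n"] show ?case
    using Suc dist_absval[of "0::'a" 0] by (cases "m \<le> n") auto
qed

lemma summable_in_nonarch_conv_radius:
  fixes f :: "'a::complete_nonarch_field fps"
  assumes "ereal (absval z) < nonarch_conv_radius f"
  shows "summable (\<lambda>n. fps_nth f n * z ^ n)"
proof -
  let ?g = "\<lambda>n. fps_nth f n * z ^ n"
  have "summable (\<lambda>n. absval (fps_nth f n) * absval z ^ n)"
    using assms unfolding nonarch_conv_radius_def
    by (intro summable_in_conv_radius) simp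
  then have s: "summable (\<lambda>n. absval (?g n))"
    by (simp add: absval_mult absval_power)
  have "Cauchy (\<lambda>n. sum ?g {..<n})"
  proof (rule metric_CauchyI)
    fix e :: real assume "e > 0"
    then obtain N where N: "\<And>m n. m \<ge> N \<Longrightarrow> norm (\<Sum>i=m..<n. absval (?g i)) < e"
      using s unfolding summable_Cauchy by blast
    have *: "dist (sum ?g {..<m}) (sum ?g {..<n}) < e" if "N \<le> n" "n \<le> m" for m n
    proof -
      have "dist (sum ?g {..<m}) (sum ?g {..<n}) = absval (sum ?g {n..<m})"
        unfolding dist_absval using that by (simp add: sum_diff_nat_ivl atLeast0LessThan[symmetric])
      also have "\<dots> \<le> norm (\<Sum>i=n..<m. absval (?g i))"
        using absval_sum_le[of ?g n m] by simp
      also have "\<dots> < e" using N that by blast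
      finally show ?thesis .
    qed
    show "\<exists>M. \<forall>m\<ge>M. \<forall>n\<ge>M. dist (sum ?g {..<m}) (sum ?g {..<n}) < e"
    proof (intro exI[of _ N] allI impI)
      fix m n assume "N \<le> m" "N \<le> n"
      then show "dist (sum ?g {..<m}) (sum ?g {..<n}) < e"
        using *[of n m] *[of m n] by (cases "n \<le> m") (simp_all add: dist_commute)
    qed
  qed
  then show ?thesis
    using Cauchy_convergent summable_iff_convergent by blast
qed

lemma nonarch_conv_radius_ge:
  fixes f :: "'a::complete_nonarch_field fps"
  assumes "summable (\<lambda>n. fps_nth f n * z ^ n)"
  shows "ereal (absval z) \<le> nonarch_conv_radius f"
proof -
  let ?g = "\<lambda>n. fps_nth f n * z ^ n"
  let ?S = "\<lambda>n. sum ?g {..<n}"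
  have "Cauchy ?S"
    using assms LIMSEQ_imp_Cauchy by (auto simp: summable_def sums_def)
  then obtain N where N: "\<And>m n. m \<ge> N \<Longrightarrow> n \<ge> N \<Longrightarrow> dist (?S m) (?S n) < 1"
    using metric_CauchyD[of ?S 1] by auto
  have "absval (?g n) < 1" if "n \<ge> N" for n
    using N[of "Suc n" n] that by (simp add: dist_absval)
  then have B: "absval (fps_nth f n) * absval z ^ n < 1" if "n \<ge> N" for n
    using that by (simp add: absval_mult absval_power)
  have "ereal r \<le> nonarch_conv_radius f" if r: "0 < r" "r < absval z" for r
  proof -
    have "summable (\<lambda>n. absval (fps_nth f n) * r ^ n)"
    proof (rule summable_comparison_test)
      show "summable (\<lambda>n. (r / absval z) ^ n)"
        using r by (intro summable_geometric) simp
      show "\<exists>M. \<forall>n\<ge>M. norm (absval (fps_nth f n) * r ^ n) \<le> (r / absval z) ^ n"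
      proof (intro exI[of _ N] allI impI)
        fix n assume "N \<le> n"
        from B[OF this] have "absval (fps_nth f n) * absval z ^ n * (r / absval z) ^ n \<le> 1 * (r / absval z) ^ n"
          using r by (intro mult_right_mono) auto
        then show "norm (absval (fps_nth f n) * r ^ n) \<le> (r / absval z) ^ n"
          using r by (simp add: power_divide)
      qed
    qed
    then show ?thesis
      unfolding nonarch_conv_radius_def using r conv_radius_geI[of _ r] by simp
  qed
  note * = this
  show ?thesis
  proof (rule dense_le)
    fix y :: ereal assume y: "y < ereal (absval z)"
    show "y \<le> nonarch_conv_radius f"
    proof (cases "y \<le> 0")
      case True
      then show ?thesis
        unfolding nonarch_conv_radius_def by (rule order_trans[OF _ conv_radius_nonneg])
    next
      case False
      with y *[of "real_of_ereal y"] show ?thesis by (cases y) auto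
    qed
  qed
qed

end

theory Submission
  imports Defs "HOL-Computational_Algebra.Primes"
begin

text \<open>
  If the quadratic coefficient vanishes, \<open>f\<close> is additive and so is its linearization, whose
  coefficients have only the small divisors \<open>lam ^ (p ^ i) - lam\<close>, all of absolute value
  \<open>\<epsilon> = |1 - lam|\<close>.

  Conversely let \<open>h\<close> linearize \<open>f\<close>. Splitting \<open>h\<close> according to exponents modulo \<open>p ^ s\<close> yields
  cocycles \<open>U s\<close> over Frobenius twists of \<open>f\<close>. Trivializing \<open>U s\<close> without loss of radius means
  writing the reduction of \<open>(U s - 1) / (lam ^ p ^ s - 1)\<close> as a logarithmic derivative, and
  logarithmic derivatives are fixed by the Cartier operator, which no nonzero polynomial without
  constant term is. So once \<open>U s\<close> is too large on a disc inside the domain of \<open>f\<close>, the same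
  obstruction recurs at all higher levels on discs shrinking to \<open>0\<close>, and \<open>h\<close> diverges. Hence
  a convergent \<open>h\<close> has integral coefficients on the largest disc on which
  \<open>|f z - lam z| \<le> \<epsilon> |z|\<close> coefficientwise.

  On that disc either the quadratic term has the critical size, and the Cartier condition at the
  exponents \<open>p\<close> and \<open>2 p\<close>, expanded to third order in \<open>lam - 1\<close>, is violated; or the term
  of degree \<open>p\<close> has the critical size, one conjugates by the linearization of the additive part
  of \<open>f\<close>, and finds a violation at a level \<open>p ^ s\<close> determined by the size of the quadratic term.
\<close>

section \<open>Non-Archimedean absolute values\<close>


text \<open>In characteristic \<open>p\<close> one has \<open>lam ^ q - 1 = (lam - 1) ^ q\<close>
  for \<open>q = p ^ s\<close>. The divisor \<open>lam ^ n - lam\<close> met in solving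
  \<open>h oo f = lam h\<close> for the coefficient at \<open>n\<close> therefore has absolute value
  \<open>\<epsilon> ^ q\<close>, where \<open>q\<close> is the largest power of \<open>p\<close>
  dividing \<open>n - 1\<close>. Such divisors are too small for a majorant argument, and whether
  they do harm depends on cancellations in the numerators. The splitting modulo \<open>p ^ s\<close>
  isolates one size of divisor at a time: passing from \<open>s\<close> to \<open>s + 1\<close>
  solves for the exponents with divisors of size \<open>\<epsilon> ^ p ^ s\<close>, and what remains
  is a series in \<open>z ^ p\<close> of the same kind, over a map whose coefficients are raised to
  the power \<open>p\<close>. Every level is thus the same step with other constants. The gain is
  that convergence, an asymptotic property, becomes an exact bound on a known disc, and
  non-linearizability becomes a finite congruence modulo powers of \<open>lam - 1\<close>. The
  assumption \<open>p \<ge> 5\<close> makes 2 and 3 units; they occur as factors of the leading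
  terms of these congruences.\<close>

lemma absval_zero [simp]: "absval (0 :: 'a::nonarch_field) = 0"
  using dist_absval[of "0::'a" 0] by simp

lemma absval_eq_0_iff [simp]: "absval (x :: 'a::nonarch_field) = 0 \<longleftrightarrow> x = 0"
  using dist_absval[of x 0] by (metis diff_zero dist_eq_0_iff)

lemma absval_pos_iff [simp]: "absval (x :: 'a::nonarch_field) > 0 \<longleftrightarrow> x \<noteq> 0"
  using absval_nonneg[of x] absval_eq_0_iff[of x] by linarith

lemma absval_minus [simp]: "absval (- x :: 'a::nonarch_field) = absval x"
  using dist_absval[of 0 x] dist_absval[of x 0] by (simp add: dist_commute)

lemma absval_minus_commute: "absval (x - y :: 'a::nonarch_field) = absval (y - x)"
  using absval_minus[of "x - y"] by simp

lemma absval_diff_le: "absval (x - y :: 'a::nonarch_field) \<le> max (absval x) (absval y)"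
  using absval_add_le[of x "- y"] by simp

lemma absval_add_bound:
  "absval x \<le> B \<Longrightarrow> absval y \<le> B \<Longrightarrow> absval (x + y :: 'a::nonarch_field) \<le> B"
  using absval_add_le[of x y] by simp

lemma absval_diff_bound:
  "absval x \<le> B \<Longrightarrow> absval y \<le> B \<Longrightarrow> absval (x - y :: 'a::nonarch_field) \<le> B"
  using absval_diff_le[of x y] by simp

lemma absval_inverse: "absval (inverse x :: 'a::nonarch_field) = inverse (absval x)"
proof (cases "x = 0")
  case False
  then have "absval (inverse x) * absval x = 1"
    by (simp flip: absval_mult add: absval_one)
  then show ?thesis by (metis inverse_unique mult.commute)
qed simp

lemma absval_divide: "absval (x / y :: 'a::nonarch_field) = absval x / absval y"
  by (simp add: divide_inverse absval_mult absval_inverse)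

lemma absval_sum_bound:
  fixes g :: "'b \<Rightarrow> 'a::nonarch_field"
  assumes "\<And>i. i \<in> A \<Longrightarrow> absval (g i) \<le> B" "0 \<le> B"
  shows "absval (sum g A) \<le> B"
  using assms(1)
  by (induction A rule: infinite_finite_induct) (auto simp: assms(2) intro: absval_add_bound)

lemma absval_of_nat_le: "absval (of_nat n :: 'a::nonarch_field) \<le> 1"
  by (induction n) (auto simp: absval_one intro!: absval_add_bound)

lemma absval_eqI_near:
  fixes x y :: "'a::nonarch_field"
  assumes "absval (x - y) < absval x"
  shows "absval y = absval x"
proof (rule antisym)
  show "absval y \<le> absval x"
    using absval_diff_le[of x "x - y"] assms by simp
  show "absval x \<le> absval y"
    using absval_add_le[of "x - y" y] assms by simp
qed

lemma absval_power_minus_one_le: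
  fixes \<mu> :: "'a::nonarch_field"
  assumes "absval (\<mu> - 1) \<le> \<delta>" "\<delta> \<le> 1"
  shows "absval (\<mu> ^ k - 1) \<le> \<delta>"
proof (induction k)
  case 0
  show ?case using order_trans[OF absval_nonneg assms(1)] by simp
next
  case (Suc k)
  have "absval \<mu> \<le> 1"
    using absval_add_bound[of "\<mu> - 1" 1 1] assms by (simp add: absval_one)
  then have "absval (\<mu> * (\<mu> ^ k - 1)) \<le> 1 * \<delta>"
    unfolding absval_mult using Suc by (intro mult_mono) auto
  moreover have "\<mu> ^ Suc k - 1 = \<mu> * (\<mu> ^ k - 1) + (\<mu> - 1)"
    by (simp add: algebra_simps)
  ultimately show ?case
    using assms(1) by (simp only: absval_add_bound mult_1)
qed

lemma absval_power_minus_one_approx: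
  fixes \<mu> :: "'a::nonarch_field"
  assumes "absval (\<mu> - 1) \<le> \<delta>" "\<delta> \<le> 1"
  shows "absval (\<mu> ^ k - 1 - of_nat k * (\<mu> - 1)) \<le> \<delta>\<^sup>2"
proof (induction k)
  case 0
  show ?case by simp
next
  case (Suc k)
  have "absval ((\<mu> - 1) * (\<mu> ^ k - 1)) \<le> \<delta> * \<delta>"
    unfolding absval_mult using assms absval_power_minus_one_le[OF assms, of k]
      order_trans[OF absval_nonneg assms(1)]
    by (intro mult_mono) auto
  moreover have "\<mu> ^ Suc k - 1 - of_nat (Suc k) * (\<mu> - 1)
      = (\<mu> ^ k - 1 - of_nat k * (\<mu> - 1)) + (\<mu> - 1) * (\<mu> ^ k - 1)"
    by (simp add: algebra_simps)
  ultimately show ?case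
    using Suc by (simp only: absval_add_bound power2_eq_square)
qed

text \<open>Bezout gives an integer inverse of \<open>n\<close> in the field. Integers have absolute
  value at most 1, so neither factor of the product 1 can be smaller.\<close>

lemma absval_of_nat_unit:
  assumes "prime CHAR('a::nonarch_field)" "\<not> CHAR('a) dvd n"
  shows "absval (of_nat n :: 'a) = 1"
proof -
  from assms have "coprime n CHAR('a)"
    using prime_imp_coprime coprime_commute by blast
  moreover have "n \<noteq> 0" using assms(2) by (metis dvd_0_right)
  ultimately obtain x y where "n * x = CHAR('a) * y + 1"
    using bezout_nat[of n "CHAR('a)"] by (auto simp: coprime_iff_gcd_eq_1)
  then have "of_nat (n * x) = (of_nat (CHAR('a) * y + 1) :: 'a)"
    by (rule arg_cong)
  then have "(of_nat n :: 'a) * of_nat x = 1" by simp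
  then have *: "absval (of_nat n :: 'a) * absval (of_nat x :: 'a) = 1"
    by (metis absval_mult absval_one)
  have "absval (of_nat n :: 'a) * absval (of_nat x :: 'a) \<le> absval (of_nat n :: 'a) * 1"
    by (intro mult_left_mono absval_of_nat_le) simp
  with * absval_of_nat_le[of n] show ?thesis
    by (metis dual_order.antisym mult.right_neutral)
qed

lemma absval_power_minus_one_eq:
  fixes \<mu> :: "'a::nonarch_field"
  assumes "prime CHAR('a)" "\<not> CHAR('a) dvd k" "absval (\<mu> - 1) < 1"
  shows "absval (\<mu> ^ k - 1) = absval (\<mu> - 1)"
proof (cases "\<mu> = 1")
  case False
  let ?\<delta> = "absval (\<mu> - 1)"
  have e: "absval (of_nat k * (\<mu> - 1)) = ?\<delta>"
    using absval_of_nat_unit[OF assms(1,2)] by (simp add: absval_mult)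
  have "absval (of_nat k * (\<mu> - 1) - (\<mu> ^ k - 1)) \<le> ?\<delta>\<^sup>2"
    using absval_power_minus_one_approx[of \<mu> ?\<delta> k] assms(3)
    by (subst absval_minus_commute) auto
  also have "\<dots> < ?\<delta>"
    using assms(3) False by (simp add: power2_eq_square)
  finally show ?thesis
    using absval_eqI_near[of "of_nat k * (\<mu> - 1)" "\<mu> ^ k - 1"] e by simp
qed simp

lemma diff_power_char:
  fixes x y :: "'a::{comm_ring_1}"
  assumes "prime CHAR('a)" "q = CHAR('a) ^ s"
  shows "(x - y) ^ q = x ^ q - y ^ q"
  using freshmans_dream'[OF assms, of "x - y" y] by (simp add: algebra_simps)

lemma of_nat_power_char:
  assumes "prime CHAR('a::comm_semiring_1)"
  shows "(of_nat n :: 'a) ^ CHAR('a) = of_nat n"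
proof (induction n)
  case 0
  show ?case using assms prime_gt_0_nat by (simp add: power_0_left)
next
  case (Suc n)
  then show ?case by (simp add: freshmans_dream[OF assms])
qed


section \<open>Coefficient bounds of geometric type\<close>

text \<open>For \<open>c > 0\<close> the least such \<open>B\<close> is the Gauss norm on the disc
  of radius \<open>1 / c\<close>. A series without constant term and with bound \<open>1 / c\<close>
  maps this disc to itself, which is why \<open>1 / c\<close> recurs as the bound of inner
  functions.\<close>

definition geom_bound :: "real \<Rightarrow> real \<Rightarrow> 'a::nonarch_field fps \<Rightarrow> bool" where
  "geom_bound c B f \<longleftrightarrow> (\<forall>n. absval (fps_nth f n) \<le> B * c ^ n)"

lemma geom_boundD: "geom_bound c B f \<Longrightarrow> absval (fps_nth f n) \<le> B * c ^ n"
  by (simp add: geom_bound_def)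

lemma geom_boundI: "(\<And>n. absval (fps_nth f n) \<le> B * c ^ n) \<Longrightarrow> geom_bound c B f"
  by (simp add: geom_bound_def)

lemma geom_bound_nonneg: "geom_bound c B f \<Longrightarrow> 0 \<le> B"
  using geom_boundD[of c B f 0] absval_nonneg[of "fps_nth f 0"] by (simp del: absval_nonneg)

lemma geom_bound_mono: "geom_bound c B f \<Longrightarrow> B \<le> B' \<Longrightarrow> c > 0 \<Longrightarrow> geom_bound c B' f"
  unfolding geom_bound_def
  by (meson mult_right_mono order_trans zero_le_power less_imp_le)

lemma geom_bound_add: "geom_bound c B f \<Longrightarrow> geom_bound c B g \<Longrightarrow> geom_bound c B (f + g)"
  by (simp add: geom_bound_def absval_add_bound)

lemma geom_bound_diff: "geom_bound c B f \<Longrightarrow> geom_bound c B g \<Longrightarrow> geom_bound c B (f - g)"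
  by (simp add: geom_bound_def absval_diff_bound)

lemma geom_bound_minus [simp]: "geom_bound c B (- f) \<longleftrightarrow> geom_bound c B f"
  by (simp add: geom_bound_def)

lemma geom_bound_diff_commute: "geom_bound c B (f - g) \<longleftrightarrow> geom_bound c B (g - f)"
  using geom_bound_minus[of c B "f - g"] by (simp del: geom_bound_minus)

lemma geom_bound_const: "c > 0 \<Longrightarrow> absval a \<le> B \<Longrightarrow> geom_bound c B (fps_const a)"
  using order_trans[OF absval_nonneg, of a B] by (auto simp: geom_bound_def)

lemma geom_bound_1 [simp]: "c > 0 \<Longrightarrow> geom_bound c 1 1"
  using geom_bound_const[of c 1 1] by (simp add: absval_one)

lemma geom_bound_X: "c > 0 \<Longrightarrow> 1 \<le> B * c \<Longrightarrow> geom_bound c B fps_X"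
  by (auto simp: geom_bound_def fps_X_def absval_one zero_le_mult_iff)
     (smt (verit) mult_nonneg_nonneg zero_le_power mult_nonneg_nonpos2)

lemma geom_bound_mult:
  assumes "geom_bound c B f" "geom_bound c B' g" "c > 0"
  shows "geom_bound c (B * B') (f * g)"
proof (rule geom_boundI)
  fix n
  note nn = geom_bound_nonneg[OF assms(1)] geom_bound_nonneg[OF assms(2)]
  have "absval (fps_nth f i * fps_nth g (n - i)) \<le> B * B' * c ^ n" if "i \<in> {0..n}" for i
  proof -
    have "absval (fps_nth f i * fps_nth g (n - i)) \<le> (B * c ^ i) * (B' * c ^ (n - i))"
      unfolding absval_mult using assms nn by (intro mult_mono geom_boundD) auto
    also have "\<dots> = B * B' * c ^ n"
      using that by (simp add: power_add[symmetric] mult_ac)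
    finally show ?thesis .
  qed
  then show "absval (fps_nth (f * g) n) \<le> B * B' * c ^ n"
    unfolding fps_mult_nth using nn assms(3) by (intro absval_sum_bound) auto
qed

lemma geom_bound_mult_le:
  assumes "geom_bound c B f" "geom_bound c B' g" "c > 0" "B * B' \<le> B''"
  shows "geom_bound c B'' (f * g)"
  using geom_bound_mono[OF geom_bound_mult[OF assms(1-3)] assms(4,3)] .

lemma geom_bound_power:
  "geom_bound c B f \<Longrightarrow> c > 0 \<Longrightarrow> geom_bound c (B ^ n) (f ^ n)"
  by (induction n) (auto intro: geom_bound_mult)

lemma geom_bound_inverse:
  assumes "geom_bound c 1 f" "absval (fps_nth f 0) = 1" "c > 0"
  shows "geom_bound c 1 (inverse f)"
proof -
  have f0: "fps_nth f 0 \<noteq> 0" using assms(2) by auto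
  have "absval (fps_nth (inverse f) n) \<le> 1 * c ^ n" for n
  proof (induction n rule: less_induct)
    case (less n)
    show ?case
    proof (cases "n = 0")
      case True
      then show ?thesis using assms(2) by (simp add: absval_inverse)
    next
      case False
      have "fps_nth (inverse f * f) n = 0"
        using False f0 by (simp add: inverse_mult_eq_1)
      then have "fps_nth (inverse f) n * fps_nth f 0
          = - (\<Sum>i<n. fps_nth (inverse f) i * fps_nth f (n - i))"
        unfolding fps_mult_nth
        by (simp add: atLeast0AtMost lessThan_Suc_atMost[symmetric] eq_neg_iff_add_eq_0 add.commute)
      then have "absval (fps_nth (inverse f) n)
          = absval (\<Sum>i<n. fps_nth (inverse f) i * fps_nth f (n - i))"
        using assms(2) by (metis absval_minus absval_mult mult.right_neutral)
      also have "\<dots> \<le> 1 * c ^ n"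
      proof (rule absval_sum_bound)
        fix i assume i: "i \<in> {..<n}"
        have "absval (fps_nth (inverse f) i * fps_nth f (n - i)) \<le> (1 * c ^ i) * (1 * c ^ (n - i))"
          unfolding absval_mult using assms(3) i
          by (intro mult_mono less geom_boundD assms(1)) auto
        then show "absval (fps_nth (inverse f) i * fps_nth f (n - i)) \<le> 1 * c ^ n"
          using i by (simp add: power_add[symmetric])
      qed (use assms(3) in simp)
      finally show ?thesis .
    qed
  qed
  then show ?thesis by (intro geom_boundI)
qed

lemma geom_bound_deriv:
  assumes "geom_bound c B f" "c > 0"
  shows "geom_bound c (B * c) (fps_deriv f)"
proof (rule geom_boundI)
  fix n
  have "absval (of_nat (Suc n) :: 'a) * absval (fps_nth f (Suc n)) \<le> 1 * (B * c ^ Suc n)"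
    using geom_bound_nonneg[OF assms(1)]
    by (intro mult_mono absval_of_nat_le geom_boundD assms) auto
  then show "absval (fps_nth (fps_deriv f) n) \<le> B * c * c ^ n"
    by (simp add: absval_mult mult_ac del: of_nat_Suc)
qed

lemma geom_bound_X_deriv:
  assumes "geom_bound c B f" "c > 0"
  shows "geom_bound c B (fps_X * fps_deriv f)"
  using geom_bound_mult_le[OF geom_bound_X[of c "1 / c"] geom_bound_deriv[OF assms], of B] assms(2)
  by simp

lemma geom_bound_compose:
  assumes "geom_bound c B g" "geom_bound c (1 / c) f" "c > 0"
  shows "geom_bound c B (g oo f)"
proof (rule geom_boundI)
  fix n
  note B = geom_bound_nonneg[OF assms(1)]
  show "absval (fps_nth (g oo f) n) \<le> B * c ^ n"
    unfolding fps_compose_nth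
  proof (rule absval_sum_bound)
    fix i
    have "absval (fps_nth g i * fps_nth (f ^ i) n) \<le> (B * c ^ i) * ((1 / c) ^ i * c ^ n)"
      unfolding absval_mult using assms B
      by (intro mult_mono geom_boundD geom_bound_power) auto
    then show "absval (fps_nth g i * fps_nth (f ^ i) n) \<le> B * c ^ n"
      using assms(3) by (simp add: power_one_over)
  qed (use B assms(3) in auto)
qed

text \<open>
  The Hasse derivatives, which unlike the iterated derivatives are divided by factorials and
  therefore give a Taylor formula in every characteristic.
\<close>

definition hasse_deriv :: "nat \<Rightarrow> 'a::comm_semiring_1 fps \<Rightarrow> 'a fps" where
  "hasse_deriv j g = Abs_fps (\<lambda>k. of_nat ((k + j) choose j) * fps_nth g (k + j))"

lemma hasse_deriv_0 [simp]: "hasse_deriv 0 g = g"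
  by (simp add: hasse_deriv_def fps_eq_iff)

lemma hasse_deriv_1: "hasse_deriv (Suc 0) g = fps_deriv g"
  by (simp add: hasse_deriv_def fps_eq_iff)

lemma hasse_deriv_2: "2 * hasse_deriv 2 (g :: 'a::comm_ring_1 fps) = fps_deriv (fps_deriv g)"
proof (rule fps_ext)
  fix k
  have "(2 * (k + 2 choose 2)) = (k + 1) * (k + 2)"
    by (simp add: choose_two algebra_simps)
  then have "2 * of_nat (k + 2 choose 2) = (of_nat (k + 1) * of_nat (k + 2) :: 'a)"
    by (metis of_nat_mult of_nat_numeral)
  then have "2 * of_nat (k + 2 choose 2) * fps_nth g (k + 2)
      = of_nat (k + 1) * (of_nat (k + 2) * fps_nth g (k + 2))"
    by (simp only: mult.assoc)
  then show "fps_nth (2 * hasse_deriv 2 g) k = fps_nth (fps_deriv (fps_deriv g)) k"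
    by (simp add: hasse_deriv_def numeral_fps_const mult.assoc)
qed

lemma hasse_deriv_3:
  "6 * hasse_deriv 3 (g :: 'a::comm_ring_1 fps) = fps_deriv (fps_deriv (fps_deriv g))"
proof (rule fps_ext)
  fix k
  have "(6 * (k + 3 choose 3)) = (k + 1) * ((k + 2) * (k + 3))"
  proof (induction k)
    case (Suc k)
    have "6 * (Suc k + 3 choose 3) = 6 * (k + 3 choose 3) + 6 * (k + 3 choose 2)"
      by (simp add: eval_nat_numeral)
    also have "6 * (k + 3 choose 2) = 3 * ((k + 2) * (k + 3))"
    proof -
      have "2 * (k + 3 choose 2) = (k + 2) * (k + 3)"
        by (induction k) (simp_all add: eval_nat_numeral)
      then show ?thesis by simp
    qed
    finally show ?case unfolding Suc by (simp add: algebra_simps)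
  qed simp
  then have "6 * of_nat (k + 3 choose 3) = (of_nat (k + 1) * (of_nat (k + 2) * of_nat (k + 3)) :: 'a)"
    by (metis of_nat_mult of_nat_numeral)
  then have "6 * of_nat (k + 3 choose 3) * fps_nth g (k + 3)
      = of_nat (k + 1) * (of_nat (k + 2) * (of_nat (k + 3) * fps_nth g (k + 3)))"
    by (simp only: mult.assoc)
  moreover have "fps_nth (fps_deriv (fps_deriv (fps_deriv g))) k
      = of_nat (k + 1) * (of_nat (k + 2) * (of_nat (k + 3) * fps_nth g (k + 3)))"
    by (simp only: fps_deriv_nth add.assoc one_add_one numeral_plus_one
        add_num_simps add_One_commute numeral_One)
  ultimately show "fps_nth (6 * hasse_deriv 3 g) k = fps_nth (fps_deriv (fps_deriv (fps_deriv g))) k"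
    by (simp only: hasse_deriv_def numeral_fps_const fps_mult_left_const_nth fps_nth_Abs_fps mult.assoc)
qed

section \<open>Taylor formula with a bound on the remainder\<close>

lemma fps_mult_nth_eq_0:
  fixes f g :: "'a::comm_semiring_1 fps"
  assumes "\<And>n. n < a \<Longrightarrow> fps_nth f n = 0" "\<And>n. n < b \<Longrightarrow> fps_nth g n = 0" "m < a + b"
  shows "fps_nth (f * g) m = 0"
  unfolding fps_mult_nth using assms
  by (intro sum.neutral ballI) (metis add_less_cancel_left atLeastAtMost_iff le_add_diff_inverse
      linorder_not_less mult_not_zero add_le_cancel_right le_trans order_less_le_trans)

lemma mult_compose_nth:
  fixes D G f :: "'a::idom fps"
  assumes "fps_nth f 0 = 0"
  shows "fps_nth (D * (G oo f)) m = (\<Sum>k\<le>m. fps_nth G k * fps_nth (D * f ^ k) m)"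
proof -
  have "fps_nth (G oo f) n = (\<Sum>k\<le>m. fps_nth G k * fps_nth (f ^ k) n)" if "n \<le> m" for n
    unfolding fps_compose_nth using that
    by (intro sum.mono_neutral_left) (auto simp: startsby_zero_power_prefix[OF assms])
  then have "fps_nth (D * (G oo f)) m
      = (\<Sum>a = 0..m. fps_nth D a * (\<Sum>k\<le>m. fps_nth G k * fps_nth (f ^ k) (m - a)))"
    by (simp add: fps_mult_nth)
  also have "\<dots> = (\<Sum>k\<le>m. fps_nth G k * fps_nth (D * f ^ k) m)"
    unfolding fps_mult_nth sum_distrib_left by (subst sum.swap) (simp add: mult_ac)
  finally show ?thesis .
qed

text \<open>The shift \<open>i = k + j\<close> gives the Taylor term of order \<open>j\<close> the
  shape of a summand in the binomial expansions of \<open>(d + f) ^ i\<close>; the vanishing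
  constant terms cut the sum off at \<open>m\<close>.\<close>

lemma mult_hasse_deriv_compose_nth:
  fixes d f g :: "'a::idom fps"
  assumes "fps_nth f 0 = 0" "fps_nth d 0 = 0"
  shows "fps_nth (d ^ j * (hasse_deriv j g oo f)) m
    = (\<Sum>i\<le>m. if j \<le> i then of_nat (i choose j) * fps_nth g i * fps_nth (d ^ j * f ^ (i - j)) m else 0)"
proof -
  let ?t = "\<lambda>i. of_nat (i choose j) * fps_nth g i * fps_nth (d ^ j * f ^ (i - j)) m"
  have "fps_nth (d ^ j * (hasse_deriv j g oo f)) m = (\<Sum>k\<le>m. ?t (k + j))"
    unfolding mult_compose_nth[OF assms(1)] by (simp add: hasse_deriv_def)
  also have "\<dots> = (\<Sum>i\<in>(\<lambda>k. k + j) ` {..m}. ?t i)"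
    by (subst sum.reindex) (auto simp: inj_on_def)
  also have "\<dots> = (\<Sum>i\<in>{j..m}. ?t i)"
  proof (rule sum.mono_neutral_right)
    show "{j..m} \<subseteq> (\<lambda>k. k + j) ` {..m}"
    proof
      fix i assume "i \<in> {j..m}"
      then show "i \<in> (\<lambda>k. k + j) ` {..m}" by (intro image_eqI[of _ _ "i - j"]) auto
    qed
    show "\<forall>i\<in>(\<lambda>k. k + j) ` {..m} - {j..m}. ?t i = 0"
    proof
      fix i assume "i \<in> (\<lambda>k. k + j) ` {..m} - {j..m}"
      then obtain k where k: "i = k + j" "m < k + j" by auto
      have "fps_nth (d ^ j * f ^ k) m = 0"
        using k startsby_zero_power_prefix[OF assms(1)] startsby_zero_power_prefix[OF assms(2)]
        by (intro fps_mult_nth_eq_0[of j _ k]) auto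
      with k show "?t i = 0" by simp
    qed
  qed simp
  also have "\<dots> = (\<Sum>i\<le>m. if j \<le> i then ?t i else 0)"
    by (intro sum.mono_neutral_cong_left) auto
  finally show ?thesis .
qed

text \<open>After subtraction only the binomial summands with \<open>j \<ge> n\<close> survive. Each
  carries a factor \<open>B ^ j\<close>, and binomial coefficients have absolute value at most
  1.\<close>

lemma geom_bound_taylor:
  fixes d f g :: "'a::nonarch_field fps"
  assumes "fps_nth f 0 = 0" "fps_nth d 0 = 0" "c > 0" "B \<le> 1"
    and g: "geom_bound c A g" and f: "geom_bound c (1 / c) f" and d: "geom_bound c (B / c) d"
  shows "geom_bound c (A * B ^ n) ((g oo (f + d)) - (\<Sum>j<n. d ^ j * (hasse_deriv j g oo f)))"
proof (rule geom_boundI)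
  fix m
  let ?t = "\<lambda>i j. of_nat (i choose j) * fps_nth g i * fps_nth (d ^ j * f ^ (i - j)) m"
  have A: "A \<ge> 0" by (rule geom_bound_nonneg[OF g])
  have B: "B \<ge> 0" using geom_bound_nonneg[OF d] assms(3) by (simp add: zero_le_divide_iff)
  have "fps_nth (g oo (f + d)) m = (\<Sum>i\<le>m. fps_nth g i * fps_nth ((d + f) ^ i) m)"
    by (simp add: fps_compose_nth atLeast0AtMost add.commute)
  also have "\<dots> = (\<Sum>i\<le>m. \<Sum>j\<le>i. ?t i j)"
  proof (rule sum.cong[OF refl])
    fix i assume "i \<in> {..m}"
    have "fps_nth (of_nat (i choose j) * d ^ j * f ^ (i - j)) m
        = of_nat (i choose j) * fps_nth (d ^ j * f ^ (i - j)) m" for j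
      by (simp flip: fps_of_nat add: mult.assoc)
    then show "fps_nth g i * fps_nth ((d + f) ^ i) m = (\<Sum>j\<le>i. ?t i j)"
      unfolding binomial_ring by (simp add: fps_sum_nth sum_distrib_left mult_ac)
  qed
  finally have 1: "fps_nth (g oo (f + d)) m = (\<Sum>i\<le>m. \<Sum>j\<le>i. ?t i j)" .
  have "fps_nth (\<Sum>j<n. d ^ j * (hasse_deriv j g oo f)) m
      = (\<Sum>j<n. \<Sum>i\<le>m. if j \<le> i then ?t i j else 0)"
    by (simp add: fps_sum_nth mult_hasse_deriv_compose_nth[OF assms(1,2)])
  also have "\<dots> = (\<Sum>i\<le>m. \<Sum>j<n. if j \<le> i then ?t i j else 0)"
    by (rule sum.swap)
  also have "\<dots> = (\<Sum>i\<le>m. \<Sum>j\<in>{..i} \<inter> {..<n}. ?t i j)"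
    by (intro sum.cong sum.mono_neutral_cong_right) auto
  finally have 2: "fps_nth (\<Sum>j<n. d ^ j * (hasse_deriv j g oo f)) m
      = (\<Sum>i\<le>m. \<Sum>j\<in>{..i} \<inter> {..<n}. ?t i j)" .
  have "fps_nth ((g oo (f + d)) - (\<Sum>j<n. d ^ j * (hasse_deriv j g oo f))) m
      = (\<Sum>i\<le>m. \<Sum>j\<in>{..i} - {..<n}. ?t i j)"
  proof -
    have "(\<Sum>j\<le>i. ?t i j) - (\<Sum>j\<in>{..i} \<inter> {..<n}. ?t i j) = (\<Sum>j\<in>{..i} - {..<n}. ?t i j)" for i
      using sum.Int_Diff[of "{..i}" "?t i" "{..<n}"] by simp
    then show ?thesis
      unfolding fps_sub_nth 1 2
      by (simp only: sum_subtractf[symmetric])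
  qed
  also have "absval \<dots> \<le> A * B ^ n * c ^ m"
  proof (intro absval_sum_bound)
    fix i j assume j: "j \<in> {..i} - {..<n}"
    have "geom_bound c ((B / c) ^ j * (1 / c) ^ (i - j)) (d ^ j * f ^ (i - j))"
      using assms by (intro geom_bound_mult geom_bound_power) auto
    moreover have "(B / c) ^ j * (1 / c) ^ (i - j) = B ^ j / c ^ i"
      using j assms(3) by (simp add: power_divide power_diff field_simps)
    ultimately have "absval (fps_nth (d ^ j * f ^ (i - j)) m) \<le> B ^ j / c ^ i * c ^ m"
      using geom_boundD by metis
    then have "absval (?t i j) \<le> 1 * (A * c ^ i) * (B ^ j / c ^ i * c ^ m)"
      unfolding absval_mult using A B assms(3)
      by (intro mult_mono absval_of_nat_le geom_boundD[OF g]) auto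
    also have "\<dots> = A * B ^ j * c ^ m" using assms(3) by simp
    also have "\<dots> \<le> A * B ^ n * c ^ m"
      using A B assms(3,4) j by (intro mult_right_mono mult_left_mono power_decreasing) auto
    finally show "absval (?t i j) \<le> A * B ^ n * c ^ m" .
  qed (use A B assms(3) in auto)
  finally show "absval (fps_nth ((g oo (f + d)) - (\<Sum>j<n. d ^ j * (hasse_deriv j g oo f))) m)
      \<le> A * B ^ n * c ^ m" .
qed

corollary geom_bound_compose_diff:
  fixes f f' g :: "'a::nonarch_field fps"
  assumes "fps_nth f 0 = 0" "fps_nth f' 0 = 0" "c > 0" "B \<le> 1"
    "geom_bound c A g" "geom_bound c (1 / c) f" "geom_bound c (B / c) (f' - f)"
  shows "geom_bound c (A * B) ((g oo f') - (g oo f))"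
  using geom_bound_taylor[of f "f' - f" c B A g 1] assms by simp


section \<open>Logarithmic derivatives and Frobenius\<close>

definition fps_dlog :: "'a::field fps \<Rightarrow> 'a fps" where
  "fps_dlog r = fps_X * fps_deriv r * inverse r"

lemma fps_dlog_mult_self: "fps_nth r 0 \<noteq> 0 \<Longrightarrow> fps_dlog r * r = fps_X * fps_deriv r"
  by (simp add: fps_dlog_def mult.assoc inverse_mult_eq_1)

lemma fps_dlog_unique:
  assumes "fps_nth r 0 \<noteq> 0" "w * r = fps_X * fps_deriv r"
  shows "fps_dlog r = w"
  using assms by (simp add: fps_dlog_def inverse_mult_eq_1' mult.assoc flip: assms(2))

lemma fps_dlog_nth_0 [simp]: "fps_nth (fps_dlog r) 0 = 0"
  by (simp add: fps_dlog_def)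

lemma fps_dlog_mult:
  assumes "fps_nth r 0 \<noteq> 0" "fps_nth s 0 \<noteq> 0"
  shows "fps_dlog (r * s) = fps_dlog r + fps_dlog s"
proof (rule fps_dlog_unique)
  have "(fps_dlog r + fps_dlog s) * (r * s) = (fps_dlog r * r) * s + (fps_dlog s * s) * r"
    by (simp add: algebra_simps)
  also have "\<dots> = fps_X * fps_deriv (r * s)"
    unfolding fps_dlog_mult_self[OF assms(1)] fps_dlog_mult_self[OF assms(2)]
    by (simp add: algebra_simps)
  finally show "(fps_dlog r + fps_dlog s) * (r * s) = fps_X * fps_deriv (r * s)" .
qed (use assms in simp)

definition frobenius_fixed :: "'a::comm_semiring_1 fps \<Rightarrow> bool" where
  "frobenius_fixed w \<longleftrightarrow> (\<forall>n. fps_nth w (CHAR('a) * n) = fps_nth w n ^ CHAR('a))"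

lemma frobenius_fixed_add:
  assumes "prime CHAR('a::comm_semiring_1)" "frobenius_fixed (v :: 'a fps)" "frobenius_fixed w"
  shows "frobenius_fixed (v + w)"
  using assms by (simp add: frobenius_fixed_def freshmans_dream)

text \<open>The logarithmic derivative is minus the sum of
  \<open>k * (- s) ^ i * z ^ (k * i)\<close> over \<open>i \<ge> 1\<close>, and \<open>k\<close>
  lies in the prime field, hence equals its \<open>p\<close>-th power.\<close>

lemma frobenius_fixed_dlog_binomial:
  fixes s :: "'a::field"
  assumes p: "prime CHAR('a)" and k: "k > 0"
  shows "frobenius_fixed (fps_dlog (1 + fps_const s * fps_X ^ k))"
proof -
  let ?p = "CHAR('a)"
  define w where
    "w = Abs_fps (\<lambda>n. if k dvd n \<and> n > 0 then - of_nat k * (- s) ^ (n div k) else 0)"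
  let ?r = "1 + fps_const s * fps_X ^ k"
  have "fps_dlog ?r = w"
  proof (rule fps_dlog_unique)
    have "fps_nth (w * ?r) n = fps_nth (fps_X * fps_deriv ?r) n" for n
    proof -
      have l: "fps_nth (w * ?r) n = fps_nth w n + s * (if n < k then 0 else fps_nth w (n - k))"
        by (simp add: distrib_left fps_X_power_mult_right_nth mult.left_commute[of w])
      have r: "fps_nth (fps_X * fps_deriv ?r) n = (if n = k then of_nat k * s else 0)"
        using k by (cases n) (auto simp: fps_X_power_nth)
      show ?thesis
      proof (cases "k dvd n")
        case True
        then obtain i where i: "n = k * i" ..
        consider "i = 0" | "i = 1" | j where "i = Suc (Suc j)"
          by (metis One_nat_def not0_implies_Suc)
        then show ?thesis
        proof cases
          case 3
          then have "n - k = k * Suc j" "\<not> n < k" "n \<noteq> k" using i k by auto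
          then show ?thesis using k i 3 unfolding l r by (simp add: w_def)
        next
          case 2
          then show ?thesis using k i unfolding l r by (simp add: w_def)
        next
          case 1
          then show ?thesis using k i unfolding l r by (simp add: w_def)
        qed
      next
        case False
        then have "n \<noteq> k" "n \<ge> k \<Longrightarrow> \<not> k dvd n - k" by (auto simp: dvd_minus_self)
        then show ?thesis using False unfolding l r by (simp add: w_def)
      qed
    qed
    then show "w * ?r = fps_X * fps_deriv ?r" by (simp add: fps_eq_iff)
  qed (use k in simp)
  moreover have "fps_nth w (?p * n) = fps_nth w n ^ ?p" for n
  proof -
    have p0: "?p > 0" using p prime_gt_0_nat by blast
    consider "n = 0" | i where "n > 0" "n = k * i" | "\<not> k dvd n" "n > 0"
      by (metis dvdE gr0I)
    then show ?thesis
    proof cases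
      case 1
      then show ?thesis using p0 by (simp add: w_def)
    next
      case (2 i)
      have "(- of_nat k :: 'a) ^ ?p = - of_nat k"
        using diff_power_char[OF p, of ?p 1 0 "of_nat k"] of_nat_power_char[OF p, of k] p0
        by (simp add: power_0_left)
      then have "(- of_nat k * (- s) ^ i) ^ ?p = - of_nat k * (- s) ^ (?p * i)"
        unfolding power_mult_distrib[of "- of_nat k"]
        by (simp add: power_mult[symmetric] mult.commute[of i])
      moreover have "?p * n = k * (?p * i)" using 2 by simp
      ultimately show ?thesis using 2 k p0 by (simp add: w_def)
    next
      case 3
      \<comment> \<open>Multiplication by \<open>p\<close> can turn an index into a multiple of
        \<open>k\<close> only if \<open>p\<close> divides \<open>k\<close>, and then all
        coefficients vanish.\<close>
      have "of_nat k = (0 :: 'a)" if "k dvd ?p * n"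
      proof -
        have "\<not> coprime k ?p"
          using that 3(1) by (metis coprime_dvd_mult_right_iff)
        then have "?p dvd k"
          using p by (metis coprime_commute prime_imp_coprime)
        then show ?thesis by (simp add: of_nat_eq_0_iff_char_dvd)
      qed
      then show ?thesis using 3 p0 by (auto simp: w_def)
    qed
  qed
  ultimately show ?thesis by (simp add: frobenius_fixed_def)
qed

text \<open>A series with constant term 1 is an infinite product of binomials
  \<open>1 + s * z ^ k\<close>. Finitely many factors reach any given order, and
  \<open>fps_dlog\<close> turns the product into a sum.\<close>

lemma fps_approx_frobenius_fixed_dlog:
  fixes r :: "'a::field fps"
  assumes p: "prime CHAR('a)" and r: "fps_nth r 0 = 1"
  shows "\<exists>P. fps_nth P 0 = 1 \<and> frobenius_fixed (fps_dlog P) \<and> (\<forall>k\<le>n. fps_nth r k = fps_nth P k)"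
proof (induction n)
  case 0
  have "frobenius_fixed (fps_dlog (1::'a fps))"
    using prime_gt_0_nat[OF p] by (simp add: fps_dlog_def frobenius_fixed_def)
  then show ?case using r by (intro exI[of _ 1]) auto
next
  case (Suc n)
  then obtain P where P: "fps_nth P 0 = 1" "frobenius_fixed (fps_dlog P)"
    "\<And>k. k \<le> n \<Longrightarrow> fps_nth r k = fps_nth P k" by blast
  define s where "s = fps_nth r (Suc n) - fps_nth P (Suc n)"
  let ?b = "1 + fps_const s * fps_X ^ Suc n"
  have n: "fps_nth (P * ?b) k = fps_nth P k + s * (if k < Suc n then 0 else fps_nth P (k - Suc n))" for k
    by (simp add: distrib_left fps_X_power_mult_right_nth mult.left_commute[of P] del: power_Suc)
  have "frobenius_fixed (fps_dlog (P * ?b))"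
    using P frobenius_fixed_dlog_binomial[OF p, of "Suc n" s]
    by (subst fps_dlog_mult) (auto intro: frobenius_fixed_add[OF p])
  moreover have "fps_nth r k = fps_nth (P * ?b) k" if "k \<le> Suc n" for k
    using that P unfolding n by (cases "k = Suc n") (auto simp: s_def)
  ultimately show ?case using P(1) n by (intro exI[of _ "P * ?b"]) auto
qed

text \<open>
  Reading \<open>w\<close> as the differential \<open>w dz / z\<close>, this says that the Cartier operator fixes
  logarithmic differentials.
\<close>

lemma frobenius_fixed_dlog:
  fixes r :: "'a::field fps"
  assumes p: "prime CHAR('a)" and r: "fps_nth r 0 = 1"
  shows "frobenius_fixed (fps_dlog r)"
  unfolding frobenius_fixed_def
proof
  fix n
  let ?N = "CHAR('a) * n"
  obtain P where P: "fps_nth P 0 = 1" "frobenius_fixed (fps_dlog P)"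
    "\<And>k. k \<le> ?N \<Longrightarrow> fps_nth r k = fps_nth P k"
    using fps_approx_frobenius_fixed_dlog[OF assms, of ?N] by blast
  \<comment> \<open>The quotient is 1 up to order \<open>?N\<close>, so its logarithmic derivative
    vanishes to that order and does not affect the two coefficients compared.\<close>
  define q where "q = r * inverse P"
  have q: "q * P = r" "fps_nth q 0 = 1"
    using P(1) r by (auto simp: q_def mult.assoc inverse_mult_eq_1)
  have "q - 1 = (r - P) * inverse P"
    using P(1) by (simp add: q_def algebra_simps inverse_mult_eq_1')
  then have "fps_nth (q - 1) k = 0" if "k \<le> ?N" for k
    using fps_mult_nth_eq_0[of "Suc ?N" "r - P" 0 "inverse P" k] P(3) that by auto
  then have q0: "fps_nth q k = 0" if "0 < k" "k \<le> ?N" for k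
    using that by fastforce
  have "fps_nth (fps_X * fps_deriv q) k = 0" if "k \<le> ?N" for k
    using that q0 by (cases k) auto
  then have "fps_nth (fps_dlog q) k = 0" if "k \<le> ?N" for k
    unfolding fps_dlog_def using that
      fps_mult_nth_eq_0[of "Suc ?N" "fps_X * fps_deriv q" 0 "inverse q" k] by (simp only: less_Suc_eq_le add_0_right)
  then have "fps_nth (fps_dlog r) k = fps_nth (fps_dlog P) k" if "k \<le> ?N" for k
    using that q P(1) fps_dlog_mult[of q P] by auto
  moreover have "n \<le> ?N" using prime_gt_0_nat[OF p] by simp
  ultimately show "fps_nth (fps_dlog r) ?N = fps_nth (fps_dlog r) n ^ CHAR('a)"
    using P(2) by (simp add: frobenius_fixed_def)
qed

section \<open>Frobenius twists and sections\<close>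

lemma fps_compose_X_power_nth:
  fixes f :: "'a::idom fps"
  assumes "q > 0"
  shows "fps_nth (f oo fps_X ^ q) n = (if q dvd n then fps_nth f (n div q) else 0)"
proof -
  have "fps_nth (f oo fps_X ^ q) n = (\<Sum>i = 0..n. if i * q = n then fps_nth f i else 0)"
    unfolding fps_compose_nth
    by (intro sum.cong) (auto simp: power_mult[symmetric] fps_X_power_nth mult.commute)
  also have "\<dots> = (if q dvd n then fps_nth f (n div q) else 0)"
  proof (cases "q dvd n")
    case True
    then obtain i where i: "n = q * i" ..
    have "(\<Sum>j = 0..n. if j * q = n then fps_nth f j else 0)
        = (\<Sum>j\<in>{i}. if j * q = n then fps_nth f j else 0)"
      using assms i by (intro sum.mono_neutral_right) auto
    then show ?thesis using i assms by simp
  qed (auto intro!: sum.neutral)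
  finally show ?thesis .
qed

definition frobenius_map :: "nat \<Rightarrow> 'a::comm_semiring_1 fps \<Rightarrow> 'a fps" where
  "frobenius_map q f = Abs_fps (\<lambda>n. fps_nth f n ^ q)"

lemma frobenius_map_nth [simp]: "fps_nth (frobenius_map q f) n = fps_nth f n ^ q"
  by (simp add: frobenius_map_def)

lemma fps_power_char:
  fixes f :: "'a::idom fps"
  assumes p: "prime CHAR('a)" and q: "q = CHAR('a) ^ s"
  shows "f ^ q = frobenius_map q f oo fps_X ^ q"
proof (rule fps_ext)
  fix n
  have q0: "q > 0" using p q prime_gt_0_nat by simp
  have p': "prime CHAR('a fps)" "q = CHAR('a fps) ^ s" using p q by simp_all
  \<comment> \<open>The Frobenius identity for sums applies to the truncation \<open>a\<close>; the
    tail keeps its order above \<open>n\<close> when raised to the power \<open>q\<close>.\<close>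
  define a where "a = (\<Sum>i\<le>n. fps_const (fps_nth f i) * fps_X ^ i)"
  have a: "fps_nth a k = (if k \<le> n then fps_nth f k else 0)" for k
    by (simp add: a_def fps_sum_nth fps_X_power_nth mult_delta_right)
  have "f ^ q = (a + (f - a)) ^ q" by simp
  also have "\<dots> = a ^ q + (f - a) ^ q" by (rule freshmans_dream'[OF p'])
  also have "fps_nth \<dots> n = fps_nth (a ^ q) n"
  proof -
    have "(f - a) ^ q = (f - a) * (f - a) ^ (q - 1)"
      using q0 by (simp add: power_eq_if)
    then have "fps_nth ((f - a) ^ q) n = 0"
      using fps_mult_nth_eq_0[of "Suc n" "f - a" 0 "(f - a) ^ (q - 1)" n] a by auto
    then show ?thesis by simp
  qed
  also have "a ^ q = (\<Sum>i\<le>n. fps_const (fps_nth f i ^ q) * fps_X ^ (i * q))"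
    unfolding a_def freshmans_dream_sum'[OF p']
    by (simp add: power_mult_distrib power_mult)
  also have "fps_nth \<dots> n = (\<Sum>i\<le>n. if i * q = n then fps_nth f i ^ q else 0)"
    by (auto simp: fps_sum_nth fps_X_power_nth intro: sum.cong)
  also have "\<dots> = (if q dvd n then fps_nth f (n div q) ^ q else 0)"
  proof (cases "q dvd n")
    case True
    then obtain i where i: "n = q * i" ..
    have "(\<Sum>j\<le>n. if j * q = n then fps_nth f j ^ q else 0)
        = (\<Sum>j\<in>{i}. if j * q = n then fps_nth f j ^ q else 0)"
      using q0 i by (intro sum.mono_neutral_right) auto
    then show ?thesis using i q0 by simp
  qed (auto intro!: sum.neutral)
  finally show "fps_nth (f ^ q) n = fps_nth (frobenius_map q f oo fps_X ^ q) n"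
    using q0 by (simp add: fps_compose_X_power_nth)
qed

definition fps_section :: "nat \<Rightarrow> 'a fps \<Rightarrow> 'a fps" where
  "fps_section q f = Abs_fps (\<lambda>n. fps_nth f (q * n))"

lemma fps_section_nth [simp]: "fps_nth (fps_section q f) n = fps_nth f (q * n)"
  by (simp add: fps_section_def)

lemma fps_section_mult_compose:
  fixes f g :: "'a::idom fps"
  assumes q: "q > 0"
  shows "fps_section q (f * (g oo fps_X ^ q)) = fps_section q f * g"
proof (rule fps_ext)
  fix n
  let ?G = "g oo fps_X ^ q"
  have "fps_nth (f * ?G) (q * n) = (\<Sum>i\<in>{0..q * n}. fps_nth f (q * n - i) * fps_nth ?G i)"
    unfolding mult.commute[of f] fps_mult_nth by (simp only: mult.commute)
  also have "\<dots> = (\<Sum>i\<in>(\<lambda>j. q * j) ` {0..n}. fps_nth f (q * n - i) * fps_nth ?G i)"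
    using q by (intro sum.mono_neutral_right) (auto simp: fps_compose_X_power_nth)
  also have "\<dots> = (\<Sum>j\<in>{0..n}. fps_nth f (q * (n - j)) * fps_nth g j)"
    using q by (subst sum.reindex) (auto simp: inj_on_def fps_compose_X_power_nth diff_mult_distrib2)
  also have "\<dots> = fps_nth (g * fps_section q f) n"
    unfolding fps_mult_nth by (simp add: mult.commute)
  finally show "fps_nth (fps_section q (f * ?G)) n = fps_nth (fps_section q f * g) n"
    by (simp only: fps_section_nth mult.commute[of g])
qed

lemma fps_deriv_compose_X_power_char:
  fixes f :: "'a::idom fps"
  assumes "prime CHAR('a)" "CHAR('a) dvd q"
  shows "fps_deriv (f oo fps_X ^ q) = 0"
proof (cases "q = 0")
  case True
  then show ?thesis by (simp add: fps_eq_iff fps_compose_nth)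
next
  case False
  have "of_nat q = (0::'a)" using assms(2) by (simp add: of_nat_eq_0_iff_char_dvd)
  moreover have "fps_deriv (f oo fps_X ^ q) = (fps_deriv f oo fps_X ^ q) * fps_deriv (fps_X ^ q)"
    using False by (intro fps_compose_deriv) simp
  ultimately show ?thesis by (simp add: fps_deriv_power)
qed


section \<open>One step of the renormalization\<close>

text \<open>On the disc of radius \<open>1 / D\<close> the nonlinear part of \<open>F\<close> is
  smaller than the displacement \<open>(\<mu> - 1) z\<close> by the factor \<open>\<theta>\<close>.
  Uniform bounds hold even for \<open>\<theta> = 1\<close>; the comparison of reductions requires
  \<open>\<theta> < 1\<close>.\<close>

locale near_identity =
  fixes F :: "'a::nonarch_field fps" and D \<delta> \<theta> :: real
  assumes char: "prime CHAR('a)" and F_0: "fps_nth F 0 = 0"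
    and absval_mult_minus_1: "absval (fps_nth F 1 - 1) = \<delta>"
    and delta: "0 < \<delta>" "\<delta> < 1" and D_pos: "0 < D" and theta: "0 \<le> \<theta>" "\<theta> \<le> 1"
    and F_near: "geom_bound D (\<delta> * \<theta> / D) (F - fps_const (fps_nth F 1) * fps_X)"
begin

definition "\<mu> = fps_nth F 1"

lemma char_pos: "CHAR('a) > 0" using char prime_gt_0_nat by blast

lemma mu_minus_1: "absval (\<mu> - 1) = \<delta>" using absval_mult_minus_1 by (simp add: \<mu>_def)

lemma absval_mu: "absval \<mu> = 1"
  using absval_eqI_near[of 1 \<mu>] mu_minus_1 delta by (simp add: absval_one absval_minus_commute)

lemma F_near_X: "geom_bound D (\<delta> / D) (F - fps_X)"
proof -
  have "geom_bound D (\<delta> * (1 / D)) (fps_const (\<mu> - 1) * fps_X)"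
    using D_pos mu_minus_1 by (intro geom_bound_mult geom_bound_const geom_bound_X) auto
  moreover have "geom_bound D (\<delta> / D) (F - fps_const \<mu> * fps_X)"
    using F_near theta delta D_pos unfolding \<mu>_def[symmetric]
    by (rule_tac geom_bound_mono) (auto simp: divide_right_mono)
  ultimately have "geom_bound D (\<delta> / D) ((F - fps_const \<mu> * fps_X) + fps_const (\<mu> - 1) * fps_X)"
    by (intro geom_bound_add) auto
  then show ?thesis by (simp add: algebra_simps flip: fps_const_sub)
qed

lemma F_bound: "geom_bound D (1 / D) F"
proof -
  have "geom_bound D (1 / D) (F - fps_X)"
    using F_near_X by (rule geom_bound_mono) (use D_pos delta in \<open>auto simp: divide_right_mono\<close>)
  moreover have "geom_bound D (1 / D) (fps_X :: 'a fps)"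
    using D_pos by (intro geom_bound_X) auto
  ultimately have "geom_bound D (1 / D) ((F - fps_X) + fps_X)" by (rule geom_bound_add)
  then show ?thesis by simp
qed

lemma compose_F_near: "geom_bound D A f \<Longrightarrow> geom_bound D (A * \<delta>) ((f oo F) - f)"
  using geom_bound_compose_diff[of fps_X F D \<delta> A f] F_0 D_pos delta F_near_X
  by (simp add: geom_bound_X)

end

text \<open>The cocycle \<open>u\<close> measures how far \<open>r\<close> is from being invariant
  under \<open>F\<close>. The factor \<open>g\<close> is the part of \<open>r\<close> that can be
  found with divisors \<open>\<mu> ^ k - 1\<close> of the single size \<open>\<delta>\<close>, those
  with \<open>k\<close> prime to \<open>p\<close>; the smaller divisors stay with
  \<open>r_top\<close>, a series in \<open>z ^ p\<close>.\<close>

locale cocycle_step = near_identity F D \<delta> \<theta>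
  for r F :: "'a::nonarch_field fps" and D \<delta> \<theta> :: real +
  assumes r_0: "fps_nth r 0 = 1" and u_near: "geom_bound D \<delta> (r * inverse (r oo F) - 1)"
begin

definition "u = r * inverse (r oo F)"
definition "\<rho> = fps_dlog r"
definition "r_top = fps_section CHAR('a) r oo fps_X ^ CHAR('a)"
definition "g = r * inverse r_top"

lemma u_near': "geom_bound D \<delta> (u - 1)" using u_near by (simp add: u_def)

lemma u_0: "fps_nth u 0 = 1" using r_0 by (simp add: u_def)

lemma u_bound: "geom_bound D 1 u"
proof -
  have "geom_bound D 1 ((u - 1) + 1)"
    using u_near' delta D_pos by (intro geom_bound_add) (auto intro: geom_bound_mono)
  then show ?thesis by simp
qed

lemma r_eq: "r = u * (r oo F)"
  using r_0 by (simp add: u_def mult.assoc inverse_mult_eq_1)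

lemma dlog_u_bound: "geom_bound D \<delta> (fps_dlog u)"
proof -
  have "geom_bound D (\<delta> * 1) (fps_X * fps_deriv (u - 1) * inverse u)"
    using D_pos u_near' u_bound u_0
    by (intro geom_bound_mult geom_bound_X_deriv geom_bound_inverse) (auto simp: absval_one)
  then show ?thesis by (simp add: fps_dlog_def)
qed

section \<open>The logarithmic derivative of \<open>r\<close>\<close>

definition "F\<^sub>1 = fps_shift 1 F"
text \<open>\<open>1 + T\<close> is \<open>z F' / F\<close>, the factor that the derivation
  \<open>z d/dz\<close> acquires under substitution of \<open>F\<close>.\<close>

definition "T = fps_X * fps_deriv F\<^sub>1 * inverse F\<^sub>1"

lemma F_eq: "F = fps_X * F\<^sub>1"
  unfolding F\<^sub>1_def using F_0 by (simp add: fps_eq_iff fps_X_mult_nth)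

lemma F1_0: "fps_nth F\<^sub>1 0 = \<mu>" by (simp add: F\<^sub>1_def \<mu>_def)

lemma F1_near: "geom_bound D \<delta> (F\<^sub>1 - fps_const \<mu>)"
proof (rule geom_boundI)
  fix n
  have "absval (fps_nth (F - fps_const \<mu> * fps_X) (Suc n)) \<le> \<delta> * \<theta> / D * D ^ Suc n"
    unfolding \<mu>_def by (rule geom_boundD[OF F_near])
  also have "\<dots> = \<delta> * \<theta> * D ^ n" using D_pos by simp
  also have "\<dots> \<le> \<delta> * 1 * D ^ n"
    using D_pos theta delta by (auto intro!: mult_mono)
  also have "fps_nth (F - fps_const \<mu> * fps_X) (Suc n) = fps_nth (F\<^sub>1 - fps_const \<mu>) n"
    by (cases n) (auto simp: F\<^sub>1_def)
  finally show "absval (fps_nth (F\<^sub>1 - fps_const \<mu>) n) \<le> \<delta> * D ^ n" by simp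
qed

lemma T_bound: "geom_bound D \<delta> T"
proof -
  have "geom_bound D 1 ((F\<^sub>1 - fps_const \<mu>) + fps_const \<mu>)"
    using F1_near D_pos delta absval_mu
    by (intro geom_bound_add geom_bound_const) (auto intro: geom_bound_mono)
  then have "geom_bound D (\<delta> * 1) (fps_X * fps_deriv (F\<^sub>1 - fps_const \<mu>) * inverse F\<^sub>1)"
    using D_pos F1_near absval_mu F1_0
    by (intro geom_bound_mult geom_bound_X_deriv geom_bound_inverse) auto
  then show ?thesis by (simp add: T_def)
qed

lemma rho_eq: "\<rho> - fps_dlog u = (\<rho> oo F) + T * (\<rho> oo F)"
proof -
  define W where "W = (fps_deriv r oo F) * inverse (r oo F)"
  have 1: "\<rho> = fps_dlog u + fps_dlog (r oo F)"
  proof -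
    have "\<rho> = fps_dlog (u * (r oo F))" using r_eq by (simp add: \<rho>_def)
    also have "\<dots> = fps_dlog u + fps_dlog (r oo F)"
      by (rule fps_dlog_mult) (use u_0 r_0 in auto)
    finally show ?thesis .
  qed
  have 2: "fps_dlog (r oo F) = fps_X * fps_deriv F * W"
    using F_0 by (simp add: fps_dlog_def W_def fps_compose_deriv)
  have 3: "\<rho> oo F = F * W"
    using F_0 r_0
    by (simp add: \<rho>_def fps_dlog_def W_def fps_compose_mult_distrib fps_inverse_compose)
  have 4: "fps_deriv F = F\<^sub>1 + fps_X * fps_deriv F\<^sub>1"
    by (subst F_eq) simp
  have 5: "T * F\<^sub>1 = fps_X * fps_deriv F\<^sub>1"
    using absval_mu F1_0 by (auto simp: T_def mult.assoc inverse_mult_eq_1)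
  have "\<rho> - fps_dlog u = fps_X * fps_deriv F * W" using 1 2 by simp
  also have "\<dots> = fps_X * F\<^sub>1 * W + T * (fps_X * F\<^sub>1 * W)"
    unfolding 4 by (simp add: algebra_simps flip: 5)
  finally show ?thesis unfolding 3 F_eq[symmetric] .
qed

lemma rho_frobenius: "fps_nth \<rho> (CHAR('a) * n) = fps_nth \<rho> n ^ CHAR('a)"
  using frobenius_fixed_dlog[OF char r_0] by (simp add: frobenius_fixed_def \<rho>_def)

text \<open>At exponents prime to \<open>p\<close> the coefficient is found from
  \<open>rho_eq\<close> by a division of size \<open>\<delta>\<close>. At multiples of
  \<open>p\<close>, where the divisor would be far smaller, nothing is divided: the coefficient is
  the \<open>p\<close>-th power of an earlier one.\<close>

lemma rho_bound: "geom_bound D 1 \<rho>"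
proof -
  have "absval (fps_nth \<rho> k) \<le> 1 * D ^ k" for k
  proof (induction k rule: less_induct)
    case (less k)
    show ?case
    proof (cases "CHAR('a) dvd k")
      case True
      then obtain j where j: "k = CHAR('a) * j" ..
      show ?thesis
      proof (cases "j = 0")
        case False
        then have "j < k" using j prime_gt_1_nat[OF char] by simp
        then have "absval (fps_nth \<rho> j) ^ CHAR('a) \<le> (1 * D ^ j) ^ CHAR('a)"
          by (intro power_mono less) auto
        then show ?thesis
          unfolding j rho_frobenius absval_power by (simp add: power_mult[symmetric] mult.commute)
      qed (use j in \<open>simp add: \<rho>_def\<close>)
    next
      case False
      \<comment> \<open>Bounds are known only below \<open>k\<close>, so the compositions are
        compared with those of the truncation. The coefficient at \<open>k\<close> enters
        \<open>\<rho> oo F\<close> through \<open>\<mu> ^ k\<close> only, and the product with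
        \<open>T\<close> not at all, as \<open>T\<close> has no constant term.\<close>
      define \<rho>' where "\<rho>' = Abs_fps (\<lambda>n. if n < k then fps_nth \<rho> n else 0)"
      have bd: "geom_bound D 1 \<rho>'"
        using less D_pos by (auto simp: geom_bound_def \<rho>'_def)
      have lt: "fps_nth (\<rho> oo F) m = fps_nth (\<rho>' oo F) m" if "m < k" for m
        unfolding fps_compose_nth using that by (intro sum.cong) (auto simp: \<rho>'_def)
      have "fps_nth (\<rho> oo F) k = (\<Sum>i<k. fps_nth \<rho> i * fps_nth (F ^ i) k) + fps_nth \<rho> k * \<mu> ^ k"
        by (simp add: fps_compose_nth atLeast0AtMost lessThan_Suc_atMost[symmetric]
            startsby_zero_power_nth_same[OF F_0] \<mu>_def)
      also have "(\<Sum>i<k. fps_nth \<rho> i * fps_nth (F ^ i) k) = fps_nth (\<rho>' oo F) k"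
        unfolding fps_compose_nth atLeast0AtMost lessThan_Suc_atMost[symmetric]
        by (simp add: \<rho>'_def)
      finally have k: "fps_nth (\<rho> oo F) k = fps_nth (\<rho>' oo F) k + fps_nth \<rho> k * \<mu> ^ k" .
      have "fps_nth (T * (\<rho> oo F)) k = fps_nth (T * (\<rho>' oo F)) k"
        unfolding fps_mult_nth
      proof (intro sum.cong refl)
        fix i assume "i \<in> {0..k}"
        then show "fps_nth T i * fps_nth (\<rho> oo F) (k - i) = fps_nth T i * fps_nth (\<rho>' oo F) (k - i)"
          using lt[of "k - i"] by (cases "i = 0") (auto simp: T_def)
      qed
      then have "- (fps_nth \<rho> k * (\<mu> ^ k - 1))
          = fps_nth (fps_dlog u + ((\<rho>' oo F) - \<rho>') + T * (\<rho>' oo F)) k"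
        using arg_cong[OF rho_eq, of "\<lambda>x. fps_nth x k"] k by (simp add: \<rho>'_def algebra_simps)
      also have "absval \<dots> \<le> \<delta> * D ^ k"
        using bd D_pos dlog_u_bound T_bound compose_F_near[OF bd] geom_bound_compose[OF bd F_bound]
        by (intro geom_boundD geom_bound_add) (auto intro: geom_bound_mult_le)
      finally have "absval (fps_nth \<rho> k) * absval (\<mu> ^ k - 1) \<le> \<delta> * D ^ k"
        by (simp add: absval_mult)
      moreover have "absval (\<mu> ^ k - 1) = \<delta>"
        using absval_power_minus_one_eq[OF char False, of \<mu>] mu_minus_1 delta by simp
      ultimately show ?thesis using delta by (simp add: mult.commute)
    qed
  qed
  then show ?thesis by (intro geom_boundI)
qed

section \<open>Splitting off the exponents divisible by \<open>p\<close>\<close>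

lemma r_top_0: "fps_nth r_top 0 = 1" using r_0 by (simp add: r_top_def)

lemma g_0: "fps_nth g 0 = 1" using r_0 r_top_0 by (simp add: g_def)

lemma r_factor: "r = g * r_top"
  using r_top_0 by (simp add: g_def mult.assoc inverse_mult_eq_1)

lemma g_section: "fps_section CHAR('a) g = 1"
proof -
  let ?s = "fps_section CHAR('a) r"
  have "?s = fps_section CHAR('a) g * ?s"
    using fps_section_mult_compose[OF char_pos, of g ?s] r_factor by (simp add: r_top_def)
  moreover have "?s \<noteq> 0" using r_0 by (metis fps_section_nth fps_zero_nth mult_0_right zero_neq_one)
  ultimately show ?thesis by simp
qed

lemma g_dlog: "fps_X * fps_deriv g = \<rho> * g"
proof -
  have "fps_X * fps_deriv g * r_top = fps_X * fps_deriv r"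
    using fps_deriv_compose_X_power_char[OF char dvd_refl, of "fps_section CHAR('a) r"]
    by (subst (2) r_factor) (simp add: r_top_def mult_ac)
  also have "\<dots> = \<rho> * r" using r_0 by (simp add: \<rho>_def fps_dlog_mult_self)
  also have "\<dots> = \<rho> * g * r_top" by (subst r_factor) (simp add: mult_ac)
  finally show ?thesis using r_top_0 by (auto simp: mult_right_cancel)
qed

text \<open>Coefficients at positive multiples of \<open>p\<close> vanish by
  \<open>g_section\<close>; at other \<open>k\<close> the equation \<open>g_dlog\<close> yields them
  after division by the unit \<open>k\<close>.\<close>

lemma g_bound: "geom_bound D 1 g"
proof -
  have "absval (fps_nth g k) \<le> 1 * D ^ k" for k
  proof (induction k rule: less_induct)
    case (less k)
    show ?case
    proof (cases "CHAR('a) dvd k")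
      case True
      then obtain j where j: "k = CHAR('a) * j" ..
      have "fps_nth g k = fps_nth (1 :: 'a fps) j"
        using arg_cong[OF g_section, of "\<lambda>x. fps_nth x j"] j by simp
      then show ?thesis using D_pos j by (auto simp: absval_one)
    next
      case False
      then have "absval (of_nat k :: 'a) = 1" by (intro absval_of_nat_unit char)
      then have "absval (fps_nth g k) = absval (fps_nth (fps_X * fps_deriv g) k)"
        using False by (cases k) (auto simp: absval_mult simp del: of_nat_Suc)
      also have "\<dots> = absval (\<Sum>i = 0..k. fps_nth \<rho> i * fps_nth g (k - i))"
        unfolding g_dlog fps_mult_nth ..
      also have "\<dots> \<le> 1 * D ^ k"
      proof (rule absval_sum_bound)
        fix i assume i: "i \<in> {0..k}"
        show "absval (fps_nth \<rho> i * fps_nth g (k - i)) \<le> 1 * D ^ k"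
        proof (cases "i = 0")
          case False
          then have "absval (fps_nth \<rho> i * fps_nth g (k - i)) \<le> (1 * D ^ i) * (1 * D ^ (k - i))"
            unfolding absval_mult using i D_pos
            by (intro mult_mono geom_boundD[OF rho_bound] less) auto
          then show ?thesis using i by (simp add: power_add[symmetric])
        qed (use D_pos in \<open>simp add: \<rho>_def\<close>)
      qed (use D_pos in simp)
      finally show ?thesis .
    qed
  qed
  then show ?thesis by (intro geom_boundI)
qed

text \<open>There are two sources of error: replacing \<open>F\<close> by its linear part costs
  \<open>\<delta> * \<theta>\<close>, and replacing \<open>\<mu> ^ n - 1\<close> by
  \<open>n * (\<mu> - 1)\<close> costs \<open>\<delta>\<^sup>2\<close>.\<close>

lemma g_compose_F: "geom_bound D (\<delta> * max \<theta> \<delta>) ((g oo F) - g - fps_const (\<mu> - 1) * (fps_X * fps_deriv g))"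
proof -
  let ?L = "fps_const \<mu> * fps_X"
  have L: "geom_bound D (1 / D) ?L"
    using geom_bound_mult[OF geom_bound_const geom_bound_X, of D \<mu> 1 "1 / D"] D_pos absval_mu by simp
  have "\<delta> * \<theta> \<le> 1" using delta theta by (auto intro: mult_le_one)
  then have "geom_bound D (1 * (\<delta> * \<theta>)) ((g oo F) - (g oo ?L))"
    using F_near F_0 D_pos g_bound L
    by (intro geom_bound_compose_diff) (auto simp: \<mu>_def)
  then have 1: "geom_bound D (\<delta> * max \<theta> \<delta>) ((g oo F) - (g oo ?L))"
    using D_pos delta by (auto elim!: geom_bound_mono)
  have 2: "geom_bound D (\<delta> * max \<theta> \<delta>) ((g oo ?L) - g - fps_const (\<mu> - 1) * (fps_X * fps_deriv g))"
  proof (rule geom_boundI)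
    fix n
    have "fps_nth (fps_X * fps_deriv g) n = of_nat n * fps_nth g n" by (cases n) auto
    then have "fps_nth ((g oo ?L) - g - fps_const (\<mu> - 1) * (fps_X * fps_deriv g)) n
        = (\<mu> ^ n - 1 - of_nat n * (\<mu> - 1)) * fps_nth g n"
      unfolding fps_sub_nth fps_nth_compose_linear fps_mult_left_const_nth
      by (simp only: algebra_simps mult_1)
    also have "absval \<dots> \<le> \<delta>\<^sup>2 * (1 * D ^ n)"
      unfolding absval_mult using mu_minus_1 delta
      by (intro mult_mono geom_boundD[OF g_bound] absval_power_minus_one_approx) auto
    also have "\<dots> \<le> \<delta> * max \<theta> \<delta> * D ^ n"
      using D_pos delta by (auto simp: power2_eq_square intro!: mult_right_mono)
    finally show "absval (fps_nth ((g oo ?L) - g - fps_const (\<mu> - 1) * (fps_X * fps_deriv g)) n)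
        \<le> \<delta> * max \<theta> \<delta> * D ^ n" .
  qed
  show ?thesis using geom_bound_add[OF 1 2] by (simp add: algebra_simps)
qed

section \<open>The cocycle passed on to the next level\<close>

definition "u_top = r_top * inverse (r_top oo F)"

text \<open>From \<open>u_top * g = u * (g oo F)\<close> and \<open>z g' = \<rho> g\<close>. For
  \<open>\<theta> < 1\<close> the error is strictly below \<open>\<delta>\<close>, so after division
  by \<open>\<mu> - 1\<close> the change from \<open>u\<close> to \<open>u_top\<close> reduces to
  the logarithmic derivative \<open>\<rho>\<close>.\<close>

lemma u_top_near:
  "geom_bound D (\<delta> * max \<theta> \<delta>) (u_top - u - fps_const (\<mu> - 1) * \<rho>)"
proof -
  let ?E = "(g oo F) - g - fps_const (\<mu> - 1) * (fps_X * fps_deriv g)"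
  have ne: "fps_nth g 0 \<noteq> 0" "fps_nth (r_top oo F) 0 \<noteq> 0" "fps_nth (g oo F) 0 \<noteq> 0"
    using g_0 r_top_0 by auto
  have "u_top * (g * (r_top oo F)) = g * r_top"
  proof -
    have "u_top * (g * (r_top oo F)) = g * r_top * (inverse (r_top oo F) * (r_top oo F))"
      by (simp only: u_top_def mult_ac)
    then show ?thesis unfolding inverse_mult_eq_1[OF ne(2)] by simp
  qed
  also have "\<dots> = u * ((g oo F) * (r_top oo F))"
    using r_eq r_factor by (metis F_0 fps_compose_mult_distrib)
  finally have "(u_top * g) * (r_top oo F) = (u * (g oo F)) * (r_top oo F)"
    by (simp only: mult.assoc)
  moreover have "r_top oo F \<noteq> 0" using ne(2) by (metis fps_zero_nth)
  ultimately have "u_top * g = u * (g oo F)" by (metis mult_right_cancel)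
  then have "(u_top - u - fps_const (\<mu> - 1) * \<rho>) * g
      = (u - 1) * ((g oo F) - g) + ?E"
    by (simp add: g_dlog algebra_simps)
  then have "(u_top - u - fps_const (\<mu> - 1) * \<rho>) = ((u - 1) * ((g oo F) - g) + ?E) * inverse g"
    using ne(1) by (metis inverse_mult_eq_1' mult.assoc mult.right_neutral)
  moreover have "geom_bound D (\<delta> * max \<theta> \<delta>) ((u - 1) * ((g oo F) - g))"
    using geom_bound_mult_le[OF u_near' compose_F_near[OF g_bound] D_pos] delta by simp
  ultimately show ?thesis
    using geom_bound_mult_le[OF geom_bound_add[OF _ g_compose_F] geom_bound_inverse[OF g_bound]]
      g_0 D_pos by (simp add: absval_one)
qed

lemma u_top_near_1: "geom_bound D \<delta> (u_top - 1)"
proof -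
  have "geom_bound D \<delta> (u_top - u - fps_const (\<mu> - 1) * \<rho>)"
    using u_top_near by (rule geom_bound_mono) (use delta theta D_pos in auto)
  moreover have "geom_bound D \<delta> (fps_const (\<mu> - 1) * \<rho>)"
    using geom_bound_mult_le[OF geom_bound_const[of D "\<mu> - 1" \<delta>] rho_bound D_pos, of \<delta>]
      D_pos mu_minus_1 by simp
  ultimately have "geom_bound D \<delta>
      ((u_top - u - fps_const (\<mu> - 1) * \<rho>) + fps_const (\<mu> - 1) * \<rho> + (u - 1))"
    using u_near' by (intro geom_bound_add)
  then show ?thesis by simp
qed

text \<open>\<open>F ^ p\<close> is the Frobenius twist of \<open>F\<close> in the variable
  \<open>z ^ p\<close>. Hence \<open>u_top\<close> is again a cocycle of the form \<open>u\<close>,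
  for the section of \<open>r\<close> over the twisted map, and the step can be iterated.\<close>

lemma u_top_eq:
  "u_top = fps_section CHAR('a) r * inverse (fps_section CHAR('a) r oo frobenius_map CHAR('a) F)
     oo fps_X ^ CHAR('a)"
proof -
  let ?p = "CHAR('a)"
  let ?s = "fps_section ?p r" and ?F = "frobenius_map ?p F"
  have X0: "fps_nth ((fps_X :: 'a fps) ^ ?p) 0 = 0" using char_pos by simp
  have F0': "fps_nth ?F 0 = 0" using F_0 char_pos by simp
  have "r_top oo F = ?s oo (fps_X ^ ?p oo F)"
    unfolding r_top_def by (rule fps_compose_assoc[symmetric]) (use F_0 X0 in auto)
  also have "fps_X ^ ?p oo F = ?F oo fps_X ^ ?p"
    using fps_power_char[OF char, of ?p 1 F] by (simp add: fps_X_power_compose F_0)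
  also have "?s oo (?F oo fps_X ^ ?p) = (?s oo ?F) oo fps_X ^ ?p"
    by (rule fps_compose_assoc) (use F0' X0 in auto)
  finally show ?thesis
    using X0 r_0 unfolding u_top_def r_top_def
    by (simp add: fps_compose_mult_distrib fps_inverse_compose)
qed

end


section \<open>Propagation of divergence\<close>

text \<open>\<open>D\<close> is the maximum of \<open>root j (w j / B')\<close>. It is attained
  because late roots are at most \<open>root j (B / B') * E\<close>, which tends to \<open>E\<close>
  and so falls below the root at \<open>j0\<close>; \<open>d\<close> is the last index attaining
  it.\<close>

lemma critical_radius:
  fixes w :: "nat \<Rightarrow> real"
  assumes w: "\<And>j. 0 \<le> w j" "\<And>j. j \<ge> 1 \<Longrightarrow> w j \<le> B * E ^ j"
    and j0: "j0 \<ge> 1" "B' * E ^ j0 < w j0" and B: "0 < B'" "B' \<le> B" "0 < E"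
  obtains D d where "E < D" "1 \<le> d" "\<And>j. j \<ge> 1 \<Longrightarrow> w j \<le> B' * D ^ j"
    "\<And>j. j > d \<Longrightarrow> w j < B' * D ^ j" "w d = B' * D ^ d"
proof -
  define \<phi> where "\<phi> j = root j (w j / B')" for j
  have \<phi>0: "\<phi> j \<ge> 0" if "j \<ge> 1" for j using that w(1) B by (simp add: \<phi>_def)
  have \<phi>_pow: "w j = B' * \<phi> j ^ j" if "j \<ge> 1" for j
    using that w(1)[of j] B by (simp add: \<phi>_def real_root_pow_pos2)
  have E_lt: "E < \<phi> j0"
  proof (rule power_less_imp_less_base)
    show "E ^ j0 < \<phi> j0 ^ j0" using j0 \<phi>_pow[OF j0(1)] B by simp
  qed (use \<phi>0 j0 in auto)
  have "(\<lambda>j. root j (B / B') * E) \<longlonglongrightarrow> 1 * E"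
    using B by (intro tendsto_mult LIMSEQ_root_const tendsto_const) auto
  then have "\<forall>\<^sub>F j in sequentially. root j (B / B') * E < \<phi> j0"
    using E_lt by (intro order_tendstoD(2)) auto
  then obtain J where J: "\<And>j. j \<ge> J \<Longrightarrow> root j (B / B') * E < \<phi> j0"
    unfolding eventually_sequentially by blast
  define K where "K = max J j0"
  define D where "D = Max (\<phi> ` {1..K})"
  have Kne: "{1..K} \<noteq> {}" using j0 by (auto simp: K_def)
  have D_ge: "\<phi> j \<le> D" if "1 \<le> j" "j \<le> K" for j
    unfolding D_def using that by (intro Max_ge) auto
  have "D \<ge> \<phi> j0" using j0 by (intro D_ge) (auto simp: K_def)
  have far: "\<phi> j < D" if "j > K" for j
  proof -
    have "\<phi> j \<le> root j (B / B' * E ^ j)"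
      unfolding \<phi>_def using that w(2)[of j] B by (simp add: K_def divide_right_mono)
    also have "\<dots> = root j (B / B') * E"
      unfolding real_root_mult using that B by (simp add: real_root_power_cancel)
    also have "\<dots> < \<phi> j0" using that by (intro J) (auto simp: K_def)
    finally show ?thesis using \<open>D \<ge> \<phi> j0\<close> by simp
  qed
  have "D \<in> \<phi> ` {1..K}" unfolding D_def using Kne by (intro Max_in) auto
  define A where "A = {j \<in> {1..K}. \<phi> j = D}"
  have A: "finite A" "A \<noteq> {}" using \<open>D \<in> \<phi> ` {1..K}\<close> by (auto simp: A_def)
  define d where "d = Max A"
  have dA: "d \<in> A" unfolding d_def using A by (intro Max_in)
  have le: "\<phi> j \<le> D" if "j \<ge> 1" for j
    using D_ge[OF that] far[of j] by fastforce
  have lt: "\<phi> j < D" if "j > d" for j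
  proof (cases "j \<le> K")
    case True
    then have "j \<notin> A" using that A(1) unfolding d_def by (meson Max_ge leD)
    then have "\<phi> j \<noteq> D" using True that dA by (auto simp: A_def)
    then show ?thesis using le[of j] that dA by (auto simp: A_def)
  qed (simp add: far)
  show ?thesis
  proof (rule that)
    show "E < D" using E_lt \<open>D \<ge> \<phi> j0\<close> by simp
    show "1 \<le> d" "w d = B' * D ^ d" using dA \<phi>_pow by (auto simp: A_def)
    show "w j \<le> B' * D ^ j" if "j \<ge> 1" for j
      using that \<phi>_pow[of j] le[OF that] \<phi>0[OF that] B by (auto intro: power_mono)
    show "w j < B' * D ^ j" if "j > d" for j
      using that \<phi>_pow[of j] lt[OF that] \<phi>0[of j] B by (auto intro: power_strict_mono)
  qed
qed

lemma absval_power_char_minus_one: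
  fixes x :: "'a::nonarch_field"
  assumes "prime CHAR('a)" "q = CHAR('a) ^ s"
  shows "absval (x ^ q - 1) = absval (x - 1) ^ q"
  using diff_power_char[OF assms, of x 1] by (simp flip: absval_power)

text \<open>The disc of radius \<open>1 / c\<close> is the one to which the bound of
  \<open>h\<close> is to be extended, and \<open>1 / R\<close> is a possibly much smaller radius on
  which \<open>h\<close> is known to be bounded.\<close>

locale linearized_map =
  fixes lam :: "'a::nonarch_field" and f h :: "'a fps" and c R \<epsilon> :: real
  assumes char: "prime CHAR('a)"
    and eps: "absval (lam - 1) = \<epsilon>" "0 < \<epsilon>" "\<epsilon> < 1"
    and f_0: "fps_nth f 0 = 0" and f_1: "fps_nth f 1 = lam"
    and f_near: "geom_bound c (\<epsilon> / c) (f - fps_const lam * fps_X)"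
    and h_0: "fps_nth h 0 = 0" and h_1: "fps_nth h 1 = 1"
    and conj: "h oo f = fps_const lam * h"
    and c: "1 \<le> c" "c \<le> R" and h_conv: "geom_bound R (1 / R) h"
begin

definition "Q s = CHAR('a) ^ s"
text \<open>\<open>h\<close> is divided by \<open>z\<close> to obtain constant term 1. The exponents
  of \<open>h\<close> kept here are those congruent to 1 modulo \<open>Q s\<close>, which are
  exactly those whose divisor \<open>lam ^ n - lam\<close> has absolute value at most
  \<open>\<epsilon> ^ Q s\<close>.\<close>

definition "H s = Abs_fps (\<lambda>j. fps_nth h (Q s * j + 1))"
definition "F s = frobenius_map (Q s) f"
definition "U s = H s * inverse (H s oo F s)"

lemma p_ge: "CHAR('a) \<ge> 2" using char prime_ge_2_nat by blast

lemma Q_pos: "Q s > 0" using p_ge by (simp add: Q_def)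

lemma Q_Suc: "Q (Suc s) = Q s * CHAR('a)" by (simp add: Q_def)

lemma H_0: "fps_nth (H s) 0 = 1" using h_1 by (simp add: H_def)

lemma F_0: "fps_nth (F s) 0 = 0" using f_0 Q_pos by (simp add: F_def)

lemma U_0: "fps_nth (U s) 0 = 1" by (simp add: U_def H_0)

lemma H_Suc: "H (Suc s) = fps_section CHAR('a) (H s)"
  by (simp add: H_def fps_eq_iff Q_Suc mult_ac)

lemma F_Suc: "F (Suc s) = frobenius_map CHAR('a) (F s)"
  by (simp add: F_def fps_eq_iff Q_Suc power_mult)

lemma absval_lam: "absval lam = 1"
  using absval_eqI_near[of 1 lam] eps by (simp add: absval_one absval_minus_commute)

lemma eps_Q: "0 < \<epsilon> ^ Q s" "\<epsilon> ^ Q s < 1"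
  using eps Q_pos[of s] by (auto simp: power_less_one_iff)

lemma c_Q_pos: "0 < c ^ Q s"
  using c by simp

lemma near_identity_F:
  assumes "c ^ Q s \<le> D"
  shows "near_identity (F s) D (\<epsilon> ^ Q s) (c ^ Q s / D)"
proof -
  have D: "D > 0" "c > 0" using assms c c_Q_pos[of s] by linarith+
  have "geom_bound D (\<epsilon> ^ Q s * (c ^ Q s / D) / D) (F s - fps_const (fps_nth (F s) 1) * fps_X)"
  proof (rule geom_boundI)
    fix k
    show "absval (fps_nth (F s - fps_const (fps_nth (F s) 1) * fps_X) k)
        \<le> \<epsilon> ^ Q s * (c ^ Q s / D) / D * D ^ k"
    proof (cases "k \<ge> 2")
      case False
      then have "k = 0 \<or> k = 1" by auto
      then show ?thesis
        using D eps(2) F_0[of s] Q_pos[of s] by (auto simp: F_def power_0_left)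
    next
      case True
      then obtain i where i: "k = Suc (Suc i)" by (metis add_2_eq_Suc le_Suc_ex)
      have "absval (fps_nth f k) \<le> \<epsilon> / c * c ^ k"
        using geom_boundD[OF f_near, of k] i by simp
      also have "\<dots> = \<epsilon> * c * c ^ i" using D i by simp
      finally have "absval (fps_nth f k) ^ Q s \<le> (\<epsilon> * c * c ^ i) ^ Q s"
        by (intro power_mono) auto
      also have "\<dots> = \<epsilon> ^ Q s * c ^ Q s * (c ^ Q s) ^ i"
        by (simp add: power_mult_distrib power_mult[symmetric] mult.commute)
      also have "\<dots> \<le> \<epsilon> ^ Q s * c ^ Q s * D ^ i"
        using assms D eps by (intro mult_left_mono power_mono) auto
      also have "\<dots> = \<epsilon> ^ Q s * (c ^ Q s / D) / D * D ^ k" using D i by simp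
      finally show ?thesis using i by (simp add: F_def absval_power)
    qed
  qed
  moreover have "absval (fps_nth (F s) 1 - 1) = \<epsilon> ^ Q s"
    using absval_power_char_minus_one[OF char, of "Q s" s lam] eps(1) f_1
    by (simp add: F_def Q_def)
  ultimately show ?thesis
    using char F_0 eps_Q D assms by unfold_locales (auto simp: F_0)
qed

lemma cocycle_step_F:
  assumes "c ^ Q s \<le> D" "geom_bound D (\<epsilon> ^ Q s) (U s - 1)"
  shows "cocycle_step (H s) (F s) D (\<epsilon> ^ Q s) (c ^ Q s / D)"
  using near_identity_F[OF assms(1)] assms(2) H_0
  by (intro cocycle_step.intro) (auto simp: cocycle_step_axioms_def U_def)

lemma u_top_U:
  assumes "c ^ Q s \<le> D" "geom_bound D (\<epsilon> ^ Q s) (U s - 1)"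
  shows "cocycle_step.u_top (H s) (F s) = U (Suc s) oo fps_X ^ CHAR('a)"
  using cocycle_step.u_top_eq[OF cocycle_step_F[OF assms]] by (simp add: U_def H_Suc F_Suc)

text \<open>Exponents and radius rescale by \<open>p\<close>, but the constant stays
  \<open>\<epsilon> ^ Q s\<close>, whereas a step at level \<open>Suc s\<close> requires the smaller
  \<open>\<epsilon> ^ Q (Suc s)\<close>. Whether this loss is real is what the obstruction
  decides.\<close>

lemma U_Suc_bound:
  assumes "c ^ Q s \<le> D" "geom_bound D (\<epsilon> ^ Q s) (U s - 1)" "j \<ge> 1"
  shows "absval (fps_nth (U (Suc s)) j) \<le> \<epsilon> ^ Q s * (D ^ CHAR('a)) ^ j"
proof -
  have "absval (fps_nth ((U (Suc s) oo fps_X ^ CHAR('a)) - 1) (CHAR('a) * j))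
      \<le> \<epsilon> ^ Q s * D ^ (CHAR('a) * j)"
    using geom_boundD[OF cocycle_step.u_top_near_1[OF cocycle_step_F[OF assms(1,2)]]]
    unfolding u_top_U[OF assms(1,2)] .
  then show ?thesis
    using assms(3) p_ge by (simp add: fps_compose_X_power_nth power_mult)
qed

text \<open>The convergence of \<open>h\<close> enters through this bound: it caps every critical
  \<open>D\<close> at level \<open>s\<close> by \<open>R ^ Q s\<close>.\<close>

lemma U_conv: "geom_bound (R ^ Q s) (\<epsilon> ^ Q s) (U s - 1)"
proof -
  interpret near_identity "F s" "R ^ Q s" "\<epsilon> ^ Q s" "c ^ Q s / R ^ Q s"
    using c by (intro near_identity_F power_mono) auto
  have Rpos: "R > 0" using c by simp
  have H: "geom_bound (R ^ Q s) 1 (H s)"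
  proof (rule geom_boundI)
    fix j
    have "absval (fps_nth h (Q s * j + 1)) \<le> 1 / R * R ^ (Q s * j + 1)" by (rule geom_boundD[OF h_conv])
    then show "absval (fps_nth (H s) j) \<le> 1 * (R ^ Q s) ^ j"
      using Rpos by (simp add: H_def power_mult)
  qed
  have ne: "fps_nth (H s oo F s) 0 \<noteq> 0" using H_0 by simp
  have "U s - 1 = (H s - (H s oo F s)) * inverse (H s oo F s)"
    unfolding left_diff_distrib inverse_mult_eq_1'[OF ne] by (simp add: U_def)
  moreover have "geom_bound (R ^ Q s) (\<epsilon> ^ Q s * 1) ((H s - (H s oo F s)) * inverse (H s oo F s))"
    using compose_F_near[OF H] geom_bound_compose[OF H F_bound D_pos] H_0 D_pos
    by (intro geom_bound_mult geom_bound_inverse)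
       (auto simp: absval_one geom_bound_diff_commute[of _ _ "H s"])
  ultimately show ?thesis by simp
qed

text \<open>
  At level \<open>s\<close> the cocycle \<open>U s\<close> is too large to be trivialized beyond radius \<open>1 / D\<close>, and its
  last critical coefficient has index \<open>d\<close>. As the reduction of \<open>U s - 1\<close> is then a polynomial,
  it is not a logarithmic derivative, and the obstruction survives at level \<open>s + 1\<close>.
\<close>

definition critical :: "nat \<Rightarrow> real \<Rightarrow> nat \<Rightarrow> bool" where
  "critical s D d \<longleftrightarrow> c ^ Q s < D \<and> 1 \<le> d
    \<and> (\<forall>m\<ge>1. absval (fps_nth (U s) m) \<le> \<epsilon> ^ Q s * D ^ m)
    \<and> (\<forall>m>d. absval (fps_nth (U s) m) < \<epsilon> ^ Q s * D ^ m)
    \<and> absval (fps_nth (U s) d) = \<epsilon> ^ Q s * D ^ d"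

lemma U_minus_1_bound:
  assumes "\<And>m. m \<ge> 1 \<Longrightarrow> absval (fps_nth (U s) m) \<le> B * D ^ m" "0 \<le> B"
  shows "geom_bound D B (U s - 1)"
proof (rule geom_boundI)
  fix m show "absval (fps_nth (U s - 1) m) \<le> B * D ^ m"
    using assms U_0 by (cases "m = 0") auto
qed

text \<open>Otherwise \<open>u_top\<close> is negligible up to exponent \<open>p * d\<close>, so
  \<open>(\<mu> - 1) * \<rho>\<close> must cancel the critical coefficient at \<open>d\<close>. By
  Frobenius \<open>\<rho>\<close> is then of full size at \<open>p * d\<close> as well, where
  \<open>U s\<close> has nothing left to cancel it, since \<open>p * d > d\<close>.\<close>

lemma critical_obstruction:
  assumes "critical s D d"
  obtains j where "1 \<le> j" "j \<le> d"
    "absval (fps_nth (U (Suc s)) j) = \<epsilon> ^ Q s * (D ^ CHAR('a)) ^ j"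
proof -
  let ?p = "CHAR('a)" and ?\<delta> = "\<epsilon> ^ Q s"
  note crit = assms[unfolded critical_def]
  have cD: "c ^ Q s \<le> D" using crit by simp
  have U1: "geom_bound D ?\<delta> (U s - 1)"
    using crit eps by (intro U_minus_1_bound) auto
  interpret cocycle_step "H s" "F s" D ?\<delta> "c ^ Q s / D" by (rule cocycle_step_F[OF cD U1])
  note u_top = u_top_U[OF cD U1]
  have u: "u = U s" by (simp add: u_def U_def)
  define \<gamma> where "\<gamma> = max (c ^ Q s / D) ?\<delta>"
  have \<gamma>: "\<gamma> < 1" using crit eps_Q D_pos by (auto simp: \<gamma>_def)
  have err: "absval (fps_nth u_top k - fps_nth (U s) k - (\<mu> - 1) * fps_nth \<rho> k) < ?\<delta> * D ^ k" for k
  proof -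
    have "absval (fps_nth u_top k - fps_nth (U s) k - (\<mu> - 1) * fps_nth \<rho> k) \<le> ?\<delta> * \<gamma> * D ^ k"
      using geom_boundD[OF u_top_near, of k] by (simp add: u \<gamma>_def)
    also have "\<dots> < ?\<delta> * D ^ k" using \<gamma> eps_Q[of s] D_pos by simp
    finally show ?thesis .
  qed
  have "\<exists>j. 1 \<le> j \<and> j \<le> d \<and> absval (fps_nth (U (Suc s)) j) = ?\<delta> * (D ^ ?p) ^ j"
  proof (rule ccontr)
    assume no: "\<not> ?thesis"
    have lt: "absval (fps_nth u_top k) < ?\<delta> * D ^ k" if k: "1 \<le> k" "k \<le> ?p * d" for k
    proof (cases "?p dvd k")
      case True
      then obtain j where j: "k = ?p * j" ..
      then have jd: "1 \<le> j" "j \<le> d" using k p_ge by (auto simp: Suc_le_eq)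
      have "absval (fps_nth (U (Suc s)) j) < ?\<delta> * (D ^ ?p) ^ j"
        using U_Suc_bound[OF cD U1 jd(1)] no jd by (meson le_less)
      then show ?thesis
        using j p_ge by (simp add: u_top fps_compose_X_power_nth power_mult)
    next
      case False
      then show ?thesis
        using D_pos eps_Q[of s] by (simp add: u_top fps_compose_X_power_nth char_pos)
    qed
    have "d \<le> ?p * d" using p_ge by simp
    then have "absval (fps_nth (U s) d - (- ((\<mu> - 1) * fps_nth \<rho> d))) < ?\<delta> * D ^ d"
      using lt[of d] err[of d] crit absval_diff_le[of "fps_nth u_top d"
          "fps_nth u_top d - fps_nth (U s) d - (\<mu> - 1) * fps_nth \<rho> d"] by simp
    then have "absval ((\<mu> - 1) * fps_nth \<rho> d) = ?\<delta> * D ^ d"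
      using absval_eqI_near[of "fps_nth (U s) d" "- ((\<mu> - 1) * fps_nth \<rho> d)"] crit by simp
    then have "absval (fps_nth \<rho> d) = D ^ d"
      using mu_minus_1 eps_Q[of s] eps(2) by (simp add: absval_mult)
    then have "absval ((\<mu> - 1) * fps_nth \<rho> (?p * d)) = ?\<delta> * D ^ (?p * d)"
      unfolding rho_frobenius absval_mult absval_power mu_minus_1
      by (simp add: power_mult[symmetric] mult.commute)
    moreover have "absval ((\<mu> - 1) * fps_nth \<rho> (?p * d)) < ?\<delta> * D ^ (?p * d)"
    proof -
      let ?k = "?p * d"
      have k: "?k > d" using crit p_ge by auto
      then have 1: "absval (fps_nth (U s) ?k) < ?\<delta> * D ^ ?k" using crit by blast
      have 2: "absval (fps_nth u_top ?k) < ?\<delta> * D ^ ?k" using k by (intro lt) auto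
      have "(\<mu> - 1) * fps_nth \<rho> ?k = fps_nth u_top ?k - fps_nth (U s) ?k
          - (fps_nth u_top ?k - fps_nth (U s) ?k - (\<mu> - 1) * fps_nth \<rho> ?k)" by simp
      then have "absval ((\<mu> - 1) * fps_nth \<rho> ?k) \<le> max (absval (fps_nth u_top ?k - fps_nth (U s) ?k))
          (absval (fps_nth u_top ?k - fps_nth (U s) ?k - (\<mu> - 1) * fps_nth \<rho> ?k))"
        by (metis absval_diff_le)
      with 1 2 err[of ?k] absval_diff_le[of "fps_nth u_top ?k" "fps_nth (U s) ?k"]
      show ?thesis by linarith
    qed
    ultimately show False by simp
  qed
  then show ?thesis using that by blast
qed

text \<open>The obstruction has size \<open>\<epsilon> ^ Q s\<close>, while level
  \<open>Suc s\<close> tolerates only \<open>\<epsilon> ^ Q (Suc s)\<close>, at most the square of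
  it. So \<open>D'\<close> exceeds \<open>D ^ p\<close> by a definite factor, which is the gain in
  the last claim.\<close>

lemma critical_Suc:
  assumes "critical s D d"
  obtains D' d' where "critical (Suc s) D' d'" "d' \<le> d"
    "\<And>e. e \<ge> d \<Longrightarrow> (D ^ CHAR('a)) ^ e \<le> \<epsilon> ^ Q s * D' ^ e"
proof -
  let ?p = "CHAR('a)" and ?\<delta> = "\<epsilon> ^ Q s" and ?E = "D ^ CHAR('a)"
  note crit = assms[unfolded critical_def]
  have cD: "c ^ Q s \<le> D" using crit by simp
  have Dpos: "D > 0" using crit c_Q_pos[of s] by linarith
  have U1: "geom_bound D ?\<delta> (U s - 1)"
    using crit eps by (intro U_minus_1_bound) auto
  obtain j where j: "1 \<le> j" "j \<le> d" "absval (fps_nth (U (Suc s)) j) = ?\<delta> * ?E ^ j"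
    using critical_obstruction[OF assms] .
  have "Q s * 2 \<le> Q (Suc s)" using p_ge by (simp add: Q_Suc)
  then have "\<epsilon> ^ Q (Suc s) \<le> \<epsilon> ^ (Q s * 2)" using eps by (intro power_decreasing) auto
  also have "\<dots> = ?\<delta> * ?\<delta>" by (simp add: power_mult power2_eq_square)
  finally have sq: "\<epsilon> ^ Q (Suc s) \<le> ?\<delta> * ?\<delta>" .
  also have "\<dots> < ?\<delta>" using eps_Q[of s] by simp
  finally have lt: "\<epsilon> ^ Q (Suc s) < ?\<delta>" .
  obtain D' d' where D': "?E < D'" "1 \<le> d'"
    "\<And>j. j \<ge> 1 \<Longrightarrow> absval (fps_nth (U (Suc s)) j) \<le> \<epsilon> ^ Q (Suc s) * D' ^ j"
    "\<And>j. j > d' \<Longrightarrow> absval (fps_nth (U (Suc s)) j) < \<epsilon> ^ Q (Suc s) * D' ^ j"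
    "absval (fps_nth (U (Suc s)) d') = \<epsilon> ^ Q (Suc s) * D' ^ d'"
    using critical_radius[of "\<lambda>j. absval (fps_nth (U (Suc s)) j)" ?\<delta> ?E j "\<epsilon> ^ Q (Suc s)"]
      U_Suc_bound[OF cD U1] j lt Dpos eps_Q[of "Suc s"] by auto
  have E: "?E > 0" using Dpos by simp
  have jb: "?\<delta> * ?E ^ j \<le> \<epsilon> ^ Q (Suc s) * D' ^ j" using D'(3)[OF j(1)] j(3) by simp
  show ?thesis
  proof (rule that[of D' d'])
    have "c ^ Q (Suc s) \<le> ?E"
      unfolding Q_Suc power_mult using cD c by (intro power_mono) auto
    then show "critical (Suc s) D' d'" unfolding critical_def using D' by auto
    \<comment> \<open>By the bound for \<open>U (Suc s)\<close> at \<open>d'\<close>, the power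
      \<open>(D' / ?E) ^ d'\<close> is at most \<open>?\<delta> / \<epsilon> ^ Q (Suc s)\<close>, a
      value which the power with exponent \<open>j\<close> already reaches.\<close>
    have "d' \<le> j"
    proof (rule ccontr)
      assume "\<not> d' \<le> j"
      then have "(D' / ?E) ^ j < (D' / ?E) ^ d'"
        using D'(1) E by (intro power_strict_increasing) auto
      moreover have "\<epsilon> ^ Q (Suc s) * D' ^ d' \<le> ?\<delta> * ?E ^ d'"
        using U_Suc_bound[OF cD U1 D'(2)] D'(5) by simp
      then have "(D' / ?E) ^ d' \<le> ?\<delta> / \<epsilon> ^ Q (Suc s)"
        using E eps_Q[of "Suc s"] by (simp add: power_divide field_simps)
      moreover have "?\<delta> / \<epsilon> ^ Q (Suc s) \<le> (D' / ?E) ^ j"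
        using jb E eps_Q[of "Suc s"] by (simp add: power_divide field_simps)
      ultimately show False by simp
    qed
    then show "d' \<le> d" using j by simp
    fix e assume e: "e \<ge> d"
    have "?\<delta> * ?E ^ j \<le> (?\<delta> * ?\<delta>) * D' ^ j"
      using jb sq D'(1) E by (meson mult_right_mono order_trans zero_le_power less_imp_le less_trans)
    then have "?E ^ j \<le> ?\<delta> * D' ^ j" using eps_Q[of s] by (simp add: mult.assoc)
    then have "?E ^ j * ?E ^ (e - j) \<le> (?\<delta> * D' ^ j) * D' ^ (e - j)"
      using D'(1) E eps_Q[of s] by (intro mult_mono power_mono) auto
    then show "?E ^ e \<le> ?\<delta> * D' ^ e"
      using e j by (simp add: mult.assoc power_add[symmetric])
  qed
qed

text \<open>Relative to the scale \<open>Q (s + n)\<close> each step gains a fixed power of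
  \<open>\<epsilon>\<close>, while \<open>U_conv\<close> caps \<open>D'\<close> by a fixed
  \<open>R\<close> on the same scale. So \<open>\<epsilon> ^ n * R ^ (d * p)\<close> would have to
  stay above 1 for all \<open>n\<close>.\<close>

lemma not_critical: "\<not> critical s D d"
proof
  assume crit: "critical s D d"
  let ?p = "CHAR('a)"
  \<comment> \<open>The outer power \<open>p\<close> makes the inequality reproduce itself: the gain
    \<open>\<epsilon> ^ Q (s + n)\<close> raised to \<open>p\<close> is one factor
    \<open>\<epsilon> ^ Q (s + Suc n)\<close>. The initial \<open>d\<close> can be kept because the
    critical index never grows.\<close>
  have "\<exists>D' d'. critical (s + n) D' d' \<and> d' \<le> d \<and> 1 \<le> \<epsilon> ^ (n * Q (s + n)) * (D' ^ d) ^ ?p" for n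
  proof (induction n)
    case 0
    have "1 \<le> c ^ Q s" using c by simp
    then have "1 \<le> D" using crit by (simp add: critical_def)
    then show ?case using crit by (intro exI[of _ D] exI[of _ d]) simp
  next
    case (Suc n)
    then obtain D' d' where IH: "critical (s + n) D' d'" "d' \<le> d"
      "1 \<le> \<epsilon> ^ (n * Q (s + n)) * (D' ^ d) ^ ?p" by blast
    obtain D2 d2 where D2: "critical (Suc (s + n)) D2 d2" "d2 \<le> d'"
      "\<And>e. e \<ge> d' \<Longrightarrow> (D' ^ ?p) ^ e \<le> \<epsilon> ^ Q (s + n) * D2 ^ e"
      using critical_Suc[OF IH(1)] by blast
    have D'pos: "0 < D'" using IH(1) c_Q_pos[of "s + n"] by (auto simp: critical_def)
    have "1 \<le> (\<epsilon> ^ (n * Q (s + n)) * (D' ^ d) ^ ?p) ^ ?p" using IH(3) by simp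
    also have "\<dots> = \<epsilon> ^ (n * Q (s + Suc n)) * ((D' ^ ?p) ^ d) ^ ?p"
      by (simp add: power_mult_distrib power_mult[symmetric] Q_Suc mult_ac)
    also have "\<dots> \<le> \<epsilon> ^ (n * Q (s + Suc n)) * (\<epsilon> ^ Q (s + n) * D2 ^ d) ^ ?p"
      using D2(3)[of d] IH(2) eps D'pos by (intro mult_left_mono power_mono) auto
    also have "\<dots> = \<epsilon> ^ (Suc n * Q (s + Suc n)) * (D2 ^ d) ^ ?p"
      by (simp add: power_mult_distrib power_mult[symmetric] power_add[symmetric] Q_Suc
          mult_ac add_mult_distrib2)
    finally show ?case using D2 IH(2) by (intro exI[of _ D2] exI[of _ d2]) auto
  qed
  note * = this
  have "1 \<le> \<epsilon> ^ n * R ^ (d * ?p)" for n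
  proof -
    let ?Q = "Q (s + n)"
    obtain D' d' where D': "critical (s + n) D' d'" "1 \<le> \<epsilon> ^ (n * ?Q) * (D' ^ d) ^ ?p"
      using * by blast
    note cr = D'(1)[unfolded critical_def]
    have D'pos: "0 < D'" using cr c_Q_pos[of "s + n"] by linarith
    have "\<epsilon> ^ ?Q * D' ^ d' \<le> \<epsilon> ^ ?Q * (R ^ ?Q) ^ d'"
      using geom_boundD[OF U_conv[of "s + n"], of d'] cr by auto
    then have "D' ^ d' \<le> (R ^ ?Q) ^ d'" using eps_Q by simp
    then have "D' \<le> R ^ ?Q"
      using cr c power_mono_iff[of D' "R ^ ?Q" d'] D'pos by simp
    then have "(D' ^ d) ^ ?p \<le> ((R ^ ?Q) ^ d) ^ ?p" using D'pos by (intro power_mono) auto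
    with D'(2) have "1 \<le> \<epsilon> ^ (n * ?Q) * ((R ^ ?Q) ^ d) ^ ?p"
      using eps by (meson mult_left_mono order_trans zero_le_power less_imp_le)
    also have "\<dots> = (\<epsilon> ^ n * R ^ (d * ?p)) ^ ?Q"
      by (simp add: power_mult_distrib power_mult[symmetric] mult_ac)
    finally show ?thesis
      using Q_pos[of "s + n"] eps c by (smt (verit) power_less_one_iff mult_nonneg_nonneg zero_le_power)
  qed
  moreover have "(\<lambda>n. \<epsilon> ^ n * R ^ (d * ?p)) \<longlonglongrightarrow> 0 * R ^ (d * ?p)"
    using eps by (intro tendsto_mult LIMSEQ_power_zero tendsto_const) auto
  ultimately show False
    using LIMSEQ_le_const[of "\<lambda>n. \<epsilon> ^ n * R ^ (d * ?p)" 0 1] by auto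
qed

text \<open>At level 0, \<open>lam * U 0\<close> is \<open>f / z\<close>. A failure at level
  \<open>Suc s\<close>, together with the weaker bound of \<open>U_Suc_bound\<close>, would produce
  a critical triple through \<open>critical_radius\<close>.\<close>

lemma U_near_1: "geom_bound (c ^ Q s) (\<epsilon> ^ Q s) (U s - 1)"
proof (induction s)
  case 0
  define f\<^sub>1 where "f\<^sub>1 = fps_shift 1 f"
  have f: "f = fps_X * f\<^sub>1" unfolding f\<^sub>1_def using f_0 by (simp add: fps_eq_iff)
  have h: "h = fps_X * H 0" using h_0 by (simp add: H_def Q_def fps_eq_iff)
  have F: "F 0 = f" by (simp add: F_def Q_def fps_eq_iff)
  have "f * (H 0 oo f) = h oo f"
    using f_0 by (subst (2) h) (simp add: fps_compose_mult_distrib)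
  also have "\<dots> = fps_X * (fps_const lam * H 0)" unfolding conj by (subst h) (simp add: mult_ac)
  finally have "fps_X * (f\<^sub>1 * (H 0 oo f)) = fps_X * (fps_const lam * H 0)"
    by (subst (asm) (1) f) (simp add: mult.assoc)
  then have eq: "f\<^sub>1 * (H 0 oo f) = fps_const lam * H 0" by simp
  have ne: "fps_nth (H 0 oo f) 0 \<noteq> 0" using H_0 by simp
  have "fps_const lam * U 0 = (f\<^sub>1 * (H 0 oo f)) * inverse (H 0 oo f)"
    unfolding eq by (simp add: U_def F mult.assoc)
  then have U: "fps_const lam * U 0 = f\<^sub>1"
    by (simp only: mult.assoc inverse_mult_eq_1'[OF ne] mult_1_right)
  show ?case
  proof (rule U_minus_1_bound)
    fix m :: nat assume m: "1 \<le> m"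
    have "lam * fps_nth (U 0) m = fps_nth f (Suc m)"
      using arg_cong[OF U, of "\<lambda>x. fps_nth x m"] by (simp add: f\<^sub>1_def)
    then have "absval (fps_nth (U 0) m) = absval (fps_nth f (Suc m))"
      using absval_lam by (metis absval_mult mult_1)
    also have "\<dots> = absval (fps_nth (f - fps_const lam * fps_X) (Suc m))" using m by simp
    also have "\<dots> \<le> \<epsilon> / c * c ^ Suc m" by (rule geom_boundD[OF f_near])
    finally show "absval (fps_nth (U 0) m) \<le> \<epsilon> ^ Q 0 * (c ^ Q 0) ^ m"
      using c by (simp add: Q_def)
  qed (use eps in auto)
next
  case (Suc s)
  show ?case
  proof (rule ccontr)
    assume "\<not> ?thesis"
    then obtain j where j: "1 \<le> j" "\<epsilon> ^ Q (Suc s) * (c ^ Q (Suc s)) ^ j < absval (fps_nth (U (Suc s)) j)"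
      using U_minus_1_bound[of "Suc s" "\<epsilon> ^ Q (Suc s)" "c ^ Q (Suc s)"] eps
      by (metis linorder_not_le zero_le_power less_imp_le)
    have "\<epsilon> ^ Q (Suc s) \<le> \<epsilon> ^ Q s"
      using eps p_ge by (intro power_decreasing) (auto simp: Q_Suc)
    moreover have "absval (fps_nth (U (Suc s)) j) \<le> \<epsilon> ^ Q s * (c ^ Q (Suc s)) ^ j" if "1 \<le> j" for j
      using U_Suc_bound[OF order_refl Suc that] by (simp add: Q_Suc power_mult)
    moreover have "c ^ Q (Suc s) > 0" using c by simp
    ultimately obtain D d where "critical (Suc s) D d"
      using critical_radius[of "\<lambda>j. absval (fps_nth (U (Suc s)) j)" "\<epsilon> ^ Q s" "c ^ Q (Suc s)"
          j "\<epsilon> ^ Q (Suc s)"] j eps_Q[of "Suc s"] unfolding critical_def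
      by (metis absval_nonneg)
    then show False using not_critical by blast
  qed
qed

text \<open>All levels now admit a cocycle step with \<open>D = c ^ Q s\<close>, so
  \<open>H s\<close> is a bounded \<open>g\<close> times \<open>r_top\<close>, whose coefficients
  come from \<open>H (Suc s)\<close> at smaller indices. Hence the induction on \<open>j\<close> for
  all \<open>s\<close> at once.\<close>

theorem linearization_bound: "geom_bound c (1 / c) h"
proof -
  have "absval (fps_nth (H s) j) \<le> (c ^ Q s) ^ j" for s j
  proof (induction j arbitrary: s rule: less_induct)
    case (less j)
    interpret cocycle_step "H s" "F s" "c ^ Q s" "\<epsilon> ^ Q s" "c ^ Q s / c ^ Q s"
      using U_near_1 by (intro cocycle_step_F) auto
    let ?p = "CHAR('a)"
    have r_top: "absval (fps_nth r_top i) \<le> 1 * (c ^ Q s) ^ i" if "i \<le> j" for i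
    proof (cases "?p dvd i \<and> i > 0")
      case True
      then obtain k where k: "i = ?p * k" "k > 0" by (auto elim!: dvdE)
      have "absval (fps_nth (H (Suc s)) k) \<le> (c ^ Q (Suc s)) ^ k"
      proof (intro less)
        have "k < ?p * k" using k p_ge by simp
        then show "k < j" using k that by linarith
      qed
      also have "\<dots> = (c ^ Q s) ^ i" by (simp add: k power_mult Q_Suc)
      finally show ?thesis
        using k p_ge by (simp add: r_top_def fps_compose_X_power_nth H_Suc)
    next
      case False
      then show ?thesis
        using D_pos H_0 by (auto simp: r_top_def fps_compose_X_power_nth char_pos absval_one)
    qed
    have "absval (\<Sum>i = 0..j. fps_nth r_top i * fps_nth g (j - i)) \<le> (c ^ Q s) ^ j"
    proof (rule absval_sum_bound)
      fix i assume i: "i \<in> {0..j}"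
      have "absval (fps_nth r_top i * fps_nth g (j - i)) \<le> (1 * (c ^ Q s) ^ i) * (1 * (c ^ Q s) ^ (j - i))"
        unfolding absval_mult using i D_pos
        by (intro mult_mono r_top geom_boundD[OF g_bound]) auto
      then show "absval (fps_nth r_top i * fps_nth g (j - i)) \<le> (c ^ Q s) ^ j"
        using i by (simp add: power_add[symmetric])
    qed (use D_pos in simp)
    then show ?case
      by (subst r_factor) (simp add: mult.commute[of g] fps_mult_nth)
  qed
  note * = this
  show ?thesis
  proof (rule geom_boundI)
    fix n
    show "absval (fps_nth h n) \<le> 1 / c * c ^ n"
    proof (cases n)
      case (Suc m)
      then show ?thesis using *[of 0 m] c by (simp add: H_def Q_def)
    qed (use h_0 c in simp)
  qed
qed

end


section \<open>Small leading coefficient\<close>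

text \<open>The recursion is that of \<open>1 / (1 + z + \<beta> z ^ N)\<close>. With
  \<open>N = p - 1\<close> the listed indices are 1, 2 and those within distance 2 below
  \<open>p\<close> and \<open>2 * p\<close>, all that the Cartier condition will compare.\<close>

lemma trinomial_inverse_coeffs:
  fixes e :: "nat \<Rightarrow> 'a::comm_ring_1"
  assumes N: "even N" "N \<ge> 3" "of_nat N = (-1 :: 'a)" and e0: "e 0 = 1"
    and lt: "\<And>n. 0 < n \<Longrightarrow> n < N \<Longrightarrow> e n = - e (n - 1)"
    and ge: "\<And>n. n \<ge> N \<Longrightarrow> e n = - e (n - 1) - \<beta> * e (n - N)"
  shows "e 1 = -1" "e 2 = 1" "e (N - 1) = -1" "e N = 1 - \<beta>" "e (N + 1) = -1 + 2 * \<beta>"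
    "e (2 * N) = 1 + \<beta>\<^sup>2" "e (2 * N + 1) = -1 + \<beta> - 3 * \<beta>\<^sup>2"
    "e (2 * N + 2) = 1 - 2 * \<beta> + 6 * \<beta>\<^sup>2"
proof -
  have 1: "e n = (-1) ^ n" if "n < N" for n
    using that by (induction n) (use e0 lt in auto)
  have 2: "e (N + i) = (-1) ^ i * (1 - of_nat (Suc i) * \<beta>)" if "i < N" for i
    using that
  proof (induction i)
    case 0
    have "e (N - 1) = -1" using 1[of "N - 1"] N by (cases N) auto
    then show ?case using ge[of N] e0 by simp
  next
    case (Suc i)
    have "e (N + Suc i) = - e (N + i) - \<beta> * e (Suc i)" using ge[of "N + Suc i"] by simp
    also have "e (Suc i) = (-1) ^ Suc i" by (rule 1) (use Suc.prems in simp)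
    also have "e (N + i) = (-1) ^ i * (1 - of_nat (Suc i) * \<beta>)"
      by (rule Suc.IH) (use Suc.prems in simp)
    finally show ?case by (simp add: algebra_simps)
  qed
  show "e 1 = -1" "e 2 = 1" using 1[of 1] 1[of 2] N by auto
  show "e (N - 1) = -1" using 1[of "N - 1"] N by (cases N) auto
  show b: "e N = 1 - \<beta>" using 2[of 0] N by simp
  show c: "e (N + 1) = -1 + 2 * \<beta>" using 2[of 1] N by simp
  have d: "e (N + 2) = 1 - 3 * \<beta>" using 2[of 2] N by simp
  have "e (2 * N - 1) = - 1 - \<beta>"
  proof -
    have "2 * N - 1 = N + (N - 1)" "Suc (N - 1) = N" using N by auto
    moreover have "(-1 :: 'a) ^ (N - 1) = -1" using N by (cases N) auto
    ultimately show ?thesis using 2[of "N - 1"] N by (simp del: of_nat_Suc)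
  qed
  then show f: "e (2 * N) = 1 + \<beta>\<^sup>2"
    using ge[of "2 * N"] b N by (simp add: algebra_simps power2_eq_square mult_2)
  show g: "e (2 * N + 1) = -1 + \<beta> - 3 * \<beta>\<^sup>2"
  proof -
    have "e (2 * N + 1) = - e (2 * N) - \<beta> * e (N + 1)" using ge[of "2 * N + 1"] by (simp add: mult_2)
    then show ?thesis unfolding c f by (simp add: algebra_simps power2_eq_square)
  qed
  have "e (2 * N + 2) = - e (2 * N + 1) - \<beta> * e (N + 2)" using ge[of "2 * N + 2"] by (simp add: mult_2)
  then show "e (2 * N + 2) = 1 - 2 * \<beta> + 6 * \<beta>\<^sup>2"
    unfolding d g by (simp add: algebra_simps power2_eq_square)
qed

lemma geom_bound_const_mult_unit:
  assumes "absval a = 1" "c > 0"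
  shows "geom_bound c B (fps_const a * g) \<longleftrightarrow> geom_bound c B g"
  using assms by (simp add: geom_bound_def absval_mult)

lemma geom_bound_const_mult_iff:
  assumes "a \<noteq> 0"
  shows "geom_bound c (absval a * B) (fps_const a * g) \<longleftrightarrow> geom_bound c B g"
  using assms by (simp add: geom_bound_def absval_mult mult.assoc)

lemma geom_bound_1_X_mult_iff: "geom_bound 1 B (fps_X * g) \<Longrightarrow> geom_bound 1 B g"
  unfolding geom_bound_def by (metis fps_X_mult_nth One_nat_def diff_Suc_1 nat.simps(3) power_one)

lemma absval_numeral_units:
  assumes "prime CHAR('a::nonarch_field)" "CHAR('a) \<ge> 5"
  shows "absval (2 :: 'a) = 1" "absval (3 :: 'a) = 1" "absval (6 :: 'a) = 1"
proof -
  have "\<not> CHAR('a) dvd 2" "\<not> CHAR('a) dvd 3" using assms(2) by (auto dest: dvd_imp_le)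
  then show 2: "absval (2 :: 'a) = 1" and 3: "absval (3 :: 'a) = 1"
    using absval_of_nat_unit[OF assms(1), of 2] absval_of_nat_unit[OF assms(1), of 3] by auto
  have "absval (2 * 3 :: 'a) = 1" unfolding absval_mult 2 3 by simp
  then show "absval (6 :: 'a) = 1" by simp
qed

text \<open>Expressing all derivatives as multiples of \<open>h\<close> allows \<open>h\<close> to
  be cancelled from the Taylor formula, leaving an equation in \<open>P\<close> alone.\<close>

lemma second_and_third_derivative:
  fixes v h P :: "'a::field fps"
  assumes vh: "v * fps_deriv h = P * h"
  defines "Z \<equiv> v * fps_deriv P + P\<^sup>2 - fps_deriv v * P"
  shows "v\<^sup>2 * fps_deriv (fps_deriv h) = Z * h"
    and "v ^ 3 * fps_deriv (fps_deriv (fps_deriv h))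
      = (v * fps_deriv Z + Z * P - 2 * fps_deriv v * Z) * h"
proof -
  let ?h1 = "fps_deriv h" and ?h2 = "fps_deriv (fps_deriv h)"
  have "v * (v * ?h2) + fps_deriv v * (v * ?h1) = v * fps_deriv P * h + P * (v * ?h1)"
    using arg_cong[OF vh, of "\<lambda>x. v * fps_deriv x"] by (simp add: algebra_simps)
  then show 2: "v\<^sup>2 * ?h2 = Z * h"
    unfolding vh Z_def by (simp add: algebra_simps power2_eq_square)
  have "v * (v\<^sup>2 * fps_deriv ?h2) + 2 * fps_deriv v * (v\<^sup>2 * ?h2) = v * fps_deriv Z * h + Z * (v * ?h1)"
    using arg_cong[OF 2, of "\<lambda>x. v * fps_deriv x"]
    by (simp add: algebra_simps power2_eq_square)
  then show "v ^ 3 * fps_deriv ?h2 = (v * fps_deriv Z + Z * P - 2 * fps_deriv v * Z) * h"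
    unfolding vh 2 by (simp add: algebra_simps power2_eq_square power3_eq_cube)
qed

text \<open>
  Here \<open>P\<close> is \<open>v h' / h\<close> for \<open>f z = z + (lam - 1) v z\<close>, so that \<open>P / v1\<close> is the logarithmic
  derivative \<open>\<omega>\<close> of \<open>h\<close>, and the Taylor expansion of \<open>h \<circ> f = lam h\<close> determines \<open>P\<close> modulo
  \<open>(lam - 1) ^ 3\<close>. The coefficients of \<open>\<omega>\<close> at \<open>p\<close> and \<open>2 p\<close> are close to \<open>-1\<close> and \<open>1\<close>; modulo
  \<open>(lam - 1)\<^sup>2\<close> the first forces \<open>2 \<beta> = 1 - lam\<close>, and in the sum of both everything cancels
  modulo \<open>(lam - 1) ^ 3\<close> except for \<open>6 \<beta>\<^sup>2\<close>.
\<close>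

lemma no_integral_linearization_small:
  fixes lam b :: "'a::nonarch_field" and h :: "'a fps"
  assumes char: "prime CHAR('a)" "CHAR('a) \<ge> 5"
    and eps: "absval (lam - 1) = \<epsilon>" "0 < \<epsilon>" "\<epsilon> < 1" and b: "absval b \<le> \<epsilon>"
    and h: "geom_bound 1 1 h" "fps_nth h 0 = 0" "fps_nth h 1 = 1"
    and conj: "h oo (fps_const lam * fps_X + fps_const (lam - 1) * fps_X\<^sup>2
      + fps_const b * fps_X ^ CHAR('a)) = fps_const lam * h"
  shows False
proof -
  let ?p = "CHAR('a)"
  define \<eta> where "\<eta> = lam - 1"
  define \<beta> where "\<beta> = b / \<eta>"
  define K where "K = fps_const \<eta>"
  define Bt where "Bt = fps_const \<beta>"
  \<comment> \<open>\<open>S i g\<close> says that \<open>g\<close> vanishes modulo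
    \<open>(lam - 1) ^ i\<close>.\<close>
  define S where "S i g = geom_bound 1 (\<epsilon> ^ i) g" for i :: nat and g :: "'a fps"
  note units = absval_numeral_units[OF char]
  have \<eta>: "absval \<eta> = \<epsilon>" "\<eta> \<noteq> 0" using eps by (auto simp: \<eta>_def)
  have \<beta>: "absval \<beta> \<le> 1" using b \<eta> eps by (simp add: \<beta>_def absval_divide)
  have S_mono: "S i g" if "S j g" "i \<le> j" for i j g
    using that eps unfolding S_def by (elim geom_bound_mono) (auto intro: power_decreasing)
  have S_add: "S i (f + g)" and S_diff: "S i (f - g)" if "S i f" "S i g" for i f g
    using that geom_bound_add geom_bound_diff unfolding S_def by blast+
  have S_mult: "S (i + j) (f * g)" if "S i f" "S j g" for i j f g
    using that geom_bound_mult[of 1 "\<epsilon> ^ i" f "\<epsilon> ^ j" g] unfolding S_def by (simp add: power_add)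
  have S_mult0: "S i (f * g)" "S i (g * f)" if "S i f" "S 0 g" for i f g
    using S_mult[OF that] by (simp_all add: mult.commute)
  have S_K: "S 1 K" and S_Bt: "S 0 Bt" and S_X: "S 0 fps_X" and S_1: "S 0 1"
    using \<eta> \<beta> unfolding S_def K_def Bt_def by (auto intro!: geom_bound_const geom_bound_X)
  have S_pow: "S 0 (f ^ n)" if "S 0 f" for f n
    using geom_bound_power[of 1 1 f n] that by (simp add: S_def)
  have S_num: "S 0 (numeral w)" for w
    unfolding S_def numeral_fps_const
    using absval_of_nat_le[of "numeral w", where 'a = 'a] by (intro geom_bound_const) auto
  have S_deriv: "S i (fps_deriv f)" if "S i f" for i f
    using geom_bound_deriv[of 1 "\<epsilon> ^ i" f] that by (simp add: S_def)
  have S_six: "S i f" if "S i (6 * f)" for i f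
    using that units(3) geom_bound_const_mult_unit[of "6 :: 'a" 1 "\<epsilon> ^ i" f]
    by (simp add: S_def numeral_fps_const)
  have S_nth: "absval (fps_nth f n) \<le> \<epsilon> ^ i" if "S i f" for i f n
    using geom_boundD[of 1 "\<epsilon> ^ i" f n] that by (simp add: S_def)
  have S_cong: "S i g" if "S i f" "f = g" for i f g using that by simp

  define v1 where "v1 = 1 + fps_X + Bt * fps_X ^ (?p - 1)"
  define v where "v = fps_X * v1"
  define k where "k = fps_shift 1 h"
  define \<omega> where "\<omega> = 1 + fps_dlog k"
  define P where "P = v1 * \<omega>"
  define Z where "Z = v * fps_deriv P + P\<^sup>2 - fps_deriv v * P"
  define Z3 where "Z3 = v * fps_deriv Z + Z * P - 2 * fps_deriv v * Z"
  have v: "v = fps_X + fps_X\<^sup>2 + Bt * fps_X ^ ?p"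
    using char(2) by (simp add: v_def v1_def algebra_simps power2_eq_square power_eq_if)
  have v': "fps_deriv v = 1 + 2 * fps_X"
  proof -
    have "(of_nat ?p :: 'a fps) = 0" by (simp flip: fps_of_nat)
    then show ?thesis by (simp add: v Bt_def fps_deriv_power power2_eq_square)
  qed
  have hk: "h = fps_X * k" using h by (simp add: k_def fps_eq_iff)
  have k0: "fps_nth k 0 = 1" using h by (simp add: k_def)
  have S_k: "S 0 k" using h(1) geom_bound_1_X_mult_iff[of 1 k] by (simp add: S_def hk)
  have S_ik: "S 0 (inverse k)"
    using geom_bound_inverse[of 1 k] S_k k0 by (simp add: S_def absval_one)
  have S_\<omega>: "S 0 \<omega>"
    unfolding \<omega>_def fps_dlog_def
    by (intro S_add S_1 S_mult0 S_X S_deriv S_k S_ik)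
  have S_v1: "S 0 v1" unfolding v1_def by (intro S_add S_1 S_mult0 S_X S_Bt S_pow)
  have S_v: "S 0 v" unfolding v_def by (intro S_mult0 S_X S_v1)
  have S_P: "S 0 P" unfolding P_def by (intro S_mult0 S_v1 S_\<omega>)
  have S_Z: "S 0 Z" unfolding Z_def by (intro S_add S_diff S_mult0 S_v S_P S_deriv S_pow)
  have S_Z3: "S 0 Z3" unfolding Z3_def by (intro S_add S_diff S_mult0 S_v S_P S_Z S_deriv S_num)

  have vh: "v * fps_deriv h = P * h"
  proof -
    have "fps_X * fps_deriv h = fps_X * (k + fps_X * fps_deriv k)" by (simp add: hk)
    also have "\<dots> = \<omega> * h"
      using fps_dlog_mult_self[of k] k0 by (simp add: \<omega>_def hk algebra_simps)
    finally show ?thesis by (simp add: v_def P_def mult_ac)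
  qed
  note h23 = second_and_third_derivative[OF vh, folded Z_def, folded Z3_def]

  \<comment> \<open>Third-order Taylor expansion of \<open>h oo f = lam h\<close> around
    \<open>z\<close>, divided by \<open>(lam - 1) h\<close>; the factor 6 clears the denominators
    relating Hasse to iterated derivatives.\<close>
  have basic: "S 3 (6 * P - 6 + 3 * K * Z + K\<^sup>2 * Z3)"
  proof -
    define d where "d = K * v"
    have d: "fps_nth d 0 = 0" "geom_bound 1 (\<epsilon> / 1) d"
      using S_mult[OF S_K S_v] by (auto simp: d_def v_def S_def)
    have f: "fps_const lam * fps_X + fps_const (lam - 1) * fps_X\<^sup>2
      + fps_const b * fps_X ^ ?p = fps_X + d"
    proof -
      have "fps_const lam = 1 + K" "fps_const (lam - 1) = K" "fps_const b = K * Bt"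
        using \<eta> by (simp_all add: K_def Bt_def \<eta>_def \<beta>_def)
      then show ?thesis by (simp add: d_def v algebra_simps)
    qed
    have "geom_bound 1 (1 * \<epsilon> ^ 4) ((h oo (fps_X + d)) - (\<Sum>j<4. d ^ j * (hasse_deriv j h oo fps_X)))"
      using h(1) d eps by (intro geom_bound_taylor geom_bound_X) auto
    moreover have "(\<Sum>j<4. d ^ j * (hasse_deriv j h oo fps_X))
        = h + d * fps_deriv h + d\<^sup>2 * hasse_deriv 2 h + d ^ 3 * hasse_deriv 3 h"
      by (simp add: eval_nat_numeral hasse_deriv_1)
    ultimately have "S 4 (fps_const lam * h
        - (h + d * fps_deriv h + d\<^sup>2 * hasse_deriv 2 h + d ^ 3 * hasse_deriv 3 h))"
      using conj unfolding f by (simp add: S_def)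
    from S_mult0(2)[OF this S_num[of "num.Bit0 (num.Bit1 num.One)"]]
    have "S 4 (6 * (fps_const lam * h
        - (h + d * fps_deriv h + d\<^sup>2 * hasse_deriv 2 h + d ^ 3 * hasse_deriv 3 h)))" .
    moreover have "6 * (fps_const lam * h
        - (h + d * fps_deriv h + d\<^sup>2 * hasse_deriv 2 h + d ^ 3 * hasse_deriv 3 h))
      = K * ((- (6 * P - 6 + 3 * K * Z + K\<^sup>2 * Z3)) * h)"
    proof -
      have "fps_const lam = 1 + K" by (simp add: K_def \<eta>_def)
      then have "6 * (fps_const lam * h
          - (h + d * fps_deriv h + d\<^sup>2 * hasse_deriv 2 h + d ^ 3 * hasse_deriv 3 h))
        = 6 * K * h - 6 * K * (v * fps_deriv h) - 3 * K\<^sup>2 * (v\<^sup>2 * (2 * hasse_deriv 2 h))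
          - K ^ 3 * (v ^ 3 * (6 * hasse_deriv 3 h))"
        by (simp add: d_def algebra_simps power_mult_distrib)
      then show ?thesis
        unfolding hasse_deriv_2 hasse_deriv_3 h23 vh
        by (simp add: algebra_simps power2_eq_square power3_eq_cube)
    qed
    ultimately have "geom_bound 1 (absval \<eta> * \<epsilon> ^ 3) (K * ((- (6 * P - 6 + 3 * K * Z + K\<^sup>2 * Z3)) * h))"
      using \<eta> by (simp add: S_def eval_nat_numeral)
    then have "S 3 (fps_X * ((- (6 * P - 6 + 3 * K * Z + K\<^sup>2 * Z3)) * k))"
      unfolding K_def geom_bound_const_mult_iff[OF \<eta>(2)] by (simp add: S_def hk mult_ac)
    then have "S 3 ((- (6 * P - 6 + 3 * K * Z + K\<^sup>2 * Z3)) * k)"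
      unfolding S_def by (rule geom_bound_1_X_mult_iff)
    from S_mult0(1)[OF this S_ik]
    have "S 3 (- (6 * P - 6 + 3 * K * Z + K\<^sup>2 * Z3))"
      unfolding mult.assoc using k0 by (simp add: inverse_mult_eq_1')
    then show ?thesis unfolding S_def geom_bound_minus .
  qed

  have S_KZ: "S 1 (3 * K * Z)" "S 2 (K\<^sup>2 * Z3)"
    using S_mult0(2)[OF S_mult0(1)[OF S_K S_Z] S_num[of "num.Bit1 num.One"]]
      S_mult0(1)[OF S_mult[OF S_K S_K] S_Z3] by (simp_all add: mult_ac power2_eq_square numeral_2_eq_2)
  \<comment> \<open>Successive approximation in \<open>basic\<close>: \<open>P\<close> modulo a
    power of \<open>\<eta>\<close> determines \<open>Z\<close> and \<open>Z3\<close> to the same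
    order, and these enter with factors \<open>K\<close> and \<open>K\<^sup>2\<close>, which
    improves \<open>P\<close> by one order.\<close>
  have P1: "S 1 (P - 1)"
  proof (rule S_six)
    have "S 1 ((6 * P - 6 + 3 * K * Z + K\<^sup>2 * Z3) - K\<^sup>2 * Z3 - 3 * K * Z)"
      using S_KZ basic by (intro S_diff) (auto elim: S_mono)
    then show "S 1 (6 * (P - 1))" by (simp add: algebra_simps)
  qed
  have Z_eq: "Z + 2 * fps_X = v * fps_deriv (P - 1) + (P - 1) * (P - 2 * fps_X)"
    by (simp add: Z_def v' algebra_simps power2_eq_square)
  have S_P2X: "S 0 (P - 2 * fps_X)" by (intro S_diff S_P S_mult0(1)[OF S_num S_X])
  have Z1: "S 1 (Z + 2 * fps_X)"
    unfolding Z_eq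
    by (intro S_add S_mult0(2)[OF S_deriv[OF P1] S_v] S_mult0(1)[OF P1 S_P2X])
  have P2: "S 2 (P - 1 - K * fps_X)"
  proof (rule S_six)
    have "S 2 (3 * (K * (Z + 2 * fps_X)))"
      using S_mult0(2)[OF S_mult[OF S_K Z1] S_num[of "num.Bit1 num.One"]] by (simp add: numeral_2_eq_2)
    then have "S 2 ((6 * P - 6 + 3 * K * Z + K\<^sup>2 * Z3) - K\<^sup>2 * Z3 - 3 * (K * (Z + 2 * fps_X)))"
      using S_KZ basic by (intro S_diff) (auto elim: S_mono)
    then show "S 2 (6 * (P - 1 - K * fps_X))" by (simp add: algebra_simps)
  qed

  define e where "e = inverse v1"
  have v1_0: "fps_nth v1 0 = 1" using char by (simp add: v1_def Bt_def)
  have S_e: "S 0 e" using geom_bound_inverse[of 1 v1] S_v1 v1_0 by (simp add: S_def e_def absval_one)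
  have \<omega>_eq: "\<omega> = P * e"
    using v1_0 by (simp add: P_def e_def mult_ac inverse_mult_eq_1')
  define N where "N = ?p - 1"
  have N: "even N" "N \<ge> 3" "of_nat N = (-1 :: 'a)" and pN: "?p = N + 1" "2 * ?p = 2 * N + 2"
  proof -
    have "odd ?p" using char prime_odd_nat by auto
    then show "even N" "N \<ge> 3" and pN: "?p = N + 1" and "2 * ?p = 2 * N + 2"
      using char(2) by (auto simp: N_def)
    have "of_nat (N + 1) = (0 :: 'a)" unfolding pN[symmetric] by (rule of_nat_CHAR)
    then show "of_nat N = (-1 :: 'a)" by (simp add: eq_neg_iff_add_eq_0 add.commute)
  qed
  have e_rec: "fps_nth e n + (if n = 0 then 0 else fps_nth e (n - 1))
      + \<beta> * (if n < N then 0 else fps_nth e (n - N)) = (if n = 0 then 1 else 0)" for n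
  proof -
    have "e * v1 = e + e * fps_X + Bt * (e * fps_X ^ N)"
      by (simp add: v1_def N_def algebra_simps)
    moreover have "e * v1 = 1" using v1_0 by (simp add: e_def inverse_mult_eq_1)
    ultimately have "fps_nth (e + e * fps_X + Bt * (e * fps_X ^ N)) n = (if n = 0 then 1 else 0)"
      by simp
    then show ?thesis by (simp add: Bt_def fps_X_power_mult_right_nth)
  qed
  have e0: "fps_nth e 0 = 1" using e_rec[of 0] N by simp
  have "fps_nth e n = - fps_nth e (n - 1)" if "0 < n" "n < N" for n
    using e_rec[of n] that by (simp add: eq_neg_iff_add_eq_0)
  moreover have "fps_nth e n = - fps_nth e (n - 1) - \<beta> * fps_nth e (n - N)" if "n \<ge> N" for n
  proof -
    have "fps_nth e n + fps_nth e (n - 1) + \<beta> * fps_nth e (n - N) = 0"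
      using e_rec[of n] that N(2) by simp
    then have "fps_nth e n = - (fps_nth e (n - 1) + \<beta> * fps_nth e (n - N))"
      by (simp only: add.assoc eq_neg_iff_add_eq_0)
    then show ?thesis by simp
  qed
  ultimately have E: "fps_nth e 1 = -1" "fps_nth e 2 = 1" "fps_nth e (N - 1) = -1"
    "fps_nth e N = 1 - \<beta>" "fps_nth e (N + 1) = -1 + 2 * \<beta>" "fps_nth e (2 * N) = 1 + \<beta>\<^sup>2"
    "fps_nth e (2 * N + 1) = -1 + \<beta> - 3 * \<beta>\<^sup>2" "fps_nth e (2 * N + 2) = 1 - 2 * \<beta> + 6 * \<beta>\<^sup>2"
    using trinomial_inverse_coeffs[of N "fps_nth e" \<beta>] N e0 by blast+

  have \<omega>_frob: "fps_nth \<omega> (?p * n) = fps_nth \<omega> n ^ ?p" if "n > 0" for n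
    using frobenius_fixed_dlog[OF char(1) k0] that char(2) by (simp add: \<omega>_def frobenius_fixed_def)
  have \<omega>1: "S 1 (\<omega> - e)"
    using S_mult0(1)[OF P1 S_e] by (simp add: \<omega>_eq algebra_simps)
  have eps_p: "\<epsilon> ^ ?p \<le> \<epsilon> ^ 3" using char eps by (intro power_decreasing) auto
  \<comment> \<open>The coefficient at 1 is \<open>-1\<close> modulo \<open>\<eta>\<close>; taking
    \<open>p\<close>-th powers raises this precision to \<open>\<eta> ^ p\<close>, beyond the third
    order needed. The same happens from 2 to \<open>2 * p\<close>.\<close>
  have \<omega>_p: "absval (fps_nth \<omega> ?p + 1) \<le> \<epsilon> ^ 3"
  proof -
    have "absval (fps_nth \<omega> 1 - (-1)) \<le> \<epsilon>" using S_nth[OF \<omega>1, of 1] E(1) by simp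
    then have "absval ((fps_nth \<omega> 1 + 1) ^ ?p) \<le> \<epsilon> ^ ?p"
      unfolding absval_power by (intro power_mono) auto
    then show ?thesis
      using \<omega>_frob[of 1] eps_p by (simp add: freshmans_dream[OF char(1)])
  qed
  have \<omega>_2p: "absval (fps_nth \<omega> (2 * ?p) - 1) \<le> \<epsilon> ^ 3"
  proof -
    have "absval (fps_nth \<omega> 2 - 1) \<le> \<epsilon>" using S_nth[OF \<omega>1, of 2] E(2) by simp
    then have "absval ((fps_nth \<omega> 2 - 1) ^ ?p) \<le> \<epsilon> ^ ?p"
      unfolding absval_power by (intro power_mono) auto
    then show ?thesis
      using \<omega>_frob[of 2] eps_p diff_power_char[OF char(1), of ?p 1 "fps_nth \<omega> 2" 1]
      by (simp add: mult.commute)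
  qed
  have eps3: "\<epsilon> ^ 3 \<le> \<epsilon>" "\<epsilon> ^ 3 \<le> \<epsilon>\<^sup>2" "\<epsilon>\<^sup>2 < \<epsilon>" "\<epsilon> ^ 3 < \<epsilon>\<^sup>2"
    using eps power_decreasing[of 1 3 \<epsilon>] power_decreasing[of 2 3 \<epsilon>]
      power_strict_decreasing[of 1 2 \<epsilon>] power_strict_decreasing[of 2 3 \<epsilon>] by auto

  have "absval \<beta> \<le> \<epsilon>"
  proof -
    have "absval ((fps_nth \<omega> ?p + 1) - fps_nth (\<omega> - e) ?p) \<le> \<epsilon>"
      using \<omega>_p S_nth[OF \<omega>1, of ?p] eps3(1) by (intro absval_diff_bound) auto
    then have "absval (2 * \<beta>) \<le> \<epsilon>" using E(5) by (simp add: pN(1))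
    then show ?thesis using units by (simp add: absval_mult)
  qed
  then have S_Bt1: "S 1 Bt" unfolding S_def Bt_def by (intro geom_bound_const) auto

  have \<omega>2: "S 2 (\<omega> - (1 + K * fps_X) * e)"
    using S_mult0(1)[OF P2 S_e] by (simp add: \<omega>_eq algebra_simps)
  have \<beta>\<eta>: "absval (\<eta> * \<beta>) \<le> \<epsilon>\<^sup>2"
    unfolding absval_mult power2_eq_square using \<open>absval \<beta> \<le> \<epsilon>\<close> \<eta> eps by (intro mult_mono) auto
  have "absval (2 * \<beta> + \<eta>) \<le> \<epsilon>\<^sup>2"
  proof -
    have "fps_nth ((1 + K * fps_X) * e) ?p = - 1 + 2 * \<beta> + \<eta> * (1 - \<beta>)"
      using E(4,5) by (simp add: pN(1) K_def distrib_right mult.assoc)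
    then have "2 * \<beta> + \<eta> = (fps_nth \<omega> ?p + 1) - fps_nth (\<omega> - (1 + K * fps_X) * e) ?p + \<eta> * \<beta>"
      by (simp add: algebra_simps)
    moreover have "absval \<dots> \<le> \<epsilon>\<^sup>2"
      by (rule absval_add_bound[OF absval_diff_bound[OF
            order_trans[OF \<omega>_p eps3(2)] S_nth[OF \<omega>2]] \<beta>\<eta>])
    ultimately show ?thesis by simp
  qed
  then have "absval (\<eta> - (- (2 * \<beta>))) < absval \<eta>" using eps3 \<eta> by (simp add: add.commute)
  then have "absval (- (2 * \<beta>)) = absval \<eta>" by (rule absval_eqI_near)
  then have abs_\<beta>: "absval \<beta> = \<epsilon>" using units \<eta> by (simp add: absval_mult)

  have Z2: "S 2 (Z - (- 2 * fps_X + 2 * K * fps_X - K * fps_X\<^sup>2))"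
  proof -
    have "S 2 (v * fps_deriv (P - 1 - K * fps_X))" by (rule S_mult0(2)[OF S_deriv[OF P2] S_v])
    moreover have "S 2 ((P - 1 - K * fps_X) * (P - 2 * fps_X))"
      by (rule S_mult0(1)[OF P2 S_P2X])
    moreover have "S 2 (K * fps_X * (P - 1))"
      using S_mult[OF S_mult0(1)[OF S_K S_X] P1] by (simp add: numeral_2_eq_2)
    moreover have "S 2 (K * Bt * fps_X ^ ?p)"
      using S_mult0(1)[OF S_mult[OF S_K S_Bt1] S_pow[OF S_X]] by (simp add: numeral_2_eq_2)
    ultimately have "S 2 (v * fps_deriv (P - 1 - K * fps_X) + (P - 1 - K * fps_X) * (P - 2 * fps_X)
        + K * fps_X * (P - 1) + K * Bt * fps_X ^ ?p)" by (intro S_add)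
    moreover have "Z = v * fps_deriv (P - 1) + (P - 1) * (P - 2 * fps_X) - 2 * fps_X"
      using Z_eq by (simp add: algebra_simps)
    moreover have "fps_deriv (K * fps_X) = K" by (simp add: K_def)
    ultimately show ?thesis
      by (elim S_cong) (simp add: v algebra_simps power2_eq_square)
  qed
  have Z3_1: "S 1 (Z3 - 6 * fps_X\<^sup>2)"
  proof -
    have "S 1 (v * fps_deriv (Z + 2 * fps_X) + (Z + 2 * fps_X) * P - 2 * fps_deriv v * (Z + 2 * fps_X)
        - 2 * fps_X * (P - 1) - 2 * Bt * fps_X ^ ?p)"
      by (intro S_add S_diff S_mult0(2)[OF S_deriv[OF Z1] S_v] S_mult0(1)[OF Z1 S_P]
          S_mult0(2)[OF Z1 S_mult0(1)[OF S_num S_deriv[OF S_v]]]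
          S_mult0(2)[OF P1 S_mult0(1)[OF S_num S_X]]
          S_mult0(1)[OF S_mult0(2)[OF S_Bt1 S_num] S_pow[OF S_X]])
    moreover have "Z3 = v * fps_deriv Z + Z * P - 2 * (1 + 2 * fps_X) * Z" by (simp add: Z3_def v')
    ultimately show ?thesis
      by (elim S_cong, unfold v') (simp add: v algebra_simps power2_eq_square)
  qed
  \<comment> \<open>The value of \<open>6 * P\<close> modulo \<open>\<eta> ^ 3\<close>, obtained by
    inserting \<open>Z2\<close> and \<open>Z3_1\<close> into \<open>basic\<close>.\<close>
  define G where "G = 6 + 6 * K * fps_X - 6 * K\<^sup>2 * fps_X - 3 * K\<^sup>2 * fps_X\<^sup>2"
  have P3: "S 3 (6 * P - G)"
  proof -
    have "S 3 (3 * (K * (Z - (- 2 * fps_X + 2 * K * fps_X - K * fps_X\<^sup>2))))"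
      using S_mult0(2)[OF S_mult[OF S_K Z2] S_num] by (simp add: eval_nat_numeral)
    moreover have "S 3 (K\<^sup>2 * (Z3 - 6 * fps_X\<^sup>2))"
      using S_mult[OF S_mult[OF S_K S_K] Z3_1] by (simp add: eval_nat_numeral)
    ultimately have "S 3 ((6 * P - 6 + 3 * K * Z + K\<^sup>2 * Z3)
        - 3 * (K * (Z - (- 2 * fps_X + 2 * K * fps_X - K * fps_X\<^sup>2))) - K\<^sup>2 * (Z3 - 6 * fps_X\<^sup>2))"
      using basic by (intro S_diff)
    then show ?thesis by (elim S_cong) (simp add: G_def algebra_simps power2_eq_square)
  qed
  have \<omega>3: "S 3 (6 * \<omega> - G * e)"
    using S_mult0(1)[OF P3 S_e] by (simp add: \<omega>_eq algebra_simps)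

  have Ge: "fps_nth (G * e) (n + 2) = 6 * fps_nth e (n + 2) + (6 * \<eta> - 6 * \<eta>\<^sup>2) * fps_nth e (n + 1)
      - 3 * \<eta>\<^sup>2 * fps_nth e n" for n
  proof -
    have "G * e = fps_const 6 * e + fps_const (6 * \<eta> - 6 * \<eta>\<^sup>2) * (fps_X * e)
        - fps_const (3 * \<eta>\<^sup>2) * (fps_X ^ 2 * e)"
      by (simp add: G_def K_def numeral_fps_const algebra_simps flip: fps_const_mult fps_const_sub fps_const_power)
    then show ?thesis by (simp add: fps_X_power_mult_nth)
  qed
  have "fps_nth (G * e) ?p + fps_nth (G * e) (2 * ?p)
      = 36 * \<beta>\<^sup>2 - (6 * \<eta> - 6 * \<eta>\<^sup>2) * (3 * \<beta>\<^sup>2) - 3 * \<eta>\<^sup>2 * \<beta>\<^sup>2"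
  proof -
    have "?p = (N - 1) + 2" "N - 1 + 1 = N" "N - 1 + 2 = N + 1" using N pN by auto
    then have g1: "fps_nth (G * e) ?p = 6 * (-1 + 2 * \<beta>) + (6 * \<eta> - 6 * \<eta>\<^sup>2) * (1 - \<beta>) + 3 * \<eta>\<^sup>2"
      using Ge[of "N - 1"] E by simp
    have g2: "fps_nth (G * e) (2 * ?p) = 6 * (1 - 2 * \<beta> + 6 * \<beta>\<^sup>2)
        + (6 * \<eta> - 6 * \<eta>\<^sup>2) * (-1 + \<beta> - 3 * \<beta>\<^sup>2) - 3 * \<eta>\<^sup>2 * (1 + \<beta>\<^sup>2)"
      using Ge[of "2 * N"] E unfolding pN by simp
    show ?thesis unfolding g1 g2 by (simp add: algebra_simps)
  qed
  then have "36 * \<beta>\<^sup>2 = 6 * ((fps_nth \<omega> ?p + 1) + (fps_nth \<omega> (2 * ?p) - 1))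
      - fps_nth (6 * \<omega> - G * e) ?p - fps_nth (6 * \<omega> - G * e) (2 * ?p)
      + (\<eta> * (\<beta> * \<beta>)) * (18 - 18 * \<eta> + 3 * \<eta>)"
    by (simp add: numeral_fps_const algebra_simps power2_eq_square)
  also have "absval \<dots> \<le> \<epsilon> ^ 3"
  proof (intro absval_add_bound absval_diff_bound S_nth[OF \<omega>3])
    show "absval (6 * ((fps_nth \<omega> ?p + 1) + (fps_nth \<omega> (2 * ?p) - 1))) \<le> \<epsilon> ^ 3"
      unfolding absval_mult units mult_1 by (rule absval_add_bound[OF \<omega>_p \<omega>_2p])
    have "absval (18 :: 'a) \<le> 1" "absval (3 :: 'a) \<le> 1"
      using absval_of_nat_le[of 18, where 'a = 'a] units by auto
    then have "absval (18 - 18 * \<eta> + 3 * \<eta>) \<le> 1"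
      using \<eta> eps by (intro absval_add_bound absval_diff_bound) (auto simp: absval_mult intro: mult_le_one)
    then have "absval (\<eta> * (\<beta> * \<beta>)) * absval (18 - 18 * \<eta> + 3 * \<eta>) \<le> \<epsilon> ^ 3 * 1"
      using \<eta> abs_\<beta> eps by (intro mult_mono) (auto simp: absval_mult power3_eq_cube)
    then show "absval (\<eta> * (\<beta> * \<beta>) * (18 - 18 * \<eta> + 3 * \<eta>)) \<le> \<epsilon> ^ 3"
      by (simp add: absval_mult)
  qed
  finally have "absval (6 * 6 * \<beta>\<^sup>2) \<le> \<epsilon> ^ 3" by simp
  then have "\<epsilon>\<^sup>2 \<le> \<epsilon> ^ 3" unfolding absval_mult units absval_power abs_\<beta> by simp
  then show False using eps3 by simp
qed


section \<open>Linearization of the additive part\<close>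

lemma geom_bound_imp_locally_analytic:
  fixes f :: "'a::complete_nonarch_field fps"
  assumes "geom_bound c B f" "c > 0"
  shows "locally_analytic f"
proof -
  let ?z = "1 / (2 * c)"
  have "summable (\<lambda>n. absval (fps_nth f n) * ?z ^ n)"
  proof (rule summable_comparison_test)
    show "summable (\<lambda>n. B * (1 / 2) ^ n)" by (intro summable_mult summable_geometric) simp
    have "norm (absval (fps_nth f n) * ?z ^ n) \<le> B * (1 / 2) ^ n" for n
    proof -
      have "absval (fps_nth f n) * ?z ^ n \<le> (B * c ^ n) * ?z ^ n"
        using assms by (intro mult_right_mono geom_boundD) auto
      also have "\<dots> = B * (1 / 2) ^ n"
        using assms(2) by (simp add: mult.assoc flip: power_mult_distrib)
      finally show ?thesis using assms(2) by simp
    qed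
    then show "\<exists>N. \<forall>n\<ge>N. norm (absval (fps_nth f n) * ?z ^ n) \<le> B * (1 / 2) ^ n" by blast
  qed
  then have "conv_radius (\<lambda>n. absval (fps_nth f n)) \<ge> norm ?z" by (rule conv_radius_geI)
  moreover have "ereal (norm ?z) > 0" using assms(2) by simp
  ultimately show ?thesis
    unfolding locally_analytic_def nonarch_conv_radius_def by (rule less_le_trans[rotated])
qed

lemma locally_analytic_imp_geom_bound:
  fixes f :: "'a::complete_nonarch_field fps"
  assumes "locally_analytic f" "fps_nth f 0 = 0" "fps_nth f 1 = 1"
  obtains R where "R \<ge> 1" "geom_bound R (1 / R) f"
proof -
  from assms(1) have "conv_radius (\<lambda>n. absval (fps_nth f n)) > 0"
    by (simp add: locally_analytic_def nonarch_conv_radius_def)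
  then obtain r where r: "0 < r" "ereal r < conv_radius (\<lambda>n. absval (fps_nth f n))"
    using ereal_dense2[of 0] by (metis ereal_less(2))
  then have "summable (\<lambda>n. absval (fps_nth f n) * r ^ n)"
    by (intro summable_in_conv_radius) auto
  then have "Bseq (\<lambda>n. absval (fps_nth f n) * r ^ n)"
    by (intro convergent_imp_Bseq) (use summable_LIMSEQ_zero convergentI in blast)
  then obtain B where B: "B > 0" "\<And>n. norm (absval (fps_nth f n) * r ^ n) \<le> B"
    unfolding Bseq_def by blast
  define u where "u = max 1 (B / r)"
  define t where "t = max 1 (1 / r)"
  have ut: "u \<ge> 1" "t \<ge> 1" by (auto simp: u_def t_def)
  have bd: "absval (fps_nth f (Suc n)) \<le> (u * t) ^ n" for n
  proof (cases "n = 0")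
    case False
    have "absval (fps_nth f (Suc n)) \<le> B / r ^ Suc n"
      using B(2)[of "Suc n"] r by (simp add: field_simps)
    also have "\<dots> = (B / r) * (1 / r) ^ n" using r by (simp add: power_divide)
    also have "\<dots> \<le> u * t ^ n"
      using B r by (intro mult_mono power_mono) (auto simp: u_def t_def)
    also have "\<dots> \<le> u ^ n * t ^ n"
      using ut False power_increasing[of 1 n u] by (intro mult_right_mono) auto
    finally show ?thesis by (simp add: power_mult_distrib)
  qed (use assms(3) in \<open>simp add: absval_one\<close>)
  show ?thesis
  proof (rule that[of "u * t"])
    show "1 \<le> u * t" using ut mult_mono[of 1 u 1 t] by simp
    show "geom_bound (u * t) (1 / (u * t)) f"
    proof (rule geom_boundI)
      fix n
      show "absval (fps_nth f n) \<le> 1 / (u * t) * (u * t) ^ n"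
        using bd[of "n - 1"] ut assms(2) by (cases n) auto
    qed
  qed
qed

lemma geom_bound_comp_inverse:
  fixes e h :: "'a::nonarch_field fps"
  assumes e: "geom_bound c (1 / c) e" "fps_nth e 0 = 0" "absval (fps_nth e 1) = 1"
    and h: "h oo e = fps_X" and c: "c > 0"
  shows "geom_bound c (1 / c) h"
proof -
  have "absval (fps_nth h k) \<le> 1 / c * c ^ k" for k
  proof (induction k rule: less_induct)
    case (less k)
    define h' where "h' = Abs_fps (\<lambda>n. if n < k then fps_nth h n else 0)"
    have h': "geom_bound c (1 / c) h'"
      using less c by (auto simp: geom_bound_def h'_def)
    have "fps_nth (h oo e) k = fps_nth (h' oo e) k + fps_nth h k * fps_nth e 1 ^ k"
      unfolding fps_compose_nth atLeast0AtMost lessThan_Suc_atMost[symmetric]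
      by (simp add: h'_def startsby_zero_power_nth_same[OF e(2)])
    then have "fps_nth h k * fps_nth e 1 ^ k = fps_nth (fps_X - (h' oo e)) k" using h by simp
    also have "absval \<dots> \<le> 1 / c * c ^ k"
      using geom_bound_compose[OF h' e(1) c] c
      by (intro geom_boundD geom_bound_diff geom_bound_X) auto
    finally show ?case using e(3) by (simp add: absval_mult absval_power)
  qed
  then show ?thesis by (intro geom_boundI)
qed

section \<open>Small divisors and sums of two powers of \<open>p\<close>\<close>

lemma absval_power_minus_self:
  fixes x :: "'a::nonarch_field"
  assumes "prime CHAR('a)" "absval (x - 1) < 1" "\<not> CHAR('a) dvd m"
  shows "absval (x ^ Suc (CHAR('a) ^ v * m) - x) = absval (x - 1) ^ (CHAR('a) ^ v)"
proof -
  let ?q = "CHAR('a) ^ v"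
  have q: "?q > 0" using assms(1) prime_gt_0_nat by simp
  have 1: "absval (x ^ ?q - 1) = absval (x - 1) ^ ?q"
    by (rule absval_power_char_minus_one[OF assms(1) refl])
  moreover have "absval (x - 1) ^ ?q < 1" using assms(2) q by (simp add: power_less_one_iff)
  ultimately have "absval ((x ^ ?q) ^ m - 1) = absval (x - 1) ^ ?q"
    using absval_power_minus_one_eq[OF assms(1,3), of "x ^ ?q"] by simp
  moreover have "x ^ Suc (?q * m) - x = x * ((x ^ ?q) ^ m - 1)"
    by (simp only: power_Suc power_mult right_diff_distrib mult_1_right)
  moreover have "absval x = 1"
    using absval_eqI_near[of 1 x] assms(2) by (simp add: absval_one absval_minus_commute)
  ultimately show ?thesis by (simp add: absval_mult)
qed

lemma absval_power_minus_self_ge: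
  fixes x :: "'a::nonarch_field"
  assumes "prime CHAR('a)" "absval (x - 1) < 1" "\<not> CHAR('a) ^ Suc s dvd j"
  shows "absval (x - 1) ^ (CHAR('a) ^ s) \<le> absval (x ^ Suc j - x)"
proof -
  have "j \<noteq> 0" using assms(3) by (metis dvd_0_right)
  moreover have "\<not> is_unit CHAR('a)" using prime_gt_1_nat[OF assms(1)] by simp
  ultimately obtain m where "j = CHAR('a) ^ multiplicity CHAR('a) j * m" "\<not> CHAR('a) dvd m"
    using multiplicity_decompose'[of j "CHAR('a)"] by auto
  then obtain v where vm: "j = CHAR('a) ^ v * m" "\<not> CHAR('a) dvd m" by auto
  have "v \<le> s"
  proof (rule ccontr)
    assume "\<not> v \<le> s"
    then have "CHAR('a) ^ Suc s dvd CHAR('a) ^ v" by (intro le_imp_power_dvd) simp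
    then have "CHAR('a) ^ Suc s dvd j" unfolding vm(1) by (rule dvd_mult2)
    then show False using assms(3) by contradiction
  qed
  then have "CHAR('a) ^ v \<le> CHAR('a) ^ s"
    using prime_gt_0_nat[OF assms(1)] by (intro power_increasing) auto
  then show ?thesis
    using absval_power_minus_self[OF assms(1,2) vm(2), of v] assms(2)
    unfolding vm(1) by (auto intro: power_decreasing)
qed

text \<open>The cofactor \<open>1 + p ^ (y - x)\<close> is prime to \<open>p\<close>; for
  \<open>x = y\<close> it equals 2, whence \<open>p > 2\<close>.\<close>

lemma prime_power_add_dvd:
  fixes p :: nat
  assumes "prime p" "p > 2" "p ^ s dvd p ^ x + p ^ y"
  shows "p ^ s dvd p ^ x"
proof -
  have *: "p ^ s dvd p ^ x \<and> p ^ s dvd p ^ y" if "x \<le> y" "p ^ s dvd p ^ x + p ^ y" for x y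
  proof -
    have "\<not> p dvd 1 + p ^ (y - x)"
    proof (cases "x = y")
      case True
      then show ?thesis using assms(2) by (auto dest: dvd_imp_le)
    next
      case False
      then have "p dvd p ^ (y - x)" using that by (intro dvd_power) auto
      then have "p dvd 1 + p ^ (y - x) \<longleftrightarrow> p dvd 1" by (rule dvd_add_left_iff)
      then show ?thesis using assms(2) by simp
    qed
    then have "coprime (p ^ s) (1 + p ^ (y - x))"
      using prime_imp_coprime[OF assms(1)] by simp
    moreover have "p ^ x + p ^ y = p ^ x * (1 + p ^ (y - x))"
      using that by (simp add: distrib_left flip: power_add)
    ultimately have "p ^ s dvd p ^ x"
      using that(2) coprime_dvd_mult_left_iff by metis
    moreover have "p ^ x dvd p ^ y" using that(1) by (rule le_imp_power_dvd)
    ultimately show ?thesis by (blast intro: dvd_trans)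
  qed
  show ?thesis
    using *[of x y] *[of y x] assms(3) by (cases "x \<le> y") (auto simp: add.commute)
qed

text \<open>
  The unique series tangent to the identity that conjugates \<open>lam z + b z\<^sup>p\<close> to \<open>lam z\<close> is
  additive, and its coefficients are explicit.
\<close>

locale additive_part =
  fixes lam b :: "'a::nonarch_field" and \<epsilon> c :: real
  assumes char: "prime CHAR('a)"
    and eps: "absval (lam - 1) = \<epsilon>" "0 < \<epsilon>" "\<epsilon> < 1"
    and c: "c > 0" and b: "absval b \<le> \<epsilon> * c ^ (CHAR('a) - 1)"
begin

fun d :: "nat \<Rightarrow> 'a" where
  "d 0 = 1"
| "d (Suc i) = b * d i ^ CHAR('a) / (lam ^ (CHAR('a) ^ Suc i) - lam)"

text \<open>The sum of \<open>d i * z ^ (p ^ i)\<close>. The multiplicity serves as the logarithm to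
  base \<open>p\<close>; at \<open>k = 0\<close> it is 0 by convention, and
  \<open>0 \<noteq> p ^ 0\<close> gives the coefficient 0.\<close>

definition "e = Abs_fps (\<lambda>k. if k = CHAR('a) ^ multiplicity CHAR('a) k then d (multiplicity CHAR('a) k) else 0)"

lemma p_gt_1: "CHAR('a) > 1" using char by (rule prime_gt_1_nat)

declare d.simps(2) [simp del]

lemma e_power: "fps_nth e (CHAR('a) ^ i) = d i"
  using p_gt_1 by (simp add: e_def multiplicity_same_power)

lemma e_nonzeroE:
  assumes "fps_nth e k \<noteq> 0" obtains i where "k = CHAR('a) ^ i"
  using assms that[of "multiplicity CHAR('a) k"] by (auto simp: e_def split: if_splits)

lemma e_0: "fps_nth e 0 = 0" using p_gt_1 e_nonzeroE[of 0] by fastforce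

lemma e_1: "fps_nth e 1 = 1" using e_power[of 0] by simp

text \<open>\<open>p ^ Suc i - 1\<close> is prime to \<open>p\<close>, so the divisors of the
  additive part do not decay. This is what makes it linearizable.\<close>

lemma absval_lam_power: "absval (lam ^ (CHAR('a) ^ Suc i) - lam) = \<epsilon>"
proof -
  have "CHAR('a) ^ Suc i > 0" using p_gt_1 by simp
  then obtain m where m: "CHAR('a) ^ Suc i = Suc m" by (metis gr0_implies_Suc)
  have "\<not> CHAR('a) dvd m"
  proof
    assume "CHAR('a) dvd m"
    moreover have "CHAR('a) dvd Suc m" unfolding m[symmetric] by simp
    ultimately have "CHAR('a) dvd 1" by (metis Suc_eq_plus1 dvd_add_right_iff)
    then show False using p_gt_1 by simp
  qed
  then show ?thesis
    using absval_power_minus_self[OF char, of lam m 0] eps m by simp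
qed

lemma d_bound: "absval (d i) \<le> c ^ (CHAR('a) ^ i - 1)"
proof (induction i)
  case 0
  show ?case by (simp add: absval_one)
next
  case (Suc i)
  have "absval (d (Suc i)) = absval b * absval (d i) ^ CHAR('a) / \<epsilon>"
    using absval_lam_power[of i] by (simp add: d.simps(2) absval_divide absval_mult absval_power)
  also have "\<dots> \<le> (\<epsilon> * c ^ (CHAR('a) - 1)) * (c ^ (CHAR('a) ^ i - 1)) ^ CHAR('a) / \<epsilon>"
    using b Suc eps c by (intro divide_right_mono mult_mono power_mono) auto
  also have "\<dots> = c ^ (CHAR('a) - 1 + (CHAR('a) ^ i - 1) * CHAR('a))"
    using eps by (simp add: power_add power_mult)
  also have "CHAR('a) - 1 + (CHAR('a) ^ i - 1) * CHAR('a) = CHAR('a) ^ Suc i - 1"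
    using p_gt_1 by (cases "CHAR('a) ^ i") (auto simp: mult.commute)
  finally show ?case .
qed

text \<open>For critical \<open>b\<close> the bound is attained at every index; this supplies the
  main terms of both obstructions to linearization below.\<close>

lemma d_eq:
  assumes "absval b = \<epsilon> * c ^ (CHAR('a) - 1)"
  shows "absval (d i) = c ^ (CHAR('a) ^ i - 1)"
proof (induction i)
  case 0
  show ?case by (simp add: absval_one)
next
  case (Suc i)
  have "absval (d (Suc i)) = absval b * absval (d i) ^ CHAR('a) / \<epsilon>"
    using absval_lam_power[of i] by (simp add: d.simps(2) absval_divide absval_mult absval_power)
  also have "\<dots> = c ^ (CHAR('a) - 1 + (CHAR('a) ^ i - 1) * CHAR('a))"
    using eps by (simp add: assms Suc power_add power_mult)
  also have "CHAR('a) - 1 + (CHAR('a) ^ i - 1) * CHAR('a) = CHAR('a) ^ Suc i - 1"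
    using p_gt_1 by (cases "CHAR('a) ^ i") (auto simp: mult.commute)
  finally show ?case .
qed

lemma e_bound: "geom_bound c (1 / c) e"
proof (rule geom_boundI)
  fix k
  show "absval (fps_nth e k) \<le> 1 / c * c ^ k"
  proof (cases "fps_nth e k = 0")
    case False
    then obtain i where i: "k = CHAR('a) ^ i" by (rule e_nonzeroE)
    then have "k > 0" using p_gt_1 by simp
    then have "c ^ (k - 1) = 1 / c * c ^ k" using c by (cases k) auto
    then show ?thesis using d_bound[of i] e_power[of i] i by simp
  qed (use c in simp)
qed

lemma e_deriv: "fps_deriv e = 1"
proof (rule fps_ext)
  fix n
  show "fps_nth (fps_deriv e) n = fps_nth 1 n"
  proof (cases "n = 0")
    case False
    have "of_nat (Suc n) * fps_nth e (Suc n) = 0"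
    proof (cases "fps_nth e (Suc n) = 0")
      case nz: False
      then obtain i where i: "Suc n = CHAR('a) ^ i" by (rule e_nonzeroE)
      then have "i > 0" using False by (cases i) auto
      then have "CHAR('a) dvd Suc n" unfolding i by (intro dvd_power) auto
      then have "of_nat (Suc n) = (0 :: 'a)" by (simp only: of_nat_eq_0_iff_char_dvd)
      then show ?thesis by (simp only: mult_zero_left)
    qed simp
    then show ?thesis using False by (simp del: of_nat_Suc)
  qed (use e_1 in simp)
qed

lemma e_conj: "fps_const lam * e + fps_const b * e ^ CHAR('a) = e oo (fps_const lam * fps_X)"
proof (rule fps_ext)
  fix k
  have "e ^ CHAR('a) = frobenius_map CHAR('a) e oo fps_X ^ CHAR('a)" by (rule fps_power_char[OF char, of _ 1]) simp
  then have ep: "fps_nth (e ^ CHAR('a)) k = (if CHAR('a) dvd k then fps_nth e (k div CHAR('a)) ^ CHAR('a) else 0)"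
    using p_gt_1 by (simp add: fps_compose_X_power_nth)
  have "lam * fps_nth e k + b * fps_nth (e ^ CHAR('a)) k = lam ^ k * fps_nth e k"
  proof (cases "CHAR('a) dvd k")
    case False
    have "fps_nth e k = 0 \<or> k = 1"
    proof (rule disjCI)
      assume "k \<noteq> 1"
      show "fps_nth e k = 0"
      proof (rule ccontr)
        assume "fps_nth e k \<noteq> 0"
        then obtain i where i: "k = CHAR('a) ^ i" by (rule e_nonzeroE)
        with \<open>k \<noteq> 1\<close> have "i > 0" by (cases i) auto
        then show False using False i by (simp add: dvd_power)
      qed
    qed
    then show ?thesis using False ep by auto
  next
    case True
    then obtain j where j: "k = CHAR('a) * j" ..
    then have ep: "fps_nth (e ^ CHAR('a)) k = fps_nth e j ^ CHAR('a)" using ep p_gt_1 by simp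
    show ?thesis
    proof (cases "fps_nth e j = 0")
      case True
      have "fps_nth e k = 0"
      proof (rule ccontr)
        assume "fps_nth e k \<noteq> 0"
        then obtain i where i: "k = CHAR('a) ^ i" by (rule e_nonzeroE)
        obtain i' where "i = Suc i'" using i j p_gt_1 by (cases i) auto
        then have "j = CHAR('a) ^ i'" using i j p_gt_1 by simp
        then have "d i' = 0" using True e_power by simp
        then have "d i = 0" using \<open>i = Suc i'\<close> p_gt_1 by (simp add: d.simps(2))
        then show False using \<open>fps_nth e k \<noteq> 0\<close> i e_power by simp
      qed
      then show ?thesis using True ep p_gt_1 by (simp add: power_0_left)
    next
      case False
      then obtain i where i: "j = CHAR('a) ^ i" by (rule e_nonzeroE)
      then have k: "k = CHAR('a) ^ Suc i" using j by simp
      have ne: "lam ^ (CHAR('a) ^ Suc i) - lam \<noteq> 0" using absval_lam_power[of i] eps by auto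
      have "(lam ^ (CHAR('a) ^ Suc i) - lam) * d (Suc i) = b * d i ^ CHAR('a)"
        using ne by (simp add: d.simps(2) del: power_Suc)
      then show ?thesis
        unfolding ep unfolding k i e_power by (simp add: algebra_simps del: power_Suc d.simps)
    qed
  qed
  then show "fps_nth (fps_const lam * e + fps_const b * e ^ CHAR('a)) k
      = fps_nth (e oo (fps_const lam * fps_X)) k" by simp
qed

lemma e_square_nonzeroE:
  assumes "fps_nth (e\<^sup>2) n \<noteq> 0" obtains x y where "n = CHAR('a) ^ x + CHAR('a) ^ y"
proof -
  have "\<exists>i\<in>{0..n}. fps_nth e i * fps_nth e (n - i) \<noteq> 0"
    using assms sum.neutral[of "{0..n}" "\<lambda>i. fps_nth e i * fps_nth e (n - i)"]
    unfolding power2_eq_square fps_mult_nth by blast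
  then obtain i where i: "i \<le> n" "fps_nth e i \<noteq> 0" "fps_nth e (n - i) \<noteq> 0" by auto
  obtain x where "i = CHAR('a) ^ x" using i(2) by (rule e_nonzeroE)
  moreover obtain y where "n - i = CHAR('a) ^ y" using i(3) by (rule e_nonzeroE)
  ultimately have "n = CHAR('a) ^ x + CHAR('a) ^ y" using i(1) by simp
  then show ?thesis by (rule that)
qed

lemma e_square_bound: "geom_bound c (1 / c\<^sup>2) (e\<^sup>2)"
  using geom_bound_power[OF e_bound c, of 2] by (simp add: power_divide)

lemma e_square_lt_2:
  assumes "n < 2"
  shows "fps_nth (e\<^sup>2) n = 0"
proof (rule ccontr)
  assume "fps_nth (e\<^sup>2) n \<noteq> 0"
  then obtain x y where "n = CHAR('a) ^ x + CHAR('a) ^ y" by (rule e_square_nonzeroE)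
  moreover have "CHAR('a) ^ x > 0" "CHAR('a) ^ y > 0" using p_gt_1 by simp_all
  ultimately show False using assms by linarith
qed

lemma e_square_2: "fps_nth (e\<^sup>2) 2 = 1"
  using e_0 e_1 by (simp add: power2_eq_square fps_mult_nth eval_nat_numeral)

text \<open>Modulo \<open>p\<close>, a sum of two powers of \<open>p\<close> is 1 only if exactly
  one of them is \<open>p ^ 0\<close>.\<close>

lemma e_square_Suc:
  assumes "CHAR('a) dvd n" "CHAR('a) > 2"
  shows "fps_nth (e\<^sup>2) (Suc n) = 2 * fps_nth e n"
proof (cases "n = 0")
  case True
  then show ?thesis using e_square_lt_2[of 1] e_0 by simp
next
  case False
  then have n: "n \<ge> CHAR('a)" using assms(1) by (simp add: dvd_imp_le)
  have "fps_nth (e\<^sup>2) (Suc n) = (\<Sum>i = 0..Suc n. fps_nth e i * fps_nth e (Suc n - i))"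
    by (simp add: power2_eq_square fps_mult_nth)
  also have "\<dots> = (\<Sum>i\<in>{1, n}. fps_nth e i * fps_nth e (Suc n - i))"
  proof (rule sum.mono_neutral_right)
    show "\<forall>i\<in>{0..Suc n} - {1, n}. fps_nth e i * fps_nth e (Suc n - i) = 0"
    proof (rule ballI, rule ccontr)
      fix i assume i: "i \<in> {0..Suc n} - {1, n}" "fps_nth e i * fps_nth e (Suc n - i) \<noteq> 0"
      then have nz: "fps_nth e i \<noteq> 0" "fps_nth e (Suc n - i) \<noteq> 0" by auto
      obtain x where x: "i = CHAR('a) ^ x" using nz(1) by (rule e_nonzeroE)
      obtain y where y: "Suc n - i = CHAR('a) ^ y" using nz(2) by (rule e_nonzeroE)
      have "x > 0" "y > 0" using i x y by (auto intro!: gr0I)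
      then have "CHAR('a) dvd CHAR('a) ^ x + CHAR('a) ^ y" by (simp add: dvd_power)
      moreover have "CHAR('a) ^ x + CHAR('a) ^ y = Suc n" using x y i by auto
      ultimately have "CHAR('a) dvd 1" using assms(1) by (metis Suc_eq_plus1 dvd_add_right_iff)
      then show False using p_gt_1 by simp
    qed
  qed (use n p_gt_1 in auto)
  also have "\<dots> = 2 * fps_nth e n" using e_1 n assms(2) by simp
  finally show ?thesis .
qed

end

lemma additive_linearization:
  fixes lam b :: "'a::nonarch_field"
  assumes char: "prime CHAR('a)" and eps: "absval (lam - 1) < 1" "lam \<noteq> 1"
  obtains c h where "c > 0" "geom_bound c (1 / c) h" "fps_nth h 0 = 0" "fps_nth h 1 \<noteq> 0"
    "h oo (fps_const lam * fps_X + fps_const b * fps_X ^ CHAR('a)) oo fps_inv h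
      = fps_const lam * fps_X"
proof -
  define \<epsilon> where "\<epsilon> = absval (lam - 1)"
  have \<epsilon>: "0 < \<epsilon>" "\<epsilon> < 1" using eps by (auto simp: \<epsilon>_def)
  \<comment> \<open>With \<open>c \<ge> 1\<close> the bound
    \<open>absval b \<le> \<epsilon> * c\<close> already implies the one with exponent
    \<open>p - 1\<close>.\<close>
  define c where "c = max 1 (absval b / \<epsilon>)"
  have c: "c \<ge> 1" by (simp add: c_def)
  have "absval b \<le> \<epsilon> * c"
    using \<epsilon> by (simp add: c_def field_simps max_def)
  also have "\<dots> \<le> \<epsilon> * c ^ (CHAR('a) - 1)"
    using \<epsilon> c power_increasing[of 1 "CHAR('a) - 1" c] prime_ge_2_nat[OF char]
    by (intro mult_left_mono) auto
  finally interpret additive_part lam b \<epsilon> c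
    using char \<epsilon> c by unfold_locales (auto simp: \<epsilon>_def)
  let ?f = "fps_const lam * fps_X + fps_const b * fps_X ^ CHAR('a)"
  define h where "h = fps_inv e"
  have e1: "fps_nth e 1 \<noteq> 0" using e_1 by simp
  have h: "h oo e = fps_X" unfolding h_def by (rule fps_inv[OF e_0 e1])
  have inv: "fps_inv h = e" unfolding h_def by (rule fps_inv_idempotent[OF e_0 e1])
  have f0: "fps_nth ?f 0 = 0" using p_gt_1 by simp
  have fe: "?f oo e = e oo (fps_const lam * fps_X)"
    using e_0 e_conj
    by (simp add: fps_compose_add_distrib fps_compose_mult_distrib fps_X_power_compose)
  have "h oo ?f oo e = h oo (e oo (fps_const lam * fps_X))"
    unfolding fe[symmetric] by (rule fps_compose_assoc[symmetric]) (use e_0 f0 in auto)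
  also have "\<dots> = fps_const lam * fps_X"
    by (subst fps_compose_assoc) (use e_0 h in auto)
  finally have conj: "h oo ?f oo fps_inv h = fps_const lam * fps_X" unfolding inv .
  have "geom_bound c (1 / c) h"
    by (rule geom_bound_comp_inverse[OF e_bound e_0 _ h]) (use e_1 c in \<open>auto simp: absval_one\<close>)
  then show ?thesis
    using conj c e1 by (intro that[of c h]) (auto simp: h_def fps_inv_def)
qed

text \<open>On the disc of radius \<open>1 / c\<close> the term of degree \<open>p\<close> has
  exactly the critical size, and \<open>\<alpha>\<close> is the size there of the quadratic term
  relative to \<open>z\<close>, a quantity unchanged by rescaling \<open>z\<close>.\<close>

locale perturbed_additive_part = additive_part +
  fixes a :: "'a" and h :: "'a fps" and \<alpha> :: real
  assumes p_ge_5: "CHAR('a) \<ge> 5"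
    and b_eq: "absval b = \<epsilon> * c ^ (CHAR('a) - 1)"
    and alpha: "\<alpha> = absval a / c" "\<alpha> \<le> 1"
    and h: "geom_bound c (1 / c) h" "fps_nth h 0 = 0" "fps_nth h 1 = 1"
    and conj: "h oo (fps_const lam * fps_X + fps_const a * fps_X\<^sup>2 + fps_const b * fps_X ^ CHAR('a))
      = fps_const lam * h"
begin

definition "g = h oo e"
text \<open>As \<open>e' = 1\<close>, this is also \<open>h'\<close> evaluated at
  \<open>e oo (lam z)\<close>, the first Taylor coefficient of \<open>h\<close> there.\<close>

definition "G = fps_deriv g oo (fps_const lam * fps_X)"

lemma absval_lam: "absval lam = 1"
  using absval_eqI_near[of 1 lam] eps by (simp add: absval_one absval_minus_commute)

lemma alpha_nonneg: "0 \<le> \<alpha>" using alpha c by simp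

lemma g_1: "fps_nth g 1 = 1"
  using h e_0 e_1 by (simp add: g_def fps_compose_nth)

lemma g_bound: "geom_bound c (1 / c) g"
  unfolding g_def by (rule geom_bound_compose[OF h(1) e_bound c])

lemma lamX_bound: "geom_bound c (1 / c) (fps_const lam * fps_X)"
  using geom_bound_mult[OF geom_bound_const geom_bound_X, of c lam 1 "1 / c"] c absval_lam by simp

lemma G_bound: "geom_bound c 1 G"
  using geom_bound_compose[OF geom_bound_deriv[OF g_bound c] lamX_bound c] c by (simp add: G_def)

lemma G_nth: "fps_nth G j = lam ^ j * (of_nat (Suc j) * fps_nth g (Suc j))"
  by (simp add: G_def)

lemma absval_G_le: "absval (fps_nth G j) \<le> absval (fps_nth g (Suc j))"
proof -
  have "absval (of_nat (Suc j) :: 'a) * absval (fps_nth g (Suc j)) \<le> 1 * absval (fps_nth g (Suc j))"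
    by (intro mult_right_mono absval_of_nat_le) simp
  then show ?thesis by (simp add: G_nth absval_mult absval_power absval_lam del: of_nat_Suc)
qed

text \<open>\<open>e\<close> linearizes all of \<open>f\<close> but the quadratic term:
  \<open>f oo e\<close> is \<open>e oo (lam z)\<close> plus \<open>a * e\<^sup>2\<close>. The latter
  has relative size \<open>\<alpha>\<close>, so the Taylor formula for \<open>h\<close> leaves an
  error of order \<open>\<alpha>\<^sup>2\<close>.\<close>

lemma perturbation:
  "geom_bound c (\<alpha>\<^sup>2 / c) (fps_const lam * g - (g oo (fps_const lam * fps_X)) - fps_const a * (e\<^sup>2 * G))"
proof -
  let ?L = "fps_const lam * fps_X"
  let ?f = "?L + fps_const a * fps_X\<^sup>2 + fps_const b * fps_X ^ CHAR('a)"
  define D where "D = fps_const a * e\<^sup>2"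
  have f0: "fps_nth ?f 0 = 0" using p_gt_1 by simp
  have eL0: "fps_nth (e oo ?L) 0 = 0" using e_0 by simp
  have D0: "fps_nth D 0 = 0" using e_square_lt_2[of 0] by (simp add: D_def)
  have fe: "?f oo e = (e oo ?L) + D"
    using e_0 e_conj
    by (simp add: fps_compose_add_distrib fps_compose_mult_distrib fps_X_power_compose D_def
        algebra_simps)
  have "geom_bound c (absval a * (1 / c\<^sup>2)) D"
    unfolding D_def by (intro geom_bound_mult geom_bound_const e_square_bound c) simp
  then have D: "geom_bound c (\<alpha> / c) D" by (simp add: alpha power2_eq_square)
  have "geom_bound c (1 / c * \<alpha>\<^sup>2) ((h oo ((e oo ?L) + D)) - (\<Sum>j<2. D ^ j * (hasse_deriv j h oo (e oo ?L))))"
    by (rule geom_bound_taylor[OF eL0 D0 c alpha(2) h(1) geom_bound_compose[OF e_bound lamX_bound c] D])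
  moreover have "h oo ((e oo ?L) + D) = fps_const lam * g"
  proof -
    have "h oo ((e oo ?L) + D) = (h oo ?f) oo e"
      unfolding fe[symmetric] by (rule fps_compose_assoc) (use e_0 f0 in auto)
    then show ?thesis
      unfolding conj g_def using e_0 by (simp add: fps_compose_mult_distrib)
  qed
  moreover have "(\<Sum>j<2. D ^ j * (hasse_deriv j h oo (e oo ?L))) = (g oo ?L) + fps_const a * (e\<^sup>2 * G)"
  proof -
    have "h oo (e oo ?L) = g oo ?L" unfolding g_def by (rule fps_compose_assoc) (use e_0 in auto)
    moreover have "fps_deriv h oo (e oo ?L) = G"
      unfolding G_def g_def fps_compose_deriv[OF e_0] e_deriv mult_1_right
      by (rule fps_compose_assoc) (use e_0 in auto)
    ultimately show ?thesis
      by (simp add: eval_nat_numeral hasse_deriv_1 D_def mult.assoc)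
  qed
  ultimately show ?thesis by (simp add: diff_diff_eq)
qed

lemma perturbation_nth:
  "absval ((lam - lam ^ k) * fps_nth g k - a * fps_nth (e\<^sup>2 * G) k) \<le> \<alpha>\<^sup>2 / c * c ^ k"
proof -
  have "fps_nth (fps_const lam * g - (g oo (fps_const lam * fps_X)) - fps_const a * (e\<^sup>2 * G)) k
      = (lam - lam ^ k) * fps_nth g k - a * fps_nth (e\<^sup>2 * G) k"
    by (simp only: fps_sub_nth fps_mult_left_const_nth fps_nth_compose_linear left_diff_distrib)
  then show ?thesis using geom_boundD[OF perturbation, of k] by simp
qed

lemma e_square_G_bound: "geom_bound c (1 / c\<^sup>2) (e\<^sup>2 * G)"
  using geom_bound_mult[OF e_square_bound G_bound c] by simp

text \<open>The perturbation term and the error in \<open>perturbation_nth\<close> are both at most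
  \<open>\<alpha> * c ^ j\<close>, and the divisor is at least
  \<open>\<epsilon> ^ (p ^ s)\<close>.\<close>

lemma g_small:
  assumes "\<not> CHAR('a) ^ Suc s dvd j"
  shows "absval (fps_nth g (Suc j)) \<le> \<alpha> / \<epsilon> ^ (CHAR('a) ^ s) * c ^ j"
proof -
  have "\<alpha>\<^sup>2 \<le> \<alpha>" using alpha(2) alpha_nonneg by (simp add: power2_eq_square mult_left_le_one_le)
  then have "\<alpha>\<^sup>2 / c * c ^ Suc j \<le> \<alpha> * c ^ j" using c by simp
  then have 1: "absval ((lam - lam ^ Suc j) * fps_nth g (Suc j) - a * fps_nth (e\<^sup>2 * G) (Suc j)) \<le> \<alpha> * c ^ j"
    using perturbation_nth[of "Suc j"] by linarith
  have "absval (a * fps_nth (e\<^sup>2 * G) (Suc j)) \<le> absval a * (1 / c\<^sup>2 * c ^ Suc j)"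
    unfolding absval_mult by (intro mult_left_mono geom_boundD[OF e_square_G_bound]) simp
  also have "\<dots> = \<alpha> * c ^ j" using c by (simp add: alpha power2_eq_square)
  finally have 2: "absval (a * fps_nth (e\<^sup>2 * G) (Suc j)) \<le> \<alpha> * c ^ j" .
  have "absval ((lam - lam ^ Suc j) * fps_nth g (Suc j)) \<le> \<alpha> * c ^ j"
    using absval_add_bound[OF 1 2] by simp
  moreover have "\<epsilon> ^ (CHAR('a) ^ s) * absval (fps_nth g (Suc j))
      \<le> absval ((lam - lam ^ Suc j) * fps_nth g (Suc j))"
    unfolding absval_mult absval_minus_commute[of lam]
    using absval_power_minus_self_ge[OF char _ assms, of lam] eps by (intro mult_right_mono) auto
  ultimately show ?thesis using eps by (simp add: field_simps)
qed

text \<open>At exponent \<open>Suc N\<close> with \<open>N = p * q\<close> the divisor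
  \<open>\<epsilon> ^ N\<close> is below \<open>\<alpha>\<close>, so
  \<open>a * e\<^sup>2 * G\<close> would have to be small there. But its main term
  \<open>2 * a * d (Suc s)\<close> has size \<open>\<alpha> * c ^ N\<close>, and the other terms are
  smaller by the factor \<open>\<kappa> = \<alpha> / \<epsilon> ^ q < 1\<close>. The two bounds on
  \<open>\<alpha>\<close> serve these two comparisons.\<close>

lemma no_linearization_large:
  assumes q: "q = CHAR('a) ^ s" and a: "\<epsilon> ^ (CHAR('a) * q) < \<alpha>" "\<alpha> < \<epsilon> ^ q"
  shows False
proof -
  define N where "N = CHAR('a) * q"
  have N: "N = CHAR('a) ^ Suc s" by (simp add: N_def q)
  have N2: "N \<ge> 2"
    unfolding N using p_gt_1 self_le_power[of "CHAR('a)" "Suc s"] by linarith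
  define \<kappa> where "\<kappa> = \<alpha> / \<epsilon> ^ q"
  have \<alpha>0: "\<alpha> > 0" using a(1) eps zero_less_power[of \<epsilon> "CHAR('a) * q"] by linarith
  have \<kappa>: "0 < \<kappa>" "\<kappa> < 1" using a \<alpha>0 eps by (auto simp: \<kappa>_def)
  have \<alpha>1: "\<alpha> < 1"
    using a(2) eps power_le_one[of \<epsilon> q] by linarith
  have "absval (fps_nth (e\<^sup>2 * G) (Suc N) - fps_nth (e\<^sup>2) (Suc N)) \<le> \<kappa> * c ^ (N - 1)"
  proof -
    have G0: "fps_nth G 0 = 1" using g_1 by (simp add: G_nth)
    have "fps_nth (e\<^sup>2 * G) (Suc N) = (\<Sum>j = 0..Suc N. fps_nth G j * fps_nth (e\<^sup>2) (Suc N - j))"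
      by (simp add: mult.commute[of "e\<^sup>2"] fps_mult_nth)
    also have "\<dots> = fps_nth (e\<^sup>2) (Suc N) + (\<Sum>j\<in>{1..Suc N}. fps_nth G j * fps_nth (e\<^sup>2) (Suc N - j))"
      by (subst sum.atLeast_Suc_atMost) (auto simp: G0)
    finally have "fps_nth (e\<^sup>2 * G) (Suc N) - fps_nth (e\<^sup>2) (Suc N)
        = (\<Sum>j\<in>{1..Suc N}. fps_nth G j * fps_nth (e\<^sup>2) (Suc N - j))" by simp
    also have "absval \<dots> \<le> \<kappa> * c ^ (N - 1)"
    proof (rule absval_sum_bound)
      fix j assume j: "j \<in> {1..Suc N}"
      show "absval (fps_nth G j * fps_nth (e\<^sup>2) (Suc N - j)) \<le> \<kappa> * c ^ (N - 1)"
      proof (cases "j < N")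
        case False
        then show ?thesis using e_square_lt_2[of "Suc N - j"] \<kappa> c by simp
      next
        case True
        then have "\<not> CHAR('a) ^ Suc s dvd j" using j unfolding N by (auto dest: dvd_imp_le)
        then have "absval (fps_nth G j) \<le> \<kappa> * c ^ j"
          using g_small[of s j] absval_G_le[of j] unfolding \<kappa>_def q by linarith
        then have "absval (fps_nth G j * fps_nth (e\<^sup>2) (Suc N - j))
            \<le> (\<kappa> * c ^ j) * (1 / c\<^sup>2 * c ^ (Suc N - j))"
          unfolding absval_mult using \<kappa> c
          by (intro mult_mono geom_boundD[OF e_square_bound]) auto
        also have "\<dots> = \<kappa> * (c ^ j * c ^ (Suc N - j) / c\<^sup>2)" by simp
        also have "c ^ j * c ^ (Suc N - j) = c ^ (N - 1) * c\<^sup>2"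
          using True N2 by (simp flip: power_add)
        finally show ?thesis using c by simp
      qed
    qed (use \<kappa> c in simp)
    finally show ?thesis .
  qed
  moreover have "absval (fps_nth (e\<^sup>2) (Suc N)) = c ^ (N - 1)"
  proof -
    have "CHAR('a) dvd N" by (simp add: N_def)
    then have "fps_nth (e\<^sup>2) (Suc N) = 2 * d (Suc s)"
      using e_square_Suc[of N] p_ge_5 e_power[of "Suc s"] unfolding N by simp
    then show ?thesis
      using absval_numeral_units[OF char p_ge_5] d_eq[OF b_eq, of "Suc s"]
      unfolding N by (simp only: absval_mult mult_1)
  qed
  moreover have "\<kappa> * c ^ (N - 1) < c ^ (N - 1)" using \<kappa> c by simp
  ultimately have main: "absval (fps_nth (e\<^sup>2 * G) (Suc N)) = c ^ (N - 1)"
    using absval_eqI_near[of "fps_nth (e\<^sup>2) (Suc N)" "fps_nth (e\<^sup>2 * G) (Suc N)"]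
    by (simp add: absval_minus_commute)
  have "absval a * c ^ (N - 1) = \<alpha> * c ^ N"
    using c N2 by (simp add: alpha power_eq_if)
  then have l: "absval (a * fps_nth (e\<^sup>2 * G) (Suc N)) = \<alpha> * c ^ N"
    by (simp add: absval_mult main)
  have "absval (lam ^ Suc N - lam) = \<epsilon> ^ N"
    using absval_power_minus_self[OF char, of lam 1 "Suc s"] eps p_gt_1 by (simp add: N)
  then have "absval ((lam - lam ^ Suc N) * fps_nth g (Suc N)) \<le> \<epsilon> ^ N * (1 / c * c ^ Suc N)"
    unfolding absval_mult absval_minus_commute[of lam]
    using eps by (intro mult_mono geom_boundD[OF g_bound]) auto
  also have "\<dots> = \<epsilon> ^ N * c ^ N" using c by simp
  also have "\<dots> < \<alpha> * c ^ N" using a(1) c by (simp add: N_def)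
  finally have "absval ((lam - lam ^ Suc N) * fps_nth g (Suc N)) < \<alpha> * c ^ N" .
  moreover have "\<alpha>\<^sup>2 / c * c ^ Suc N < \<alpha> * c ^ N"
    using \<alpha>0 \<alpha>1 c by (simp add: power2_eq_square)
  ultimately have "absval (a * fps_nth (e\<^sup>2 * G) (Suc N)) < \<alpha> * c ^ N"
    using perturbation_nth[of "Suc N"] absval_diff_le[of "(lam - lam ^ Suc N) * fps_nth g (Suc N)"
        "(lam - lam ^ Suc N) * fps_nth g (Suc N) - a * fps_nth (e\<^sup>2 * G) (Suc N)"] by simp
  then show False using l by simp
qed

end


section \<open>The resonant case\<close>

lemma prime_power_mod:
  fixes p :: nat
  assumes "p > 1"
  shows "p ^ x mod p = (if x = 0 then 1 else 0)"
  using assms by (cases x) auto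

text \<open>Powers of \<open>p\<close> are 0 or 1 modulo \<open>p\<close>, so a sum congruent to 2
  needs both exponents to vanish.\<close>

lemma two_prime_powers:
  fixes p :: nat
  assumes p: "p \<ge> 5" and eq: "p * k + 2 = p ^ x + p ^ y"
  shows "k = 0"
proof -
  define f where "f x = (if x = 0 then 1 else 0 :: nat)" for x :: nat
  have f: "p ^ x mod p = f x" for x using prime_power_mod[of p x] p by (simp add: f_def)
  have "(f x + f y) mod p = (p ^ x + p ^ y) mod p"
    by (intro mod_add_cong) (simp_all flip: f)
  also have "\<dots> = 2 mod p" unfolding eq[symmetric] by (simp only: mod_mult_self4)
  finally have "f x + f y = 2" using p by (simp add: f_def split: if_splits)
  then have "x = 0" "y = 0" by (auto simp: f_def split: if_splits)
  then show ?thesis using eq p by simp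
qed

text \<open>Modulo \<open>p\<close> exactly two of the four exponents vanish. In the application
  \<open>Suc j\<close> is \<open>p ^ u + p ^ w\<close> plus a multiple of \<open>q = p ^ s\<close>,
  and the alternatives become \<open>j\<close> congruent to 1, 0 or -1 modulo
  \<open>q\<close>.\<close>

lemma four_prime_powers:
  fixes p :: nat
  assumes p: "prime p" "p \<ge> 5" and s: "s \<ge> 1"
    and eq: "(p ^ x + p ^ y) + (p ^ u + p ^ w) = p ^ s * t + 2"
  shows "p ^ u + p ^ w = 2 \<or> p ^ s dvd p ^ u + p ^ w - 1 \<or> p ^ s dvd p ^ u + p ^ w"
proof -
  define f where "f x = (if x = 0 then 1 else 0 :: nat)" for x :: nat
  have f: "p ^ x mod p = f x" for x using prime_power_mod[of p x] p by (simp add: f_def)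
  have "(f x + f y + (f u + f w)) mod p = ((p ^ x + p ^ y) + (p ^ u + p ^ w)) mod p"
    by (intro mod_add_cong) (simp_all flip: f)
  also have "\<dots> = 2 mod p"
  proof -
    have "p dvd p ^ s * t" using s by (simp add: dvd_power)
    then obtain k where "p ^ s * t = p * k" ..
    then show ?thesis unfolding eq by (simp only: mod_mult_self4)
  qed
  finally have "f x + f y + (f u + f w) = 2" using p(2) by (simp add: f_def split: if_splits)
  then consider "u = 0" "w = 0" | "x = 0" "y = 0" | "x = 0" "u = 0" | "x = 0" "w = 0"
    | "y = 0" "u = 0" | "y = 0" "w = 0"
    by (auto simp: f_def split: if_splits)
  moreover have *: "p ^ s dvd p ^ z" if "p ^ z + p ^ v = p ^ s * t" for z v
    using prime_power_add_dvd[OF p(1), of s z v] p(2) that by simp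
  ultimately show ?thesis
  proof cases
    case 2
    then have "p ^ u + p ^ w = p ^ s * t" using eq by simp
    then show ?thesis by (simp only: dvd_triv_left simp_thms)
  qed (use eq *[of w y] *[of u y] *[of w x] *[of u x] in \<open>auto simp: add_ac\<close>)
qed

context perturbed_additive_part
begin

lemma e_even:
  assumes "even k"
  shows "fps_nth e k = 0"
proof (rule ccontr)
  assume "fps_nth e k \<noteq> 0"
  then obtain i where i: "k = CHAR('a) ^ i" by (rule e_nonzeroE)
  have "odd CHAR('a)" using char p_ge_5 prime_odd_nat by auto
  then show False using assms i by simp
qed

lemma e_square_double_power: "fps_nth (e\<^sup>2) (2 * CHAR('a) ^ i) = (d i)\<^sup>2"
proof -
  let ?N = "CHAR('a) ^ i"
  have "fps_nth (e\<^sup>2) (2 * ?N) = (\<Sum>k = 0..2 * ?N. fps_nth e k * fps_nth e (2 * ?N - k))"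
    by (simp add: power2_eq_square fps_mult_nth)
  also have "\<dots> = (\<Sum>k\<in>{?N}. fps_nth e k * fps_nth e (2 * ?N - k))"
  proof (rule sum.mono_neutral_right)
    show "\<forall>k\<in>{0..2 * ?N} - {?N}. fps_nth e k * fps_nth e (2 * ?N - k) = 0"
    proof (rule ballI, rule ccontr)
      fix k assume k: "k \<in> {0..2 * ?N} - {?N}" "fps_nth e k * fps_nth e (2 * ?N - k) \<noteq> 0"
      then have nz: "fps_nth e k \<noteq> 0" "fps_nth e (2 * ?N - k) \<noteq> 0" by auto
      obtain x where x: "k = CHAR('a) ^ x" using nz(1) by (rule e_nonzeroE)
      obtain y where y: "2 * ?N - k = CHAR('a) ^ y" using nz(2) by (rule e_nonzeroE)
      have sum: "CHAR('a) ^ x + CHAR('a) ^ y = 2 * ?N" using x y k by auto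
      have "?N dvd CHAR('a) ^ x" "?N dvd CHAR('a) ^ y"
        using prime_power_add_dvd[OF char, of i x y] prime_power_add_dvd[OF char, of i y x]
          sum p_ge_5 by (auto simp: add.commute)
      then have "?N \<le> CHAR('a) ^ x" "?N \<le> CHAR('a) ^ y"
        using p_gt_1 by (intro dvd_imp_le; simp)+
      then show False using sum x k by simp
    qed
  qed auto
  also have "\<dots> = (d i)\<^sup>2" by (simp add: e_power power2_eq_square)
  finally show ?thesis .
qed

lemma e_square_add_2:
  assumes "CHAR('a) dvd n" "n > 0"
  shows "fps_nth (e\<^sup>2) (n + 2) = 0"
proof (rule ccontr)
  assume "fps_nth (e\<^sup>2) (n + 2) \<noteq> 0"
  then obtain x y where xy: "n + 2 = CHAR('a) ^ x + CHAR('a) ^ y" by (rule e_square_nonzeroE)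
  from assms(1) obtain k where k: "n = CHAR('a) * k" ..
  then have "k = 0" using two_prime_powers[OF p_ge_5, of k x y] xy by simp
  then show False using k assms(2) by simp
qed

text \<open>
  The series \<open>\<xi>\<close> collects the exponents of \<open>g\<close> congruent to \<open>1\<close> modulo \<open>q\<close>. Its logarithmic
  derivative agrees with \<open>(-2 / lam) (A - \<kappa> A2)\<close> modulo \<open>(lam - 1) ^ q\<close>. The first order
  part \<open>A\<close> may satisfy the Cartier condition, but it lives on powers of \<open>p\<close>, whereas \<open>A2\<close>
  violates the condition at the exponents \<open>2\<close> and \<open>2 p\<close>.
\<close>

lemma no_linearization_resonant:
  assumes c1: "c = 1" and s: "s \<ge> 1" and q: "q = CHAR('a) ^ s" and a: "a = (lam - 1) ^ q"
  shows False
proof -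
  \<comment> \<open>Off the exponents congruent to 1 modulo \<open>q\<close> every divisor is at
    least \<open>\<epsilon> ^ r\<close>, so that \<open>\<zeta>\<close> bounds the coefficients of
    \<open>g\<close> there. \<open>E\<close> is the size of \<open>a\<close> and bounds every
    \<open>lam ^ (q * m) - 1\<close>.\<close>
  define r where "r = CHAR('a) ^ (s - 1)"
  define E where "E = \<epsilon> ^ q"
  define \<zeta> where "\<zeta> = E / \<epsilon> ^ r"
  define \<kappa> where "\<kappa> = a / (lam - 1)"
  have q_r: "q = CHAR('a) * r" using s by (cases s) (auto simp: q r_def)
  have r: "r \<ge> 1" using p_gt_1 by (simp add: r_def)
  have "CHAR('a) * 1 \<le> CHAR('a) * r" using r by (intro mult_le_mono2)
  then have q5: "q \<ge> 5" using p_ge_5 q_r by linarith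
  have p_dvd: "CHAR('a) dvd q" by (simp add: q_r)
  have Suc_div: "Suc (q * i) div q = i" and Suc_mod: "Suc (q * i) mod q = 1" for i
    using div_mult_self2[of q 1 i] mod_mult_self2[of 1 q i] q5 by simp_all
  have E: "0 < E" "E < 1" using eps q5 by (auto simp: E_def power_less_one_iff)
  have abs_a: "absval a = E" using eps(1) by (simp add: a E_def absval_power)
  have \<alpha>: "\<alpha> = E" using alpha(1) by (simp add: c1 abs_a)
  have E_eps: "E \<le> \<epsilon> * \<epsilon>"
    using eps q5 power_decreasing[of 2 q \<epsilon>] by (simp add: E_def power2_eq_square)
  have E_le: "E \<le> \<epsilon>" using eps q5 power_decreasing[of 1 q \<epsilon>] by (simp add: E_def)
  have \<zeta>_eq: "\<zeta> = \<epsilon> ^ (q - r)"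
    using eps q_r p_gt_1 by (simp add: \<zeta>_def E_def power_diff)
  have "1 * r < CHAR('a) * r" using r p_gt_1 by (intro mult_strict_right_mono) auto
  then have qr: "q - r \<ge> 1" using q_r by linarith
  have \<zeta>: "\<zeta> \<le> \<epsilon>" "0 \<le> \<zeta>"
    unfolding \<zeta>_eq using eps power_decreasing[of 1 "q - r" \<epsilon>] qr by auto
  have \<zeta>r: "\<zeta> \<le> \<epsilon> ^ r"
  proof -
    have "2 * r \<le> CHAR('a) * r" using p_ge_5 by (intro mult_le_mono1) simp
    then have "r \<le> q - r" using q_r by linarith
    then show ?thesis unfolding \<zeta>_eq using eps by (intro power_decreasing) auto
  qed
  have E_\<zeta>: "E \<le> \<zeta>" unfolding E_def \<zeta>_eq using eps by (intro power_decreasing) auto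
  note units = absval_numeral_units[OF char p_ge_5]
  have lam_q: "lam ^ q - 1 = a" using diff_power_char[OF char q, of lam 1] by (simp add: a)
  have lam_qm: "absval (lam ^ (q * m) - 1) \<le> E" for m
    using absval_power_minus_one_le[of "lam ^ q" E m] abs_a lam_q E by (simp add: power_mult)

  have bd_e2: "absval (fps_nth (e\<^sup>2) n) \<le> 1" and bd_g: "absval (fps_nth g n) \<le> 1" and bd_e: "absval (fps_nth e n) \<le> 1" for n
    using geom_boundD[OF e_square_bound, of n] geom_boundD[OF g_bound, of n]
      geom_boundD[OF e_bound, of n] by (simp_all add: c1)
  have pert: "absval ((lam - lam ^ k) * fps_nth g k - a * fps_nth (e\<^sup>2 * G) k) \<le> E * E" for k
    using perturbation_nth[of k] by (simp add: c1 \<alpha> power2_eq_square)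
  have g_q: "absval (fps_nth g (Suc j)) \<le> \<zeta>" if "\<not> q dvd j" for j
  proof -
    have "CHAR('a) ^ Suc (s - 1) = q" using s q by simp
    then show ?thesis using g_small[of "s - 1" j] that by (simp add: c1 \<alpha> \<zeta>_def r_def)
  qed
  have g_p: "absval (fps_nth g (Suc j)) \<le> E / \<epsilon>" if "\<not> CHAR('a) dvd j" for j
    using g_small[of 0 j] that by (simp add: c1 \<alpha>)
  have G_q: "absval (fps_nth G j) \<le> \<zeta>" if "\<not> q dvd j" for j
    using order_trans[OF absval_G_le g_q[OF that]] .

  define \<xi> where "\<xi> = Abs_fps (\<lambda>m. fps_nth g (Suc (q * m)))"
  define A where "A = fps_section q e"
  define A2 where "A2 = fps_section q (e\<^sup>2)"
  have bd_\<xi>: "absval (fps_nth \<xi> m) \<le> 1" for m using bd_g by (simp add: \<xi>_def)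
  have G_\<xi>: "fps_nth G (q * m) = lam ^ (q * m) * fps_nth \<xi> m" for m
  proof -
    have "(of_nat (q * m) :: 'a) = 0" using p_dvd by (simp only: of_nat_eq_0_iff_char_dvd dvd_mult2)
    then show ?thesis by (simp add: G_nth \<xi>_def)
  qed

  \<comment> \<open>Summands of \<open>e\<^sup>2 * G\<close> with \<open>q\<close> not dividing
    \<open>i\<close> contain a \<open>G\<close> coefficient of size at most \<open>\<zeta>\<close>
    and go into the error.\<close>
  have first_order: "absval ((lam - lam ^ Suc j) * fps_nth g (Suc j)
      - a * (\<Sum>i\<in>{i. i \<le> Suc j \<and> q dvd i}. fps_nth (e\<^sup>2) (Suc j - i) * fps_nth G i)) \<le> E * \<zeta>" for j
  proof -
    let ?S = "\<Sum>i\<in>{i. i \<le> Suc j \<and> q dvd i}. fps_nth (e\<^sup>2) (Suc j - i) * fps_nth G i"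
    let ?S' = "\<Sum>i\<in>{i. i \<le> Suc j \<and> \<not> q dvd i}. fps_nth (e\<^sup>2) (Suc j - i) * fps_nth G i"
    have "fps_nth (e\<^sup>2 * G) (Suc j) = (\<Sum>i = 0..Suc j. fps_nth (e\<^sup>2) (Suc j - i) * fps_nth G i)"
      by (simp add: mult.commute[of "e\<^sup>2"] fps_mult_nth mult.commute)
    also have "{0..Suc j} = {i. i \<le> Suc j \<and> q dvd i} \<union> {i. i \<le> Suc j \<and> \<not> q dvd i}" by auto
    also have "(\<Sum>i\<in>\<dots>. fps_nth (e\<^sup>2) (Suc j - i) * fps_nth G i) = ?S + ?S'"
      by (rule sum.union_disjoint) auto
    finally have split: "fps_nth (e\<^sup>2 * G) (Suc j) = ?S + ?S'" .
    have "absval ?S' \<le> \<zeta>"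
    proof (rule absval_sum_bound)
      fix i assume "i \<in> {i. i \<le> Suc j \<and> \<not> q dvd i}"
      then have "absval (fps_nth (e\<^sup>2) (Suc j - i)) * absval (fps_nth G i) \<le> 1 * \<zeta>"
        by (intro mult_mono bd_e2 G_q) auto
      then show "absval (fps_nth (e\<^sup>2) (Suc j - i) * fps_nth G i) \<le> \<zeta>" by (simp add: absval_mult)
    qed (rule \<zeta>)
    then have 1: "absval (a * ?S') \<le> E * \<zeta>" unfolding absval_mult abs_a using E by simp
    have 2: "absval ((lam - lam ^ Suc j) * fps_nth g (Suc j) - a * fps_nth (e\<^sup>2 * G) (Suc j)) \<le> E * \<zeta>"
      using pert[of "Suc j"] mult_left_mono[OF E_\<zeta>, of E] E by linarith
    have eq: "(lam - lam ^ Suc j) * fps_nth g (Suc j) - a * ?S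
        = ((lam - lam ^ Suc j) * fps_nth g (Suc j) - a * fps_nth (e\<^sup>2 * G) (Suc j)) + a * ?S'"
      unfolding split by (simp add: algebra_simps)
    show ?thesis unfolding eq by (rule absval_add_bound[OF 2 1])
  qed

  \<comment> \<open>Only \<open>k = q * i\<close> contributes to the first-order sum, with the
    coefficient 1 of \<open>e\<^sup>2\<close> at 2. The divisor is \<open>lam - lam\<^sup>2\<close>
    up to \<open>E\<close>; dividing \<open>a\<close> by it produces
    \<open>\<kappa>\<close>.\<close>
  have G_1: "absval (fps_nth G (Suc (q * i)) + 2 * \<kappa> * fps_nth \<xi> i) \<le> E" for i
  proof -
    let ?j = "Suc (q * i)"
    let ?S = "\<Sum>k\<in>{k. k \<le> Suc ?j \<and> q dvd k}. fps_nth (e\<^sup>2) (Suc ?j - k) * fps_nth G k"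
    define \<delta> where "\<delta> = lam ^ (q * i) - 1"
    define x where "x = fps_nth g (Suc ?j)"
    define y where "y = fps_nth \<xi> i"
    define W where "W = (lam - lam ^ Suc ?j) * x - a * ?S"
    have "?S = (\<Sum>k\<in>{q * i}. fps_nth (e\<^sup>2) (Suc ?j - k) * fps_nth G k)"
    proof (rule sum.mono_neutral_right)
      show "\<forall>k\<in>{k. k \<le> Suc ?j \<and> q dvd k} - {q * i}. fps_nth (e\<^sup>2) (Suc ?j - k) * fps_nth G k = 0"
      proof
        fix k assume k: "k \<in> {k. k \<le> Suc ?j \<and> q dvd k} - {q * i}"
        then obtain l where l: "k = q * l" by auto
        have "l < i"
        proof (rule ccontr)
          assume "\<not> l < i"
          then have "q * (i + 1) \<le> q * l" using k l by (intro mult_le_mono2) (cases "l = i", auto)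
          then show False using k l q5 by simp
        qed
        then have "q * l \<le> q * i" by simp
        then have "Suc ?j - k = q * (i - l) + 2" unfolding l diff_mult_distrib2 by linarith
        moreover have "q * (i - l) > 0" using \<open>l < i\<close> q5 by simp
        moreover have "CHAR('a) dvd q * (i - l)" using p_dvd by simp
        ultimately show "fps_nth (e\<^sup>2) (Suc ?j - k) * fps_nth G k = 0"
          using e_square_add_2[of "q * (i - l)"] by simp
      qed
    qed auto
    then have S: "?S = (1 + \<delta>) * y"
      using e_square_2 by (simp add: G_\<xi> \<delta>_def y_def numeral_2_eq_2)
    have W: "absval W \<le> E * \<zeta>" unfolding W_def x_def by (rule first_order)
    have \<delta>: "absval \<delta> \<le> E" using lam_qm by (simp add: \<delta>_def)
    have "\<not> CHAR('a) dvd ?j"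
    proof
      assume "CHAR('a) dvd ?j"
      then have "CHAR('a) dvd 1" using p_dvd by (metis Suc_eq_plus1 dvd_add_right_iff dvd_mult2)
      then show False using p_gt_1 by simp
    qed
    then have x: "absval x \<le> E / \<epsilon>" unfolding x_def by (rule g_p)
    have G: "fps_nth G ?j = 2 * lam * (1 + \<delta>) * x"
    proof -
      have "(of_nat (q * i) :: 'a) = 0" using p_dvd by (simp only: of_nat_eq_0_iff_char_dvd dvd_mult2)
      then have "(of_nat (Suc ?j) :: 'a) = 2" by simp
      then show ?thesis unfolding G_nth by (simp add: \<delta>_def x_def mult_ac del: of_nat_Suc)
    qed
    have lam_j: "lam ^ Suc ?j = lam\<^sup>2 * (1 + \<delta>)" by (simp add: \<delta>_def power2_eq_square)
    have "lam - 1 \<noteq> 0" using eps by auto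
    then have \<kappa>: "(lam - 1) * \<kappa> = a" by (simp add: \<kappa>_def)
    have "(lam - 1) * (fps_nth G ?j + 2 * \<kappa> * y) = (lam - 1) * fps_nth G ?j + 2 * ((lam - 1) * \<kappa>) * y"
      by (simp only: distrib_left mult_ac)
    also have "\<dots> = (lam - 1) * fps_nth G ?j + 2 * a * y" unfolding \<kappa> ..
    also have "\<dots> = - (2 * (1 + \<delta>) * (W + lam\<^sup>2 * (\<delta> * x) + a * \<delta> * y)) - 2 * (a * \<delta> * y)"
      unfolding G W_def S lam_j by (simp add: algebra_simps power2_eq_square)
    also have "absval \<dots> \<le> \<epsilon> * E"
    proof -
      have b1: "absval (a * \<delta> * y) \<le> \<epsilon> * E"
      proof -
        have "absval (a * \<delta> * y) \<le> E * E * 1"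
          unfolding absval_mult abs_a using \<delta> bd_\<xi> E by (intro mult_mono) (auto simp: y_def)
        also have "\<dots> \<le> \<epsilon> * E"
          using E_le E by (simp add: mult_right_mono)
        finally show ?thesis .
      qed
      have "absval (\<delta> * x) \<le> E * (E / \<epsilon>)"
        unfolding absval_mult using \<delta> x E by (intro mult_mono) auto
      also have "\<dots> \<le> E * \<epsilon>"
        using E_eps E eps by (intro mult_left_mono) (auto simp: divide_le_eq)
      finally have b2: "absval (lam\<^sup>2 * (\<delta> * x)) \<le> \<epsilon> * E"
        by (simp add: absval_mult absval_power absval_lam mult.commute)
      have "E * \<zeta> \<le> E * \<epsilon>" using \<zeta>(1) E by (intro mult_left_mono) auto
      then have b3: "absval W \<le> \<epsilon> * E" using order_trans[OF W] by (simp add: mult.commute)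
      have "absval (1 + \<delta>) \<le> 1" using \<delta> E by (intro absval_add_bound) (auto simp: absval_one)
      then have "absval (1 + \<delta>) * absval (W + lam\<^sup>2 * (\<delta> * x) + a * \<delta> * y) \<le> 1 * (\<epsilon> * E)"
        by (rule mult_mono[OF _ absval_add_bound[OF absval_add_bound[OF b3 b2] b1]]) auto
      then have b4: "absval (- (2 * (1 + \<delta>) * (W + lam\<^sup>2 * (\<delta> * x) + a * \<delta> * y))) \<le> \<epsilon> * E"
        unfolding absval_minus absval_mult[of "2 * (1 + \<delta>)"] absval_mult[of 2] units by simp
      have b5: "absval (2 * (a * \<delta> * y)) \<le> \<epsilon> * E"
        unfolding absval_mult[of 2] units using b1 by simp
      show ?thesis by (rule absval_diff_bound[OF b4 b5])
    qed
    finally show ?thesis using eps by (simp add: absval_mult y_def)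
  qed

  \<comment> \<open>A nonzero coefficient of \<open>e\<^sup>2\<close> makes
    \<open>Suc (q * m) - j\<close> a sum of two powers of \<open>p\<close>. A nonzero summand in the
    first-order sum for \<open>j\<close> would do the same for \<open>Suc j - i\<close>, against
    \<open>four_prime_powers\<close>; the residue -1 is excluded since \<open>Suc j\<close> is then
    0 in the field. Only the error \<open>E * \<zeta>\<close> remains, and the divisor is at least
    \<open>\<epsilon> ^ r \<ge> \<zeta>\<close>.\<close>
  have G_other: "absval (fps_nth (e\<^sup>2) (Suc (q * m) - j) * fps_nth G j) \<le> E"
    if j: "j \<le> Suc (q * m)" "\<not> q dvd j" "j mod q \<noteq> 1" for m j
  proof (cases "fps_nth (e\<^sup>2) (Suc (q * m) - j) = 0 \<or> CHAR('a) dvd Suc j")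
    case True
    then have "fps_nth (e\<^sup>2) (Suc (q * m) - j) = 0 \<or> fps_nth G j = 0"
      unfolding G_nth by (metis mult_not_zero of_nat_eq_0_iff_char_dvd)
    then show ?thesis using E by auto
  next
    case False
    then have "fps_nth (e\<^sup>2) (Suc (q * m) - j) \<noteq> 0" by simp
    then obtain x y where xy: "Suc (q * m) - j = CHAR('a) ^ x + CHAR('a) ^ y"
      by (rule e_square_nonzeroE)
    have "fps_nth (e\<^sup>2) (Suc j - i) * fps_nth G i = 0" if i: "i \<le> Suc j" "q dvd i" for i
    proof (rule ccontr)
      assume "fps_nth (e\<^sup>2) (Suc j - i) * fps_nth G i \<noteq> 0"
      then have "fps_nth (e\<^sup>2) (Suc j - i) \<noteq> 0" by auto
      then obtain u w where uw: "Suc j - i = CHAR('a) ^ u + CHAR('a) ^ w" by (rule e_square_nonzeroE)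
      obtain l where l: "i = q * l" using i by auto
      have "q * l < q * (m + 1)" using i j q5 l by simp
      then have "l \<le> m" unfolding mult_less_cancel1 by simp
      then have "q * l \<le> q * m" by simp
      then have "(CHAR('a) ^ x + CHAR('a) ^ y) + (CHAR('a) ^ u + CHAR('a) ^ w) = CHAR('a) ^ s * (m - l) + 2"
        using xy uw[unfolded l] i(1)[unfolded l] j(1) unfolding q[symmetric] diff_mult_distrib2
        by linarith
      then have "CHAR('a) ^ u + CHAR('a) ^ w = 2 \<or> q dvd CHAR('a) ^ u + CHAR('a) ^ w - 1
          \<or> q dvd CHAR('a) ^ u + CHAR('a) ^ w"
        unfolding q by (intro four_prime_powers[OF char p_ge_5 s])
      then show False
      proof (elim disjE)
        assume "CHAR('a) ^ u + CHAR('a) ^ w = 2"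
        then have "j = q * l + 1" using uw i l by simp
        then show False using j(3) q5 by (simp add: mod_Suc)
      next
        assume "q dvd CHAR('a) ^ u + CHAR('a) ^ w - 1"
        moreover have "CHAR('a) ^ u > 0" using p_gt_1 by simp
        then have "j = q * l + (CHAR('a) ^ u + CHAR('a) ^ w - 1)"
          using uw[unfolded l] i(1)[unfolded l] by linarith
        ultimately have "q dvd j" by (simp only: dvd_add dvd_triv_left)
        then show False using j(2) by contradiction
      next
        assume "q dvd CHAR('a) ^ u + CHAR('a) ^ w"
        moreover have "Suc j = q * l + (CHAR('a) ^ u + CHAR('a) ^ w)"
          using uw[unfolded l] i(1)[unfolded l] by linarith
        ultimately have "q dvd Suc j" by (simp only: dvd_add dvd_triv_left)
        then show False using False p_dvd by (meson dvd_trans)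
      qed
    qed
    then have "(\<Sum>i\<in>{i. i \<le> Suc j \<and> q dvd i}. fps_nth (e\<^sup>2) (Suc j - i) * fps_nth G i) = 0"
      by (intro sum.neutral) blast
    then have "absval ((lam - lam ^ Suc j) * fps_nth g (Suc j)) \<le> E * \<zeta>"
      using first_order[of j] by (simp only: mult_zero_right diff_zero)
    moreover have "\<epsilon> ^ r * absval (fps_nth g (Suc j)) \<le> absval ((lam - lam ^ Suc j) * fps_nth g (Suc j))"
    proof -
      have "CHAR('a) ^ Suc (s - 1) = q" using s q by simp
      then have "\<epsilon> ^ r \<le> absval (lam ^ Suc j - lam)"
        using absval_power_minus_self_ge[OF char, of lam "s - 1" j] eps j(2) by (simp add: r_def)
      then show ?thesis
        unfolding absval_mult absval_minus_commute[of lam] by (intro mult_right_mono) auto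
    qed
    moreover have "\<zeta> * E \<le> \<epsilon> ^ r * E" using \<zeta>r E by (intro mult_right_mono) auto
    ultimately have "\<epsilon> ^ r * absval (fps_nth g (Suc j)) \<le> \<epsilon> ^ r * E"
      by (simp only: mult.commute[of E])
    then have "absval (fps_nth g (Suc j)) \<le> E" using eps by simp
    then have "absval (fps_nth (e\<^sup>2) (Suc (q * m) - j)) * absval (fps_nth G j) \<le> 1 * E"
      using absval_G_le[of j] by (intro mult_mono bd_e2) auto
    then show ?thesis by (simp add: absval_mult)
  qed

  have \<kappa>_bd: "absval \<kappa> = E / \<epsilon>" using abs_a eps by (simp add: \<kappa>_def absval_divide)

  \<comment> \<open>The indices \<open>j\<close> divisible by \<open>q\<close> give the term with
    \<open>A\<close>, those congruent to 1 give the term with \<open>A2\<close> by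
    \<open>G_1\<close>, and all others are error.\<close>
  have second_order: "absval (fps_nth (e\<^sup>2 * G) (Suc (q * m))
      - fps_nth (2 * A * \<xi> - fps_const (2 * \<kappa>) * A2 * \<xi>) m) \<le> E" for m
  proof -
    let ?k = "Suc (q * m)"
    define T where "T j = fps_nth (e\<^sup>2) (?k - j) * fps_nth G j" for j
    define M where "M j = (if q dvd j then 2 * (fps_nth \<xi> (j div q) * fps_nth A (m - j div q))
      else if j mod q = 1 then - (2 * \<kappa>) * (fps_nth \<xi> (j div q) * fps_nth A2 (m - j div q)) else 0)" for j
    have T: "fps_nth (e\<^sup>2 * G) ?k = (\<Sum>j = 0..?k. T j)"
      unfolding T_def by (simp add: mult.commute[of "e\<^sup>2"] fps_mult_nth mult.commute)
    have "(\<Sum>j = 0..?k. M j) = (\<Sum>j\<in>(\<lambda>i. q * i) ` {0..m} \<union> (\<lambda>i. Suc (q * i)) ` {0..m}. M j)"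
    proof (rule sum.mono_neutral_right)
      show "\<forall>j\<in>{0..?k} - ((\<lambda>i. q * i) ` {0..m} \<union> (\<lambda>i. Suc (q * i)) ` {0..m}). M j = 0"
      proof
        fix j assume j: "j \<in> {0..?k} - ((\<lambda>i. q * i) ` {0..m} \<union> (\<lambda>i. Suc (q * i)) ` {0..m})"
        have dm: "j = q * (j div q) + j mod q" by simp
        have "j div q \<le> ?k div q" using j by (intro div_le_mono) simp
        also have "?k div q = m" by (rule Suc_div)
        finally have "j div q \<in> {0..m}" by simp
        then have "j \<noteq> q * (j div q)" "j \<noteq> Suc (q * (j div q))" using j by blast+
        then have "j mod q \<noteq> 0" "j mod q \<noteq> 1" using dm by linarith+
        then show "M j = 0" by (simp add: M_def dvd_eq_mod_eq_0)
      qed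
    qed (auto intro!: le_SucI mult_le_mono2)
    also have "\<dots> = (\<Sum>j\<in>(\<lambda>i. q * i) ` {0..m}. M j) + (\<Sum>j\<in>(\<lambda>i. Suc (q * i)) ` {0..m}. M j)"
    proof (rule sum.union_disjoint)
      have "q * i \<noteq> Suc (q * l)" for i l
      proof
        assume "q * i = Suc (q * l)"
        then have "(q * i) mod q = Suc (q * l) mod q" by simp
        then show False using q5 by (simp add: mod_Suc)
      qed
      then show "(\<lambda>i. q * i) ` {0..m} \<inter> (\<lambda>i. Suc (q * i)) ` {0..m} = {}" by blast
    qed auto
    also have "(\<Sum>j\<in>(\<lambda>i. q * i) ` {0..m}. M j) = (\<Sum>i = 0..m. 2 * (fps_nth \<xi> i * fps_nth A (m - i)))"
      using q5 by (subst sum.reindex) (auto simp: inj_on_def M_def)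
    also have "(\<Sum>j\<in>(\<lambda>i. Suc (q * i)) ` {0..m}. M j)
        = (\<Sum>i = 0..m. - (2 * \<kappa>) * (fps_nth \<xi> i * fps_nth A2 (m - i)))"
    proof (subst sum.reindex)
      have "M (Suc (q * i)) = - (2 * \<kappa>) * (fps_nth \<xi> i * fps_nth A2 (m - i))" for i
      proof -
        show ?thesis unfolding M_def dvd_eq_mod_eq_0 Suc_div Suc_mod by simp
      qed
      then show "sum (M \<circ> (\<lambda>i. Suc (q * i))) {0..m}
          = (\<Sum>i = 0..m. - (2 * \<kappa>) * (fps_nth \<xi> i * fps_nth A2 (m - i)))" by simp
    qed (use q5 in \<open>auto simp: inj_on_def\<close>)
    finally have M: "(\<Sum>j = 0..?k. M j) = fps_nth (2 * A * \<xi> - fps_const (2 * \<kappa>) * A2 * \<xi>) m"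
    proof -
      assume eq: "(\<Sum>j = 0..?k. M j) = (\<Sum>i = 0..m. 2 * (fps_nth \<xi> i * fps_nth A (m - i)))
        + (\<Sum>i = 0..m. - (2 * \<kappa>) * (fps_nth \<xi> i * fps_nth A2 (m - i)))"
      have "2 * A * \<xi> - fps_const (2 * \<kappa>) * A2 * \<xi>
          = fps_const 2 * (\<xi> * A) - fps_const (2 * \<kappa>) * (\<xi> * A2)"
        by (simp add: numeral_fps_const mult_ac)
      then have "fps_nth (2 * A * \<xi> - fps_const (2 * \<kappa>) * A2 * \<xi>) m
          = 2 * fps_nth (\<xi> * A) m - (2 * \<kappa>) * fps_nth (\<xi> * A2) m"
        by (simp only: fps_sub_nth fps_mult_left_const_nth)
      then show ?thesis
        unfolding eq fps_mult_nth[of \<xi>] by (simp add: sum_distrib_left sum_negf)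
    qed
    have "absval (T j - M j) \<le> E" if j: "j \<in> {0..?k}" for j
    proof (cases "q dvd j")
      case True
      then obtain i where i: "j = q * i" ..
      have "i \<le> m"
      proof (rule ccontr)
        assume "\<not> i \<le> m"
        then have "q * (m + 1) \<le> q * i" by (intro mult_le_mono2) simp
        then show False using j i q5 by simp
      qed
      then have kj: "?k - j = Suc (q * (m - i))" using i by (simp add: diff_mult_distrib2 Suc_diff_le)
      have "CHAR('a) dvd q * (m - i)" using p_dvd by simp
      then have e2v: "fps_nth (e\<^sup>2) (?k - j) = 2 * fps_nth A (m - i)"
        unfolding kj A_def fps_section_nth by (rule e_square_Suc) (use p_ge_5 in simp)
      then have "T j - M j = 2 * fps_nth A (m - i) * fps_nth \<xi> i * (lam ^ (q * i) - 1)"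
      proof -
        have "T j = 2 * fps_nth A (m - i) * (lam ^ (q * i) * fps_nth \<xi> i)"
          unfolding T_def e2v by (simp only: i G_\<xi>)
        moreover have "M j = 2 * (fps_nth \<xi> i * fps_nth A (m - i))" using i q5 by (simp add: M_def)
        ultimately show ?thesis by (simp add: algebra_simps)
      qed
      also have "absval \<dots> \<le> 1 * 1 * 1 * E"
        unfolding absval_mult using units bd_e bd_\<xi> lam_qm E
        by (intro mult_mono) (auto simp: A_def)
      finally show ?thesis by simp
    next
      case nd: False
      show ?thesis
      proof (cases "j mod q = 1")
        case True
        define i where "i = j div q"
        have i: "j = Suc (q * i)" using True div_mult_mod_eq[of j q] by (simp add: i_def mult.commute)
        have "i \<le> m" using j i q5 by simp
        then have kj: "?k - j = q * (m - i)" using i by (simp add: diff_mult_distrib2)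
        have "T j - M j = fps_nth A2 (m - i) * (fps_nth G (Suc (q * i)) + 2 * \<kappa> * fps_nth \<xi> i)"
          using nd True unfolding T_def M_def kj A2_def i_def[symmetric]
          by (simp add: i algebra_simps)
        also have "absval \<dots> \<le> 1 * E"
          unfolding absval_mult using bd_e2 G_1 E by (intro mult_mono) (auto simp: A2_def)
        finally show ?thesis by simp
      next
        case False
        then show ?thesis using G_other[of j m] nd j by (simp add: T_def M_def)
      qed
    qed
    then have "absval (\<Sum>j = 0..?k. T j - M j) \<le> E" using E by (intro absval_sum_bound) auto
    then show ?thesis unfolding T M[symmetric] by (simp add: sum_subtractf)
  qed

  define \<Phi> where "\<Phi> = fps_const lam * fps_dlog \<xi> + 2 * A - fps_const (2 * \<kappa>) * A2"
  have \<xi>0: "fps_nth \<xi> 0 = 1" using g_1 by (simp add: \<xi>_def)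
  have \<Phi>\<xi>: "\<Phi> * \<xi> = fps_const lam * (fps_X * fps_deriv \<xi>) + (2 * A * \<xi> - fps_const (2 * \<kappa>) * A2 * \<xi>)"
    using fps_dlog_mult_self[of \<xi>] \<xi>0 by (simp add: \<Phi>_def algebra_simps)
  have "geom_bound 1 E (\<Phi> * \<xi>)"
  proof (rule geom_boundI)
    fix m
    let ?k = "Suc (q * m)"
    let ?R = "fps_nth (2 * A * \<xi> - fps_const (2 * \<kappa>) * A2 * \<xi>) m"
    have X: "fps_nth (fps_X * fps_deriv \<xi>) m = of_nat m * fps_nth \<xi> m" by (cases m) auto
    let ?t = "lam ^ (q * m) - 1 - of_nat m * a"
    have t: "absval ?t \<le> E * E"
      using absval_power_minus_one_approx[of "lam ^ q" E m] abs_a lam_q E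
      by (simp add: power_mult power2_eq_square)
    \<comment> \<open>The perturbation equation at \<open>Suc (q * m)\<close>: its divisor
      \<open>lam ^ (q * m) - 1\<close> is \<open>m * a\<close> modulo \<open>E * E\<close>, so
      division by \<open>a\<close> turns it into the derivation \<open>z d/dz\<close> applied to
      \<open>\<xi>\<close>.\<close>
    have "a * fps_nth (\<Phi> * \<xi>) m = - lam * ?t * fps_nth \<xi> m
        - ((lam - lam ^ ?k) * fps_nth g ?k - a * fps_nth (e\<^sup>2 * G) ?k)
        - a * (fps_nth (e\<^sup>2 * G) ?k - ?R)"
      unfolding \<Phi>\<xi> by (simp add: X \<xi>_def algebra_simps)
    also have "absval \<dots> \<le> E * E"
    proof (rule absval_diff_bound[OF absval_diff_bound[OF _ pert]])
      have "absval lam * absval ?t * absval (fps_nth \<xi> m) \<le> 1 * (E * E) * 1"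
        using t bd_\<xi> absval_lam E by (intro mult_mono) auto
      then show "absval (- lam * ?t * fps_nth \<xi> m) \<le> E * E" by (simp add: absval_mult)
      show "absval (a * (fps_nth (e\<^sup>2 * G) ?k - ?R)) \<le> E * E"
        unfolding absval_mult abs_a using second_order[of m] E by (intro mult_left_mono) auto
    qed
    finally show "absval (fps_nth (\<Phi> * \<xi>) m) \<le> E * 1 ^ m"
      using E by (simp add: absval_mult abs_a)
  qed
  moreover have "geom_bound 1 1 (inverse \<xi>)"
    using bd_\<xi> \<xi>0 by (intro geom_bound_inverse) (auto simp: geom_bound_def absval_one)
  ultimately have "geom_bound 1 (E * 1) (\<Phi> * \<xi> * inverse \<xi>)" by (intro geom_bound_mult) auto
  then have "geom_bound 1 E \<Phi>"
    using \<xi>0 by (simp add: mult.assoc inverse_mult_eq_1')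
  \<comment> \<open>For even \<open>n\<close> the exponent \<open>q * n\<close> is not a power of
    the odd prime \<open>p\<close>, so \<open>A\<close> drops out.\<close>
  then have \<Phi>: "absval (lam * fps_nth (fps_dlog \<xi>) n - 2 * \<kappa> * fps_nth (e\<^sup>2) (q * n)) \<le> E" if "even n" for n
    using geom_boundD[of 1 E \<Phi> n] that
    by (simp add: \<Phi>_def A_def A2_def e_even numeral_fps_const)
  let ?\<rho> = "fps_nth (fps_dlog \<xi>)"
  have E_less: "E < E / \<epsilon>" using E eps by (simp add: less_divide_eq)
  \<comment> \<open>At 2 the logarithmic derivative is at most \<open>E / \<epsilon>\<close>, so at
    \<open>2 * p\<close> it is at most the \<open>p\<close>-th power, hence at most
    \<open>E\<close>. But \<open>A2\<close> is a unit at \<open>2 * p\<close>, and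
    \<open>\<kappa>\<close> has absolute value \<open>E / \<epsilon> > E\<close>.\<close>
  have "absval (2 * \<kappa> * fps_nth (e\<^sup>2) (q * 2)) \<le> 1 * (E / \<epsilon>) * 1"
    unfolding absval_mult using units \<kappa>_bd bd_e2 E eps by (intro mult_mono) auto
  then have "absval (lam * ?\<rho> 2) \<le> E / \<epsilon>"
    using \<Phi>[of 2] E_less absval_add_bound[of "lam * ?\<rho> 2 - 2 * \<kappa> * fps_nth (e\<^sup>2) (q * 2)" "E / \<epsilon>"
        "2 * \<kappa> * fps_nth (e\<^sup>2) (q * 2)"] by simp
  then have "absval (?\<rho> 2) \<le> E / \<epsilon>" by (simp add: absval_mult absval_lam)
  also have "E / \<epsilon> = \<epsilon> ^ (q - 1)" using eps q5 by (simp add: E_def power_diff)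
  finally have "absval (?\<rho> 2) ^ CHAR('a) \<le> (\<epsilon> ^ (q - 1)) ^ CHAR('a)" by (intro power_mono) auto
  also have "\<dots> \<le> E"
  proof -
    have "(q - 1) * 2 \<le> (q - 1) * CHAR('a)" using p_gt_1 by (intro mult_le_mono2) simp
    then have "q \<le> (q - 1) * CHAR('a)" using q5 by linarith
    then show ?thesis unfolding E_def power_mult[symmetric] using eps by (intro power_decreasing) auto
  qed
  finally have "absval (?\<rho> (CHAR('a) * 2)) \<le> E"
    using frobenius_fixed_dlog[OF char \<xi>0] by (simp add: frobenius_fixed_def absval_power)
  then have "absval (lam * ?\<rho> (CHAR('a) * 2)) \<le> E" by (simp add: absval_mult absval_lam)
  then have "absval (2 * \<kappa> * fps_nth (e\<^sup>2) (q * (CHAR('a) * 2))) \<le> E"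
    using \<Phi>[of "CHAR('a) * 2"] absval_diff_bound[of "lam * ?\<rho> (CHAR('a) * 2)" E
        "lam * ?\<rho> (CHAR('a) * 2) - 2 * \<kappa> * fps_nth (e\<^sup>2) (q * (CHAR('a) * 2))"] by simp
  moreover have "fps_nth (e\<^sup>2) (q * (CHAR('a) * 2)) = (d (Suc s))\<^sup>2"
    using e_square_double_power[of "Suc s"] by (simp add: q mult_ac)
  moreover have "absval (d (Suc s)) = 1" using d_eq[OF b_eq] by (simp add: c1)
  ultimately show False
    using E_less units by (simp add: absval_mult absval_power \<kappa>_bd)
qed

end

section \<open>Proof of the main theorem\<close>

lemma geom_bound_normalized_mono:
  assumes "geom_bound R (1 / R) h" "fps_nth h 0 = 0" "0 < R" "R \<le> R'"
  shows "geom_bound R' (1 / R') h"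
proof (rule geom_boundI)
  fix n
  show "absval (fps_nth h n) \<le> 1 / R' * R' ^ n"
  proof (cases n)
    case (Suc m)
    have "absval (fps_nth h n) \<le> R ^ m" using geom_boundD[OF assms(1), of n] Suc assms(3) by simp
    also have "\<dots> \<le> R' ^ m" using assms by (intro power_mono) auto
    finally show ?thesis using Suc assms by simp
  qed (use assms in simp)
qed

text \<open>Conjugation by the scaling with factor \<open>A / a\<close> multiplies the coefficient
  of degree \<open>n\<close> by the power \<open>n - 1\<close> of that factor.\<close>

lemma rescaled_linearization:
  fixes lam a b A :: "'a::nonarch_field"
  assumes A: "a \<noteq> 0" "A \<noteq> 0" and p: "p > 0"
    and h: "fps_nth h 0 = 0" "fps_nth h 1 = 1" "geom_bound R (1 / R) h" "R \<ge> 1"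
    and conj: "h oo (fps_const lam * fps_X + fps_const a * fps_X\<^sup>2 + fps_const b * fps_X ^ p)
      = fps_const lam * h"
  defines "b' \<equiv> b * (A / a) ^ (p - 1)"
  obtains h' R' where "fps_nth h' 0 = 0" "fps_nth h' 1 = 1" "geom_bound R' (1 / R') h'" "R' \<ge> 1"
    "h' oo (fps_const lam * fps_X + fps_const A * fps_X\<^sup>2 + fps_const b' * fps_X ^ p)
      = fps_const lam * h'"
proof -
  define \<sigma> where "\<sigma> = A / a"
  define f where "f = fps_const lam * fps_X + fps_const a * fps_X\<^sup>2 + fps_const b * fps_X ^ p"
  define f' where "f' = fps_const lam * fps_X + fps_const A * fps_X\<^sup>2 + fps_const b' * fps_X ^ p"
  let ?S = "fps_const \<sigma> * fps_X"
  define h' where "h' = fps_const (1 / \<sigma>) * (h oo ?S)"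
  have \<sigma>: "\<sigma> \<noteq> 0" "A = a * \<sigma>" using A by (auto simp: \<sigma>_def)
  have f0: "fps_nth f 0 = 0" "fps_nth f' 0 = 0" using p by (auto simp: f_def f'_def)
  have h': "fps_nth h' n = \<sigma> ^ n * fps_nth h n / \<sigma>" for n by (simp add: h'_def)
  have "b' * \<sigma> = b * \<sigma> ^ p" using p by (simp add: b'_def \<sigma>_def power_eq_if)
  then have Sf: "?S oo f' = f oo ?S"
  proof -
    have "\<sigma> * fps_nth f' n = \<sigma> ^ n * fps_nth f n" for n
    proof -
      have "\<sigma> * A = \<sigma>\<^sup>2 * a" using \<sigma>(2) by (simp add: power2_eq_square)
      then show ?thesis
        using \<open>b' * \<sigma> = b * \<sigma> ^ p\<close>
        by (auto simp: f_def f'_def fps_X_power_nth fps_X_nth algebra_simps)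
    qed
    then have "fps_const \<sigma> * f' = f oo ?S"
      by (intro fps_ext) (unfold fps_mult_left_const_nth fps_nth_compose_linear)
    then show ?thesis using f0 by (simp add: fps_compose_mult_distrib)
  qed
  have "(h oo ?S) oo f' = h oo (?S oo f')" by (rule fps_compose_assoc[symmetric]) (use f0 in auto)
  also have "\<dots> = (h oo f) oo ?S" unfolding Sf by (rule fps_compose_assoc) (use f0 in auto)
  also have "\<dots> = fps_const lam * (h oo ?S)"
    unfolding f_def conj by (simp add: fps_compose_mult_distrib)
  finally have eq: "h' oo f' = fps_const lam * h'"
    unfolding h'_def using f0 by (simp add: fps_compose_mult_distrib mult_ac)
  define R' where "R' = max 1 (absval \<sigma>) * R"
  have R': "R' \<ge> 1" using h(4) mult_mono[of 1 "max 1 (absval \<sigma>)" 1 R] by (simp add: R'_def)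
  have "geom_bound R' (1 / R') h'"
  proof (rule geom_boundI)
    fix n
    show "absval (fps_nth h' n) \<le> 1 / R' * R' ^ n"
    proof (cases n)
      case (Suc m)
      have "absval (fps_nth h n) \<le> R ^ m" using geom_boundD[OF h(3), of n] Suc h(4) by simp
      then have "absval (fps_nth h' n) \<le> absval \<sigma> ^ m * R ^ m"
        using Suc \<sigma> by (simp add: h' absval_mult absval_divide absval_power mult_left_mono)
      also have "\<dots> \<le> R' ^ m"
        unfolding R'_def power_mult_distrib using h(4) by (intro mult_right_mono power_mono) auto
      finally show ?thesis using Suc R' by simp
    qed (use h(1) h' R' in simp)
  qed
  then show ?thesis
    using eq h R' \<sigma> h'[of 0] h'[of 1] unfolding f'_def by (intro that[of h' R']) auto
qed

lemma not_linearizable_core: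
  fixes lam a b :: "'a::nonarch_field"
  assumes char: "prime CHAR('a)" "CHAR('a) \<ge> 5"
    and lam: "lam \<noteq> 1" "absval (lam - 1) < 1" and a: "a \<noteq> 0"
    and h: "fps_nth h 0 = 0" "fps_nth h 1 = 1" "geom_bound R (1 / R) h" "R \<ge> 1"
    and conj: "h oo (fps_const lam * fps_X + fps_const a * fps_X\<^sup>2 + fps_const b * fps_X ^ CHAR('a))
      = fps_const lam * h"
  shows False
proof -
  define p where "p = CHAR('a)"
  define \<epsilon> where "\<epsilon> = absval (lam - 1)"
  have eps: "0 < \<epsilon>" "\<epsilon> < 1" using lam by (auto simp: \<epsilon>_def)
  have p5: "p \<ge> 5" using char by (simp add: p_def)
  \<comment> \<open>Rescaling changes the radius of \<open>h\<close> in an uncontrolled way, but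
    \<open>linearization_bound\<close> restores the exact bound on any disc where both nonlinear
    terms are at most critical.\<close>
  have reduce: "\<exists>h'. fps_nth h' 0 = 0 \<and> fps_nth h' 1 = 1 \<and> geom_bound c (1 / c) h'
      \<and> h' oo (fps_const lam * fps_X + fps_const A * fps_X\<^sup>2
          + fps_const (b * (A / a) ^ (p - 1)) * fps_X ^ p) = fps_const lam * h'"
    if c: "c \<ge> 1" "absval A \<le> \<epsilon> * c" "absval (b * (A / a) ^ (p - 1)) \<le> \<epsilon> * c ^ (p - 1)" and A: "A \<noteq> 0"
    for A :: 'a and c
  proof -
    let ?b = "b * (A / a) ^ (p - 1)"
    let ?f = "fps_const lam * fps_X + fps_const A * fps_X\<^sup>2 + fps_const ?b * fps_X ^ p"
    obtain h' R' where h': "fps_nth h' 0 = 0" "fps_nth h' 1 = 1" "geom_bound R' (1 / R') h'" "R' \<ge> 1"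
      "h' oo ?f = fps_const lam * h'"
      using rescaled_linearization[OF a A _ h conj] p5 unfolding p_def by auto
    have f: "fps_nth ?f n = (if n = 1 then lam else if n = 2 then A else if n = p then ?b else 0)" for n
      using p5 by (auto simp: fps_X_power_nth)
    interpret linearized_map lam ?f h' c "max R' c" \<epsilon>
    proof
      show "geom_bound c (\<epsilon> / c) (?f - fps_const lam * fps_X)"
      proof (rule geom_boundI)
        fix n
        have "fps_nth (?f - fps_const lam * fps_X) n = (if n = 2 then A else if n = p then ?b else 0)"
          unfolding fps_sub_nth f using p5 by (auto simp: fps_X_def)
        moreover have "\<epsilon> / c * c ^ 2 = \<epsilon> * c" "\<epsilon> / c * c ^ p = \<epsilon> * c ^ (p - 1)"
          using c(1) p5 by (auto simp: power2_eq_square power_eq_if)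
        ultimately show "absval (fps_nth (?f - fps_const lam * fps_X) n) \<le> \<epsilon> / c * c ^ n"
          using c eps by auto
      qed
      show "geom_bound (max R' c) (1 / max R' c) h'"
        using h'(1,3,4) by (rule_tac geom_bound_normalized_mono[of R']) auto
      show "fps_nth ?f 0 = 0" "fps_nth ?f 1 = lam" unfolding f using p5 by auto
      show "h' oo ?f = fps_const lam * h'" by (rule h'(5))
    qed (use char(1) eps h'(1,2) c(1) in \<open>simp_all add: \<epsilon>_def\<close>)
    show ?thesis using linearization_bound h'(1,2,5) by (intro exI[of _ h'] conjI)
  qed
  \<comment> \<open>The size of the coefficient of degree \<open>p\<close> once the quadratic
    coefficient has been scaled to absolute value \<open>\<epsilon>\<close>. It decides which of the
    two terms is critical first.\<close>
  define \<beta> where "\<beta> = absval b * (\<epsilon> / absval a) ^ (p - 1)"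
  show False
  proof (cases "\<beta> \<le> \<epsilon>")
    case True
    obtain h' where h': "fps_nth h' 0 = 0" "fps_nth h' 1 = 1" "geom_bound 1 (1 / 1) h'"
      "h' oo (fps_const lam * fps_X + fps_const (lam - 1) * fps_X\<^sup>2
          + fps_const (b * ((lam - 1) / a) ^ (p - 1)) * fps_X ^ p) = fps_const lam * h'"
      using reduce[of 1 "lam - 1"] True lam(1)
      by (auto simp: \<beta>_def \<epsilon>_def absval_mult absval_power absval_divide)
    show False
      by (rule no_integral_linearization_small[OF char, of lam \<epsilon> "b * ((lam - 1) / a) ^ (p - 1)" h'])
        (use h' eps True in \<open>auto simp: \<epsilon>_def \<beta>_def p_def absval_mult absval_power absval_divide\<close>)
  next
    case False
    \<comment> \<open>In the scaling with quadratic coefficient of size \<open>\<epsilon>\<close>,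
      the term of degree \<open>p\<close> is critical on the disc of radius \<open>1 / t\<close>,
      and \<open>\<alpha>\<close> is the relative size of the quadratic term there.\<close>
    define t where "t = root (p - 1) (\<beta> / \<epsilon>)"
    have t_pow: "t ^ (p - 1) = \<beta> / \<epsilon>"
      unfolding t_def using p5 False eps by (intro real_root_pow_pos2) auto
    have t: "t > 1" unfolding t_def using p5 False eps by (simp add: less_divide_eq)
    define \<alpha> where "\<alpha> = \<epsilon> / t"
    have \<alpha>: "0 < \<alpha>" "\<alpha> < \<epsilon>" using eps t by (auto simp: \<alpha>_def divide_less_eq)
    have "(\<lambda>n. \<epsilon> ^ n) \<longlonglongrightarrow> 0" using eps by (intro LIMSEQ_power_zero) auto
    then have "\<forall>\<^sub>F n in sequentially. \<epsilon> ^ n < \<alpha>" using \<alpha> by (intro order_tendstoD(2)) auto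
    then obtain n where "\<epsilon> ^ n < \<alpha>" unfolding eventually_sequentially by blast
    moreover have "n < p ^ n" using p5 by (intro power_gt_expt) simp
    then have "\<epsilon> ^ (p ^ n) \<le> \<epsilon> ^ n" using eps by (intro power_decreasing) auto
    ultimately have "\<epsilon> ^ (p ^ n) < \<alpha>" by simp
    moreover have "\<not> \<epsilon> ^ (p ^ 0) < \<alpha>" using \<alpha> by simp
    ultimately obtain s where s: "\<alpha> \<le> \<epsilon> ^ (p ^ s)" "\<epsilon> ^ (p ^ Suc s) < \<alpha>"
      using ex_least_nat_less[of "\<lambda>n. \<epsilon> ^ (p ^ n) < \<alpha>" n] by (metis linorder_not_less order_refl)
    define q where "q = p ^ s"
    have q: "q \<ge> 1" using p5 by (simp add: q_def)
    \<comment> \<open>A further scaling by a factor of size \<open>\<epsilon> ^ (q - 1)\<close>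
      keeps \<open>\<alpha>\<close> and turns \<open>t\<close> into \<open>c\<close>. The inequality
      \<open>\<alpha> \<le> \<epsilon> ^ q\<close> is equivalent to \<open>c \<ge> 1\<close>, and
      the exact value of \<open>A\<close> is \<open>lam ^ q - 1\<close>, as the resonant case
      demands.\<close>
    define A where "A = (lam - 1) ^ q"
    have A: "A \<noteq> 0" "absval A = \<epsilon> ^ q" using lam by (auto simp: A_def \<epsilon>_def absval_power)
    define c where "c = t * \<epsilon> ^ (q - 1)"
    have c_pos: "c > 0" using t eps by (simp add: c_def)
    have eq: "\<epsilon> * \<epsilon> ^ (q - 1) = \<epsilon> ^ q" using q by (simp add: power_eq_if)
    then have ct: "\<epsilon> * c = t * \<epsilon> ^ q" by (simp add: c_def mult_ac)
    have "\<epsilon> \<le> t * \<epsilon> ^ q" using s(1) t by (simp add: \<alpha>_def q_def divide_le_eq mult.commute)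
    then have c: "c \<ge> 1" using ct eps by (metis mult_le_cancel_left_pos mult.right_neutral)
    have \<alpha>_eq: "\<alpha> = absval A / c" using A(2) t eps c_pos ct by (simp add: \<alpha>_def field_simps)
    let ?b = "b * (A / a) ^ (p - 1)"
    have b: "absval ?b = \<epsilon> * c ^ (p - 1)"
    proof -
      have "absval ?b = absval b * (\<epsilon> ^ q / absval a) ^ (p - 1)"
        by (simp add: absval_mult absval_power absval_divide A(2))
      also have "\<dots> = \<beta> * (\<epsilon> ^ (q - 1)) ^ (p - 1)"
        unfolding \<beta>_def eq[symmetric] by (simp add: power_mult_distrib power_divide)
      also have "\<beta> = \<epsilon> * t ^ (p - 1)" using t_pow eps by simp
      finally show ?thesis by (simp add: c_def power_mult_distrib)
    qed
    have Ac: "absval A \<le> \<epsilon> * c"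
      using \<alpha>(2) \<alpha>_eq c_pos by (simp add: divide_less_eq)
    obtain h' where h': "fps_nth h' 0 = 0" "fps_nth h' 1 = 1" "geom_bound c (1 / c) h'"
      "h' oo (fps_const lam * fps_X + fps_const A * fps_X\<^sup>2 + fps_const ?b * fps_X ^ p)
        = fps_const lam * h'"
      using reduce[OF c Ac _ A(1)] b by auto
    have "\<alpha> \<le> 1" using \<alpha> eps by simp
    then interpret perturbed_additive_part lam ?b \<epsilon> c A h' \<alpha>
      using char eps c_pos b \<alpha>_eq \<alpha> h' by unfold_locales (auto simp: \<epsilon>_def p_def)
    show False
    proof (cases "\<alpha> = \<epsilon> ^ q")
      case True
      then have "c = 1" using \<alpha>_eq A(2) eps c_pos by (simp add: field_simps)
      moreover have "s \<ge> 1" using True \<alpha>(2) by (cases s) (auto simp: q_def)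
      ultimately show False
        using no_linearization_resonant[of s q] by (simp add: q_def p_def A_def)
    next
      case False
      then show False
        using no_linearization_large[of q s] s by (simp add: q_def p_def)
    qed
  qed
qed

theorem theorem1p6:
  fixes p :: nat and lam :: "'a::complete_nonarch_field"
  assumes "prime p" and "p \<ge> 5" and "CHAR('a) = p"
    and "\<forall>n>0. lam ^ n \<noteq> 1"
    and "absval (1 - lam) < 1"
  shows "\<forall>a\<^sub>1 a\<^sub>p :: 'a.
    linearizable (fps_of_poly (monom lam 1 + monom a\<^sub>1 2 + monom a\<^sub>p p)) \<longleftrightarrow> a\<^sub>1 = 0"
proof (intro allI iffI)
  fix a b :: 'a
  let ?f = "fps_const lam * fps_X + fps_const a * fps_X\<^sup>2 + fps_const b * fps_X ^ p"
  have char: "prime CHAR('a)" "CHAR('a) \<ge> 5" using assms by auto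
  have lam: "lam \<noteq> 1" using assms(4)[rule_format, of 1] by simp
  have lam1: "absval (lam - 1) < 1" using assms(5) by (simp add: absval_minus_commute)
  have f: "fps_of_poly (monom lam 1 + monom a 2 + monom b p) = ?f"
    by (simp add: fps_of_poly_add fps_of_poly_monom)
  have f0: "fps_nth ?f 0 = 0" "fps_nth ?f 1 = lam"
    using assms(2) by (auto simp: fps_X_power_nth)
  {
    assume "linearizable (fps_of_poly (monom lam 1 + monom a 2 + monom b p))"
    then obtain h where h: "locally_analytic h" "fps_nth h 0 = 0" "fps_nth h 1 \<noteq> 0"
      "h oo ?f oo fps_inv h = fps_const lam * fps_X"
      unfolding f linearizable_def f0 by blast
    have "h oo ?f = (h oo ?f) oo (fps_inv h oo h)" using fps_inv[OF h(2,3)] by simp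
    also have "\<dots> = (h oo ?f oo fps_inv h) oo h"
      by (rule fps_compose_assoc) (use h(2) in \<open>auto simp: fps_inv_def\<close>)
    also have "\<dots> = fps_const lam * h"
      unfolding h(4) using h(2) by (simp add: fps_compose_mult_distrib)
    finally have conj: "h oo ?f = fps_const lam * h" .
    define k where "k = fps_const (1 / fps_nth h 1) * h"
    have k: "fps_nth k 0 = 0" "fps_nth k 1 = 1" using h by (auto simp: k_def)
    have "locally_analytic k"
    proof -
      have "(\<lambda>n. absval (fps_nth k n)) = (\<lambda>n. absval (1 / fps_nth h 1) * absval (fps_nth h n))"
        by (simp only: k_def fps_mult_left_const_nth absval_mult)
      moreover have "absval (1 / fps_nth h 1) \<noteq> 0" using h(3) by simp
      then have "conv_radius (\<lambda>n. absval (1 / fps_nth h 1) * absval (fps_nth h n))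
          = conv_radius (\<lambda>n. absval (fps_nth h n))" by (rule conv_radius_cmult_left)
      ultimately show ?thesis
        using h(1) unfolding locally_analytic_def nonarch_conv_radius_def by presburger
    qed
    then obtain R where R: "R \<ge> 1" "geom_bound R (1 / R) k"
      using locally_analytic_imp_geom_bound k by blast
    have "k oo ?f = fps_const lam * k"
      using conj f0(1) by (simp add: k_def fps_compose_mult_distrib mult_ac)
    then show "a = 0"
      using not_linearizable_core[OF char lam lam1 _ k R(2,1)] assms(3) by auto
  }
  assume "a = 0"
  obtain c h where h: "c > 0" "geom_bound c (1 / c) h" "fps_nth h 0 = 0" "fps_nth h 1 \<noteq> 0"
    "h oo (fps_const lam * fps_X + fps_const b * fps_X ^ CHAR('a)) oo fps_inv h
      = fps_const lam * fps_X"
    using additive_linearization[OF char(1) lam1 lam] by blast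
  have "locally_analytic ?f"
  proof -
    have "conv_radius (\<lambda>n. absval (fps_nth ?f n)) = conv_radius (\<lambda>_. 0 :: real)"
    proof (rule conv_radius_cong')
      show "\<forall>\<^sub>F n in sequentially. absval (fps_nth ?f n) = 0"
        using eventually_gt_at_top[of p] by eventually_elim (use assms(2) in \<open>auto simp: fps_X_power_nth\<close>)
    qed
    then show ?thesis by (simp add: locally_analytic_def nonarch_conv_radius_def)
  qed
  moreover have "locally_analytic h" using h(1,2) by (intro geom_bound_imp_locally_analytic)
  ultimately show "linearizable (fps_of_poly (monom lam 1 + monom a 2 + monom b p))"
    unfolding f linearizable_def f0 using h f0(1) \<open>a = 0\<close> assms(3) by auto
qed

end
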